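(* Let $F\in\mathbb{Z}[x_1,\dots,x_n]$ be a homogeneous quartic polynomial and let $W:\mathbb{R}^n\to\mathbb{R}_{\geq 0}$ be a smooth function with compact support. For every real $Q\geq 1$ there are smooth functions $p_q(z)$ of a real variable $z$ ($1\leq q\leq Q$, $q\in\mathbb{N}$; $p_q$ depends only on $q$ and $Q$) satisfying, for every $N\geq 0$, \[ p_q(z)\ll_N 1,\qquad\text{and}\qquad p_q(z)=1+O_N\big((q/Q)^N\big)\ \text{ for } |z|\leq Q^{-2}, \] such that for every $P\geq 1$, every $\theta>0$ and every $N\geq 0$, \[ N_W(F,P)=\sum_{1\leq q\leq Q}\int_{|z|<(qQ)^{-1+\theta}}p_q(z)\,S(q,z)\,dz+O_{N,\theta}(Q^{-N\theta}P^n), \] where the implied constant in the last error term may also depend on the fixed data $n$ and $W$.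
   Context: $e(x)=e^{2\pi i x}$. \[ N_W(F,P)=\sum_{\substack{\mathbf{x}\in\mathbb{Z}^n\\ F(\mathbf{x})=0}}W(\mathbf{x}/P),\qquad S(\alpha)=\sum_{\mathbf{x}\in\mathbb{Z}^n}W(\mathbf{x}/P)\,e(\alpha F(\mathbf{x})),\qquad S(q,z)=\sum_{\substack{1\leq a\leq q\\ \gcd(a,q)=1}}S(a/q+z). \] *)

theory Defs
  imports "HOL-Analysis.Analysis" "HOL-Library.Poly_Mapping"
begin

text \<open>
  The space of real \<open>n\<close>-vectors is \<^const>\<open>Euclidean_space\<close> \<open>n\<close>, whose points are the sequences
  vanishing at all indices \<open>i \<ge> n\<close>. The integer vectors use the same encoding, and the variables
  of a polynomial in \<open>n\<close> variables are indexed by \<open>0, \<dots>, n - 1\<close>. In this way \<open>n\<close> is an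
  ordinary natural number that can be quantified over.
\<close>

definition int_vecs :: "nat \<Rightarrow> (nat \<Rightarrow> int) set" where
  "int_vecs n = {x. \<forall>i\<ge>n. x i = 0}"

text \<open>
  An integer polynomial maps an exponent vector of type \<open>nat \<Rightarrow>\<^sub>0 nat\<close> to its coefficient.
\<close>

type_synonym int_mpoly = "(nat \<Rightarrow>\<^sub>0 nat) \<Rightarrow>\<^sub>0 int"

definition poly_in_vars :: "nat \<Rightarrow> int_mpoly \<Rightarrow> bool" where
  "poly_in_vars n F \<longleftrightarrow> (\<forall>m\<in>Poly_Mapping.keys F. Poly_Mapping.keys m \<subseteq> {..<n})"

text \<open>As usual, the zero polynomial counts as homogeneous of every degree.\<close>

definition homogeneous :: "nat \<Rightarrow> int_mpoly \<Rightarrow> bool" where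
  "homogeneous d F \<longleftrightarrow>
     (\<forall>m\<in>Poly_Mapping.keys F. (\<Sum>i\<in>Poly_Mapping.keys m. Poly_Mapping.lookup m i) = d)"

definition poly_eval :: "int_mpoly \<Rightarrow> (nat \<Rightarrow> int) \<Rightarrow> int" where
  "poly_eval F x = (\<Sum>m\<in>Poly_Mapping.keys F.
     Poly_Mapping.lookup F m * (\<Prod>i\<in>Poly_Mapping.keys m. x i ^ Poly_Mapping.lookup m i))"

definition smooth :: "(real \<Rightarrow> real) \<Rightarrow> bool" where
  "smooth f \<longleftrightarrow> (\<forall>k x. (deriv ^^ k) f field_differentiable (at x))"

definition partial :: "nat \<Rightarrow> ((nat \<Rightarrow> real) \<Rightarrow> real) \<Rightarrow> (nat \<Rightarrow> real) \<Rightarrow> real" where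
  "partial i f x = deriv (\<lambda>t. f (x(i := t))) (x i)"

text \<open>
  Smoothness on real \<open>n\<close>-space: the iterated partial derivatives of all orders exist and are
  continuous. In the list \<open>js\<close> of indices the last entry is differentiated first. Values of \<open>f\<close>
  outside \<^const>\<open>Euclidean_space\<close> \<open>n\<close> play no role.
\<close>

definition smooth_on_space :: "nat \<Rightarrow> ((nat \<Rightarrow> real) \<Rightarrow> real) \<Rightarrow> bool" where
  "smooth_on_space n f \<longleftrightarrow>
     (\<forall>js. set js \<subseteq> {..<n} \<longrightarrow>
        continuous_map (Euclidean_space n) euclideanreal (foldr partial js f) \<and>
        (\<forall>i<n. \<forall>x\<in>topspace (Euclidean_space n).
           (\<lambda>t. foldr partial js f (x(i := t))) field_differentiable (at (x i))))"

definition compact_support :: "nat \<Rightarrow> ((nat \<Rightarrow> real) \<Rightarrow> real) \<Rightarrow> bool" where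
  "compact_support n f \<longleftrightarrow>
     compactin (Euclidean_space n)
       (Euclidean_space n closure_of {x \<in> topspace (Euclidean_space n). f x \<noteq> 0})"

definition weight :: "nat \<Rightarrow> ((nat \<Rightarrow> real) \<Rightarrow> real) \<Rightarrow> bool" where
  "weight n W \<longleftrightarrow> smooth_on_space n W \<and> compact_support n W \<and>
     (\<forall>x\<in>topspace (Euclidean_space n). W x \<ge> 0)"

definition e :: "real \<Rightarrow> complex" where
  "e x = exp (2 * of_real pi * \<i> * of_real x)"

text \<open>
  For \<open>P > 0\<close> and \<open>W\<close> of compact support, the infinite sums below have only finitely many nonzero
  terms.
\<close>

definition N_count :: "nat \<Rightarrow> ((nat \<Rightarrow> real) \<Rightarrow> real) \<Rightarrow> int_mpoly \<Rightarrow> real \<Rightarrow> real" where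
  "N_count n W F P =
     (\<Sum>\<^sub>\<infinity>x | x \<in> int_vecs n \<and> poly_eval F x = 0. W (\<lambda>i. of_int (x i) / P))"

definition exp_sum :: "nat \<Rightarrow> ((nat \<Rightarrow> real) \<Rightarrow> real) \<Rightarrow> int_mpoly \<Rightarrow> real \<Rightarrow> real \<Rightarrow> complex" where
  "exp_sum n W F P \<alpha> =
     (\<Sum>\<^sub>\<infinity>x\<in>int_vecs n. of_real (W (\<lambda>i. of_int (x i) / P)) * e (\<alpha> * of_int (poly_eval F x)))"

definition exp_sum_q ::
    "nat \<Rightarrow> ((nat \<Rightarrow> real) \<Rightarrow> real) \<Rightarrow> int_mpoly \<Rightarrow> real \<Rightarrow> nat \<Rightarrow> real \<Rightarrow> complex" where
  "exp_sum_q n W F P q z =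
     (\<Sum>a | 1 \<le> a \<and> a \<le> q \<and> gcd a q = 1. exp_sum n W F P (of_nat a / of_nat q + z))"

end

theory Submission
  imports Defs "HOL-Computational_Algebra.Polynomial"
begin

text \<open>
The proof is the circle method in the form of Heath-Brown's smooth delta symbol. Let \<open>\<omega>\<close> be a
smooth function supported in \<open>[1/2, 1]\<close> with integral 1. For an integer \<open>m \<noteq> 0\<close> the involution
\<open>d \<mapsto> \<bar>m\<bar> / d\<close> of the divisors of \<open>m\<close> gives
\<open>\<Sum>\<^bsub>d dvd m\<^esub> (\<omega> (d / Q) - \<omega> (\<bar>m\<bar> / (d Q))) = 0\<close>, whereas for \<open>m = 0\<close> the sum over all \<open>d \<ge> 1\<close> of
\<open>\<omega> (d / Q)\<close> is \<open>Q (1 + O(Q\<^sup>-\<^sup>N))\<close>, being a Riemann sum of a smooth function. Writing the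
condition \<open>d dvd m\<close> by additive characters modulo \<open>d\<close> and sorting the characters by their exact
denominator \<open>q\<close> expresses \<open>\<delta>(m)\<close>, up to \<open>O(Q\<^sup>-\<^sup>N)\<close> uniformly in \<open>m\<close>, as
\<open>\<Sum>\<^bsub>q \<le> Q\<^esub> c\<^sub>q(m) a\<^sub>q(m)\<close>, with Ramanujan sums \<open>c\<^sub>q\<close> and explicit real coefficients \<open>a\<^sub>q(m)\<close>. A smooth
cutoff \<open>w (m / Q\<^sup>2)\<close> with \<open>w 0 = 1\<close>, supported in \<open>\<bar>m\<bar> \<le> Q\<^sup>2 / 2\<close>, is what makes the terms with
\<open>q > Q\<close> vanish (\<open>sum_ramanujan_coef\<close>).

The function \<open>p\<^sub>q\<close> is \<open>\<psi>(z) \<Sum>\<^sub>m a\<^sub>q(m) cos (2 \<pi> m z)\<close>, where the integer translates of the bump \<open>\<psi>\<close> form a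
partition of unity. Its Fourier transform at an integer \<open>m\<close> is exactly \<open>a\<^sub>q(m)\<close> (\<open>p_fourier\<close>); only
integral frequencies occur, so that no Fourier inversion on the line is needed. Multiplying by
\<open>e (a m / q)\<close> and summing over the integer vectors \<open>x\<close> with \<open>m = F(x)\<close> gives the theorem, with
a factor \<open>P\<^sup>n\<close> from the number of vectors in the support of the weight.

The analytic properties of \<open>p\<^sub>q\<close> rest on two facts about smooth compactly supported \<open>f\<close>. Its Riemann
sums of mesh \<open>h\<close> approximate the integral to within \<open>O(h\<^sup>N)\<close> (\<open>riemann_sum\<close>), and the exponential
sum \<open>\<Sum>\<^sub>m f (m / M) e (m z)\<close> is \<open>O(M (M \<bar>1 - e z\<bar>)\<^sup>-\<^sup>N)\<close> (\<open>smooth_exp_sum_decay\<close>). The second gives the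
decay \<open>p\<^sub>q(z) = O((q Q \<bar>z\<bar>)\<^sup>-\<^sup>N)\<close> that permits the truncation of the integrals (\<open>p_decay\<close>). The first
gives the boundedness of \<open>p\<^sub>q\<close> (\<open>h_bound\<close>, \<open>coef_sum_bound\<close>) and \<open>p\<^sub>q(z) = 1 + O((q / Q)\<^sup>N)\<close> for
\<open>\<bar>z\<bar> \<le> Q\<^sup>-\<^sup>2\<close> (\<open>kernel_near_0\<close>).
\<close>

section \<open>Functions with bounded derivatives\<close>

text \<open>
\<open>derivs_bounded k B f\<close>: the derivatives of \<open>f\<close> up to order \<open>k\<close> exist, are continuous and are
bounded by \<open>B\<close> in absolute value. Keeping the bound as a parameter makes estimates uniform in families of
functions.
\<close>

primrec derivs_bounded :: "nat \<Rightarrow> real \<Rightarrow> (real \<Rightarrow> real) \<Rightarrow> bool" where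
  "derivs_bounded 0 B f \<longleftrightarrow> continuous_on UNIV f \<and> (\<forall>x. \<bar>f x\<bar> \<le> B)"
| "derivs_bounded (Suc k) B f \<longleftrightarrow> (\<forall>x. \<bar>f x\<bar> \<le> B) \<and>
     (\<exists>f'. (\<forall>x. (f has_real_derivative f' x) (at x)) \<and> derivs_bounded k B f')"

text \<open>
A family of smooth functions all of whose derivatives are bounded uniformly over the index set.
\<close>

definition smooth_family :: "'i set \<Rightarrow> ('i \<Rightarrow> real \<Rightarrow> real) \<Rightarrow> bool" where
  "smooth_family I f \<longleftrightarrow> (\<forall>k. \<exists>B. \<forall>i\<in>I. derivs_bounded k B (f i))"

lemma derivs_bounded_abs_le: "derivs_bounded k B f \<Longrightarrow> \<bar>f x\<bar> \<le> B"
  by (cases k) auto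

lemma derivs_bounded_SucI:
  "(\<And>x. \<bar>f x\<bar> \<le> B) \<Longrightarrow> (\<And>x. (f has_real_derivative f' x) (at x)) \<Longrightarrow> derivs_bounded k B f' \<Longrightarrow>
    derivs_bounded (Suc k) B f"
  by auto

lemma derivs_bounded_nonneg: "derivs_bounded k B f \<Longrightarrow> 0 \<le> B"
  using derivs_bounded_abs_le[of k B f 0] by linarith

lemma derivs_bounded_continuous: "derivs_bounded k B f \<Longrightarrow> continuous_on S f"
proof (cases k)
  case (Suc m)
  assume "derivs_bounded k B f"
  then obtain f' where "\<And>x. (f has_real_derivative f' x) (at x)" by (auto simp: Suc)
  then show ?thesis
    by (intro continuous_at_imp_continuous_on) (auto intro: DERIV_isCont)
qed (auto intro: continuous_on_subset)

lemma derivs_bounded_mono: "derivs_bounded k B f \<Longrightarrow> B \<le> B' \<Longrightarrow> derivs_bounded k B' f"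
proof (induction k arbitrary: f)
  case (Suc k)
  then obtain f' where "\<And>x. (f has_real_derivative f' x) (at x)" "derivs_bounded k B f'" by auto
  moreover have "\<bar>f x\<bar> \<le> B'" for x using derivs_bounded_abs_le[OF Suc.prems(1), of x] Suc.prems(2) by simp
  ultimately show ?case using Suc by (intro derivs_bounded_SucI)
qed (use order_trans in auto)

lemma derivs_bounded_Suc_imp: "derivs_bounded (Suc k) B f \<Longrightarrow> derivs_bounded k B f"
proof (induction k arbitrary: f)
  case 0
  then show ?case using derivs_bounded_continuous[OF 0] by auto
next
  case (Suc k)
  from Suc.prems obtain f' where f': "\<And>x. (f has_real_derivative f' x) (at x)"
    "derivs_bounded (Suc k) B f'" by auto
  with Suc.IH[of f'] Suc.prems show ?case by auto
qed

lemma derivs_bounded_const: "\<bar>c\<bar> \<le> B \<Longrightarrow> derivs_bounded k B (\<lambda>x. c)"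
proof (induction k arbitrary: c)
  case (Suc k)
  have "derivs_bounded k B (\<lambda>x. 0)" using Suc.prems by (intro Suc.IH) auto
  then show ?case using Suc.prems by (auto intro!: exI[of _ "\<lambda>x. 0"])
qed auto

lemma derivs_bounded_add:
  "derivs_bounded k B f \<Longrightarrow> derivs_bounded k B' g \<Longrightarrow> derivs_bounded k (B + B') (\<lambda>x. f x + g x)"
proof (induction k arbitrary: f g)
  case 0
  then show ?case by (auto intro!: continuous_intros order.trans[OF abs_triangle_ineq] add_mono)
next
  case (Suc k)
  from Suc.prems obtain f' g' where *: "\<And>x. (f has_real_derivative f' x) (at x)"
    "derivs_bounded k B f'" "\<And>x. (g has_real_derivative g' x) (at x)" "derivs_bounded k B' g'"
    by auto
  have "\<bar>f x + g x\<bar> \<le> B + B'" for x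
    using derivs_bounded_abs_le[OF Suc.prems(1), of x] derivs_bounded_abs_le[OF Suc.prems(2), of x]
    by linarith
  with * Suc.IH[OF *(2,4)] show ?case
    by (auto intro!: exI[of _ "\<lambda>x. f' x + g' x"] derivative_eq_intros)
qed

lemma derivs_bounded_cmult:
  "derivs_bounded k B f \<Longrightarrow> derivs_bounded k (\<bar>c\<bar> * B) (\<lambda>x. c * f x)"
proof (induction k arbitrary: f)
  case 0
  then show ?case by (auto intro!: continuous_intros mult_left_mono simp: abs_mult)
next
  case (Suc k)
  from Suc.prems obtain f' where *: "\<And>x. (f has_real_derivative f' x) (at x)"
    "derivs_bounded k B f'" by auto
  have "\<bar>c * f x\<bar> \<le> \<bar>c\<bar> * B" for x
    using derivs_bounded_abs_le[OF Suc.prems(1), of x] by (auto simp: abs_mult intro: mult_left_mono)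
  with * Suc.IH[OF *(2)] show ?case
    by (auto intro!: exI[of _ "\<lambda>x. c * f' x"] derivative_eq_intros)
qed

lemma derivs_bounded_mult:
  "derivs_bounded k B f \<Longrightarrow> derivs_bounded k B' g \<Longrightarrow> derivs_bounded k (2 ^ k * (B * B')) (\<lambda>x. f x * g x)"
proof (induction k arbitrary: f g)
  case 0
  have "0 \<le> B" using 0 derivs_bounded_nonneg by blast
  with 0 show ?case by (auto intro!: continuous_intros mult_mono simp: abs_mult)
next
  case (Suc k)
  from Suc.prems obtain f' g' where *: "\<And>x. (f has_real_derivative f' x) (at x)"
    "derivs_bounded k B f'" "\<And>x. (g has_real_derivative g' x) (at x)" "derivs_bounded k B' g'"
    by auto
  have nn: "0 \<le> B" "0 \<le> B'" using Suc.prems derivs_bounded_nonneg by blast+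
  have "\<bar>f x * g x\<bar> \<le> B * B'" for x
    using derivs_bounded_abs_le[OF Suc.prems(1), of x] derivs_bounded_abs_le[OF Suc.prems(2), of x] nn
    by (auto intro!: mult_mono simp: abs_mult)
  moreover have "B * B' \<le> 2 ^ Suc k * (B * B')"
    using nn mult_right_mono[of 1 "2 ^ Suc k" "B * B'"] one_le_power[of "2::real" "Suc k"] by simp
  ultimately have bd: "\<bar>f x * g x\<bar> \<le> 2 ^ Suc k * (B * B')" for x by (meson order_trans)
  have "derivs_bounded k (2 ^ k * (B * B') + 2 ^ k * (B * B')) (\<lambda>x. f' x * g x + f x * g' x)"
    by (intro derivs_bounded_add Suc.IH derivs_bounded_Suc_imp[OF Suc.prems(1)]
        derivs_bounded_Suc_imp[OF Suc.prems(2)] *)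
  then have "derivs_bounded k (2 ^ Suc k * (B * B')) (\<lambda>x. f' x * g x + f x * g' x)"
    by (rule derivs_bounded_mono) simp
  moreover have "((\<lambda>x. f x * g x) has_real_derivative f' x * g x + f x * g' x) (at x)" for x
    using DERIV_mult'[OF *(1,3)] by (simp add: add.commute)
  ultimately show ?case using bd by (intro derivs_bounded_SucI)
qed

lemma derivs_bounded_affine:
  assumes "derivs_bounded k B f" "\<bar>a\<bar> \<le> L" "1 \<le> L"
  shows "derivs_bounded k (L ^ k * B) (\<lambda>x. f (a * x + c))"
  using assms(1)
proof (induction k arbitrary: f)
  case 0
  then have "continuous_on UNIV (f \<circ> (\<lambda>x. a * x + c))"
    by (intro continuous_on_compose) (auto intro!: continuous_intros intro: continuous_on_subset)
  with 0 show ?case by (auto simp: o_def)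
next
  case (Suc k)
  then obtain f' where *: "\<And>x. (f has_real_derivative f' x) (at x)"
    "derivs_bounded k B f'" by auto
  have B: "0 \<le> B" using Suc.prems derivs_bounded_nonneg by blast
  have "\<bar>f (a * x + c)\<bar> \<le> L ^ Suc k * B" for x
  proof -
    have "\<bar>f (a * x + c)\<bar> \<le> 1 * B" using derivs_bounded_abs_le[OF Suc.prems] by simp
    also have "\<dots> \<le> L ^ Suc k * B" using B assms by (intro mult_right_mono one_le_power)
    finally show ?thesis .
  qed
  moreover have "((\<lambda>x. f (a * x + c)) has_real_derivative a * f' (a * x + c)) (at x)" for x
  proof -
    have "((\<lambda>x. a * x + c) has_real_derivative a) (at x)" by (auto intro!: derivative_eq_intros)
    from DERIV_chain2[OF *(1) this] show ?thesis by (simp add: mult.commute)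
  qed
  moreover have "derivs_bounded k (\<bar>a\<bar> * (L ^ k * B)) (\<lambda>x. a * f' (a * x + c))"
    by (intro derivs_bounded_cmult Suc.IH *)
  then have "derivs_bounded k (L ^ Suc k * B) (\<lambda>x. a * f' (a * x + c))"
    by (rule derivs_bounded_mono) (use assms B in \<open>simp add: mult_right_mono mult.assoc\<close>)
  ultimately show ?case by (intro derivs_bounded_SucI)
qed

lemma derivs_bounded_cos: "derivs_bounded k 1 (\<lambda>x. cos (x + c))"
proof (induction k arbitrary: c)
  case (Suc k)
  have "((\<lambda>x. cos (x + c)) has_real_derivative cos (x + (c + pi / 2))) (at x)" for x
    by (auto intro!: derivative_eq_intros simp: add.assoc[symmetric] cos_add sin_add)
  with Suc.IH[of "c + pi / 2"] show ?case by (intro derivs_bounded_SucI) auto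
qed (auto intro!: continuous_intros)

lemma derivs_bounded_diff:
  assumes "derivs_bounded (Suc k) B f" "0 \<le> d"
  shows "derivs_bounded k (d * B) (\<lambda>t. f t - f (t - d))"
  using assms(1)
proof (induction k arbitrary: f)
  case 0
  then obtain f' where *: "\<And>x. (f has_real_derivative f' x) (at x)" "\<And>x. \<bar>f' x\<bar> \<le> B" by auto
  have "\<bar>f t - f (t - d)\<bar> \<le> d * B" for t
  proof -
    have "norm (f t - f (t - d)) \<le> B * norm (t - (t - d))"
      by (rule field_differentiable_bound[of UNIV f f'])
        (use * in \<open>auto intro: has_field_derivative_at_within\<close>)
    then show ?thesis using assms(2) by (simp add: mult.commute)
  qed
  moreover have "continuous_on UNIV f" using derivs_bounded_continuous 0 by blast
  moreover from this have "continuous_on UNIV (\<lambda>t. f (t - d))"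
    by (rule continuous_on_compose2[of UNIV f UNIV "\<lambda>t. t - d"]) (auto intro!: continuous_intros)
  ultimately show ?case by (auto intro: continuous_on_diff)
next
  case (Suc k)
  then obtain f' where *: "\<And>x. (f has_real_derivative f' x) (at x)" "derivs_bounded (Suc k) B f'"
    by auto
  have "\<bar>f t - f (t - d)\<bar> \<le> d * B" for t
  proof -
    have "norm (f t - f (t - d)) \<le> B * norm (t - (t - d))"
      by (rule field_differentiable_bound[of UNIV f f'])
        (use * derivs_bounded_abs_le[OF *(2)] in \<open>auto intro: has_field_derivative_at_within\<close>)
    then show ?thesis using assms(2) by (simp add: mult.commute)
  qed
  moreover have "((\<lambda>t. f t - f (t - d)) has_real_derivative f' t - f' (t - d)) (at t)" for t
  proof -
    have "((\<lambda>t. t - d) has_real_derivative 1) (at t)" by (auto intro!: derivative_eq_intros)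
    from DERIV_diff[OF *(1)[of t] DERIV_chain2[OF *(1) this]] show ?thesis by simp
  qed
  ultimately show ?case using Suc.IH[OF *(2)] by (intro derivs_bounded_SucI)
qed

text \<open>
Hence the support conditions below are inherited by derivatives.
\<close>

lemma derivative_eq_0_outside:
  assumes "\<And>x. (f has_real_derivative f' x) (at x)" "\<And>x. x < a \<or> b < x \<Longrightarrow> f x = 0"
    and "x < a \<or> b < x"
  shows "f' x = (0::real)"
proof -
  define S where "S = {..<a} \<union> {b<..}"
  have "open S" "x \<in> S" using assms(3) by (auto simp: S_def)
  have "(f has_real_derivative 0) (at x)"
    using has_field_derivative_transform_within_open[OF _ \<open>open S\<close> \<open>x \<in> S\<close>, of "\<lambda>_. 0" 0 f] assms(2)
    by (auto simp: S_def)
  with assms(1) show ?thesis using DERIV_unique by blast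
qed

lemma smoothI:
  assumes "\<And>k. \<exists>B. derivs_bounded k B f"
  shows "smooth f"
proof -
  have "(deriv ^^ k) f field_differentiable (at x)" if "derivs_bounded (Suc k) B f" for k B f x
    using that
  proof (induction k arbitrary: f)
    case 0
    then show ?case by (auto simp: field_differentiable_def)
  next
    case (Suc k)
    then obtain f' where *: "\<And>x. (f has_real_derivative f' x) (at x)" "derivs_bounded (Suc k) B f'"
      by auto
    have "deriv f = f'" using *(1) DERIV_imp_deriv by blast
    then show ?case using Suc.IH[OF *(2)] by (simp add: funpow_Suc_right del: funpow.simps)
  qed
  then show ?thesis using assms unfolding smooth_def by blast
qed

lemma smooth_familyD: "smooth_family I f \<Longrightarrow> \<exists>B. \<forall>i\<in>I. derivs_bounded k B (f i)"
  unfolding smooth_family_def by blast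

lemma smooth_family_mult:
  "smooth_family I f \<Longrightarrow> smooth_family I g \<Longrightarrow> smooth_family I (\<lambda>i x. f i x * g i x)"
  unfolding smooth_family_def by (metis derivs_bounded_mult)

lemma smooth_family_add:
  "smooth_family I f \<Longrightarrow> smooth_family I g \<Longrightarrow> smooth_family I (\<lambda>i x. f i x + g i x)"
  unfolding smooth_family_def by (metis derivs_bounded_add)

lemma smooth_family_const: "smooth_family I (\<lambda>i x. c)"
  unfolding smooth_family_def using derivs_bounded_const by blast

lemma smooth_family_sum:
  "finite A \<Longrightarrow> (\<And>a. a \<in> A \<Longrightarrow> smooth_family I (f a)) \<Longrightarrow> smooth_family I (\<lambda>i x. \<Sum>a\<in>A. f a i x)"
  by (induction A rule: finite_induct) (auto intro: smooth_family_const smooth_family_add)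

lemma smooth_family_affine:
  assumes "smooth_family I f" "\<And>i. i \<in> I \<Longrightarrow> \<bar>a i\<bar> \<le> L"
  shows "smooth_family I (\<lambda>i x. f i (a i * x + c i))"
  unfolding smooth_family_def
proof
  fix k
  obtain B where "\<forall>i\<in>I. derivs_bounded k B (f i)" using assms(1) unfolding smooth_family_def by blast
  then have "\<forall>i\<in>I. derivs_bounded k (max 1 L ^ k * B) (\<lambda>x. f i (a i * x + c i))"
    using assms(2) by (force intro: derivs_bounded_affine)
  then show "\<exists>B. \<forall>i\<in>I. derivs_bounded k B (\<lambda>x. f i (a i * x + c i))" by blast
qed

lemma smooth_family_cos:
  assumes "\<And>i. i \<in> I \<Longrightarrow> \<bar>a i\<bar> \<le> L"
  shows "smooth_family I (\<lambda>i x. cos (a i * x))"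
proof -
  have "smooth_family I (\<lambda>i x. cos (x + 0))"
    unfolding smooth_family_def using derivs_bounded_cos by blast
  from smooth_family_affine[OF this, of a L "\<lambda>_. 0"] assms show ?thesis by simp
qed

section \<open>Smooth bump functions\<close>

lemma power_le_fact_times_exp:
  assumes "0 \<le> (s::real)"
  shows "s ^ i \<le> fact i * exp s"
proof -
  have "(\<Sum>n\<in>{i}. inverse (fact n) * s ^ n) \<le> suminf (\<lambda>n. inverse (fact n) * s ^ n)"
    using assms by (intro sum_le_suminf summable_exp) auto
  then show ?thesis by (simp add: exp_def scaleR_conv_of_real field_simps)
qed

lemma poly_times_exp_bounded: "\<exists>B. \<forall>s\<ge>0. \<bar>poly R s * exp (- s)\<bar> \<le> (B::real)"
proof (intro exI allI impI)
  fix s :: real assume s: "0 \<le> s"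
  have "\<bar>poly R s\<bar> \<le> (\<Sum>i\<le>degree R. \<bar>coeff R i\<bar> * s ^ i)"
    unfolding poly_altdef using s by (intro order.trans[OF sum_abs] sum_mono) (simp add: abs_mult)
  also have "\<dots> \<le> (\<Sum>i\<le>degree R. \<bar>coeff R i\<bar> * (fact i * exp s))"
    using s by (intro sum_mono mult_left_mono power_le_fact_times_exp) auto
  also have "\<dots> = (\<Sum>i\<le>degree R. \<bar>coeff R i\<bar> * fact i) * exp s"
    by (simp add: sum_distrib_right mult.assoc)
  finally show "\<bar>poly R s * exp (- s)\<bar> \<le> (\<Sum>i\<le>degree R. \<bar>coeff R i\<bar> * fact i)"
    by (simp add: abs_mult exp_minus field_simps)
qed

text \<open>
The functions \<open>R (1 / x) exp (- 1 / x)\<close> on the positive half-line, extended by 0, form a class that is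
closed under differentiation, so that the boundedness of each of them bounds all derivatives.
\<close>

definition flat :: "real poly \<Rightarrow> real \<Rightarrow> real" where
  "flat R x = (if 0 < x then poly R (1 / x) * exp (- (1 / x)) else 0)"

lemma flat_has_derivative:
  "(flat R has_real_derivative flat ([:0, 0, 1:] * (R - pderiv R)) x) (at x)"
proof (cases x "0::real" rule: linorder_cases)
  case less
  have "(flat R has_real_derivative 0) (at x)"
    by (rule has_field_derivative_transform_within_open[of "\<lambda>_. 0" 0 x "{..<0}"])
      (use less in \<open>auto simp: flat_def\<close>)
  then show ?thesis using less by (simp add: flat_def)
next
  case greater
  have "((\<lambda>x. poly R (1 / x) * exp (- (1 / x))) has_real_derivative
      flat ([:0, 0, 1:] * (R - pderiv R)) x) (at x)"
    using greater
    by (auto intro!: derivative_eq_intros DERIV_chain2[OF poly_DERIV]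
        simp: flat_def field_simps power2_eq_square)
  then show ?thesis
    by (rule has_field_derivative_transform_within_open[of _ _ x "{0<..}"])
      (use greater in \<open>auto simp: flat_def\<close>)
next
  case equal
  obtain B where B: "\<And>s. s \<ge> 0 \<Longrightarrow> \<bar>poly ([:0, 0, 1:] * R) s * exp (- s)\<bar> \<le> B"
    using poly_times_exp_bounded by blast
  have le: "\<bar>flat R y / y\<bar> \<le> B * \<bar>y\<bar>" for y
  proof (cases "0 < y")
    case True
    then have "\<bar>flat R y / y\<bar> = \<bar>poly ([:0, 0, 1:] * R) (1 / y) * exp (- (1 / y))\<bar> * y"
      by (simp add: flat_def abs_mult field_simps)
    also have "\<dots> \<le> B * y" using B[of "1 / y"] True by (intro mult_right_mono) auto
    finally show ?thesis using True by simp
  next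
    case False
    then show ?thesis
      using order.trans[OF abs_ge_zero B[of 0]] by (simp add: flat_def mult_nonneg_nonpos)
  qed
  have "((\<lambda>y. flat R y / y) \<longlongrightarrow> 0) (at 0)"
    by (rule Lim_null_comparison[of _ "\<lambda>y. B * \<bar>y\<bar>"])
      (use le in \<open>auto intro!: tendsto_eq_intros always_eventually\<close>)
  then have "(flat R has_real_derivative 0) (at 0)"
    by (simp add: has_field_derivative_iff flat_def[of R 0])
  then show ?thesis by (simp add: equal flat_def)
qed

lemma flat_derivs_bounded: "\<exists>B. derivs_bounded k B (flat R)"
proof (induction k arbitrary: R)
  case 0
  obtain B where B: "\<And>s. s \<ge> 0 \<Longrightarrow> \<bar>poly R s * exp (- s)\<bar> \<le> B"
    using poly_times_exp_bounded by blast
  have "\<bar>flat R x\<bar> \<le> B" for x using B[of "1 / x"] B[of 0] by (auto simp: flat_def)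
  moreover have "continuous_on UNIV (flat R)"
    by (intro continuous_at_imp_continuous_on ballI DERIV_isCont[OF flat_has_derivative])
  ultimately show ?case by auto
next
  case (Suc k)
  obtain B where B: "derivs_bounded k B (flat ([:0, 0, 1:] * (R - pderiv R)))" using Suc by blast
  obtain B' where B': "\<And>s. s \<ge> 0 \<Longrightarrow> \<bar>poly R s * exp (- s)\<bar> \<le> B'"
    using poly_times_exp_bounded by blast
  have *: "\<bar>flat R x\<bar> \<le> max B B'" for x
    using B'[of "1 / x"] B'[of 0] by (auto simp: flat_def)
  have "derivs_bounded (Suc k) (max B B') (flat R)"
    by (rule derivs_bounded_SucI[OF * flat_has_derivative derivs_bounded_mono[OF B]]) auto
  then show ?case by blast
qed

text \<open>
A smooth function that is positive exactly on the open unit interval.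
\<close>

definition bump :: "real \<Rightarrow> real" where
  "bump x = flat 1 x * flat 1 (1 - x)"

lemma bump_smooth: "smooth_family I (\<lambda>i. bump)"
proof -
  have *: "smooth_family I (\<lambda>i. flat 1)" unfolding smooth_family_def using flat_derivs_bounded by blast
  from smooth_family_mult[OF * smooth_family_affine[OF *, of "\<lambda>_. -1" 1 "\<lambda>_. 1"]]
  show ?thesis by (simp add: bump_def [abs_def])
qed

lemma bump_pos: "0 < x \<Longrightarrow> x < 1 \<Longrightarrow> 0 < bump x"
  by (simp add: bump_def flat_def)

lemma bump_nonneg: "0 \<le> bump x"
  by (simp add: bump_def flat_def)

lemma bump_eq_0: "x \<le> 0 \<or> 1 \<le> x \<Longrightarrow> bump x = 0"
  by (auto simp: bump_def flat_def)

lemma bump_symmetric: "bump (1 - x) = bump x"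
  by (simp add: bump_def)

lemma derivs_bounded_times_id:
  assumes "derivs_bounded k B f" "\<And>x. x < a \<or> b < x \<Longrightarrow> f x = 0"
  shows "\<exists>B'. derivs_bounded k B' (\<lambda>x. x * f x)"
  using assms
proof (induction k arbitrary: f)
  case 0
  then have "\<bar>x * f x\<bar> \<le> (\<bar>a\<bar> + \<bar>b\<bar>) * B" for x
    by (cases "x < a \<or> b < x") (use derivs_bounded_nonneg[OF 0(1)] in \<open>auto simp: abs_mult intro!: mult_mono\<close>)
  with 0 show ?case by (auto intro!: continuous_intros)
next
  case (Suc k)
  then obtain f' where f': "\<And>x. (f has_real_derivative f' x) (at x)" "derivs_bounded k B f'" by auto
  have supp': "x < a \<or> b < x \<Longrightarrow> f' x = 0" for x
    using derivative_eq_0_outside[OF f'(1) Suc.prems(2), of a b] by blast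
  obtain B' where B': "derivs_bounded k B' (\<lambda>x. x * f' x)" using Suc.IH[OF f'(2) supp'] by blast
  have d: "((\<lambda>x. x * f x) has_real_derivative f x + x * f' x) (at x)" for x
    by (auto intro!: derivative_eq_intros f')
  have bd: "\<bar>x * f x\<bar> \<le> (\<bar>a\<bar> + \<bar>b\<bar>) * B" for x
    using derivs_bounded_nonneg[OF Suc.prems(1)] derivs_bounded_abs_le[OF Suc.prems(1), of x] Suc.prems(2)
    by (cases "x < a \<or> b < x") (auto simp: abs_mult intro!: mult_mono)
  let ?C = "max ((\<bar>a\<bar> + \<bar>b\<bar>) * B) (B + B')"
  have "derivs_bounded k (B + B') (\<lambda>x. f x + x * f' x)"
    by (intro derivs_bounded_add derivs_bounded_Suc_imp[OF Suc.prems(1)] B')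
  then have "derivs_bounded (Suc k) ?C (\<lambda>x. x * f x)"
    using d by (intro derivs_bounded_SucI[of _ _ "\<lambda>x. f x + x * f' x"])
      (auto intro: derivs_bounded_mono order.trans[OF bd])
  then show ?case by blast
qed

lemma inverse_outside: "v < 1 \<Longrightarrow> inverse v < 1/2 \<or> 1 < inverse (v::real)"
proof (cases "0 < v")
  case False
  then have "inverse v \<le> 0" by simp
  then show ?thesis by linarith
qed (auto simp: one_less_inverse)

text \<open>
The substitution \<open>u \<mapsto> 1 / u\<close> is smooth on the support of \<open>f\<close>; the powers of \<open>1 / u\<close> are
there to make the claim stable under differentiation. As \<open>inverse 0 = 0\<close> lies outside the support of
\<open>f\<close>, the composite vanishes at \<open>u = 0\<close> as well.
\<close>

lemma derivs_bounded_inversion: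
  assumes "derivs_bounded k B f" "\<And>x. x < 1/2 \<or> 1 < x \<Longrightarrow> f x = 0"
  shows "\<exists>B'. derivs_bounded k B' (\<lambda>u. f (inverse u) * inverse u ^ i)"
proof -
  have bd: "\<bar>f (inverse u) * inverse u ^ i\<bar> \<le> B"
    if f: "derivs_bounded k B f" "\<And>x. x < 1/2 \<or> 1 < x \<Longrightarrow> f x = 0" for k f and i u
  proof (cases "inverse u < 1/2 \<or> 1 < inverse u")
    case True
    then show ?thesis using f derivs_bounded_nonneg[OF f(1)] by auto
  next
    case False
    then have u: "0 < inverse u" "\<bar>inverse u\<bar> \<le> 1" by linarith+
    have "\<bar>f (inverse u) * inverse u ^ i\<bar> \<le> B * 1"
      using u derivs_bounded_abs_le[OF f(1), of "inverse u"] derivs_bounded_nonneg[OF f(1)]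
      unfolding abs_mult power_abs by (intro mult_mono power_le_one) auto
    then show ?thesis by simp
  qed
  have deriv: "((\<lambda>u. f (inverse u) * inverse u ^ i) has_real_derivative
      (- (f' (inverse u) * inverse u ^ (i + 2))) + (- real i) * (f (inverse u) * inverse u ^ (i + 1))) (at u)"
    if f: "\<And>x. (f has_real_derivative f' x) (at x)" "\<And>x. x < 1/2 \<or> 1 < x \<Longrightarrow> f x = 0" for f f' i u
  proof (cases "u < 1")
    case True
    have 1: "f (inverse v) = 0" if "v < 1" for v
      using inverse_outside[OF that] f by blast
    have 2: "f' (inverse u) = 0"
      using inverse_outside[OF True] derivative_eq_0_outside[OF f] by blast
    have "((\<lambda>u. f (inverse u) * inverse u ^ i) has_real_derivative 0) (at u)"
      by (rule has_field_derivative_transform_within_open[of "\<lambda>_. 0" 0 u "{..<1}"])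
        (use True 1 in auto)
    then show ?thesis using 1[OF True] 2 by simp
  next
    case False
    then have u: "u \<noteq> 0" by auto
    have *: "((\<lambda>u. f (inverse u)) has_real_derivative f' (inverse u) * - (inverse u ^ 2)) (at u)"
      by (rule DERIV_chain2[OF f(1)]) (use u in \<open>auto intro!: derivative_eq_intros simp: power2_eq_square\<close>)
    have **: "((\<lambda>u. inverse u ^ i) has_real_derivative - real i * inverse u ^ (i + 1)) (at u)"
    proof (cases i)
      case (Suc n)
      have "((\<lambda>u. inverse u ^ i) has_real_derivative real i * (- (inverse u ^ 2) * inverse u ^ (i - Suc 0))) (at u)"
        by (rule DERIV_power) (use u in \<open>auto intro!: derivative_eq_intros simp: power2_eq_square\<close>)
      moreover have "real i * (- (inverse u ^ 2) * inverse u ^ (i - Suc 0)) = - real i * inverse u ^ (i + 1)"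
        by (simp add: Suc power2_eq_square algebra_simps)
      ultimately show ?thesis by (simp only:)
    qed auto
    show ?thesis
      using DERIV_mult[OF * **] by (simp add: algebra_simps power_add power2_eq_square)
  qed
  show ?thesis using assms
  proof (induction k arbitrary: f i)
    case 0
    have c: "continuous_on UNIV (\<lambda>u. f (inverse u) * inverse u ^ i)"
    proof (intro continuous_at_imp_continuous_on ballI)
      fix u :: real
      show "isCont (\<lambda>u. f (inverse u) * inverse u ^ i) u"
      proof (cases "u < 1")
        case True
        have 1: "f (inverse v) = 0" if "v < 1" for v
          using inverse_outside[OF that] 0 by blast
        have "continuous_on {..<1} (\<lambda>u. f (inverse u) * inverse u ^ i)"
          by (subst continuous_on_cong[OF refl, of _ _ "\<lambda>_. 0"]) (use 1 in auto)
        then show ?thesis using True by (simp add: continuous_on_eq_continuous_at)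
      next
        case False
        have "isCont f (inverse u)" using 0 by (simp add: continuous_on_eq_continuous_at)
        with False show ?thesis
          by (intro continuous_intros isCont_o2[of u inverse f]) auto
      qed
    qed
    show ?case using c bd[OF 0] by auto
  next
    case (Suc k)
    then obtain f' where f': "\<And>x. (f has_real_derivative f' x) (at x)" "derivs_bounded k B f'" by auto
    have supp': "x < 1/2 \<or> 1 < x \<Longrightarrow> f' x = 0" for x
      using derivative_eq_0_outside[OF f'(1) Suc.prems(2), of "1/2" 1] by blast
    obtain B1 where B1: "derivs_bounded k B1 (\<lambda>u. f' (inverse u) * inverse u ^ (i + 2))"
      using Suc.IH[OF f'(2) supp'] by blast
    obtain B2 where B2: "derivs_bounded k B2 (\<lambda>u. f (inverse u) * inverse u ^ (i + 1))"
      using Suc.IH[OF derivs_bounded_Suc_imp[OF Suc.prems(1)] Suc.prems(2)] by blast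
    have "derivs_bounded k (\<bar>- 1\<bar> * B1 + \<bar>- real i\<bar> * B2) (\<lambda>u. (- 1) * (f' (inverse u) * inverse u ^ (i + 2))
        + (- real i) * (f (inverse u) * inverse u ^ (i + 1)))"
      by (intro derivs_bounded_add derivs_bounded_cmult B1 B2)
    then have "derivs_bounded k (B1 + real i * B2) (\<lambda>u. - (f' (inverse u) * inverse u ^ (i + 2))
        + (- real i) * (f (inverse u) * inverse u ^ (i + 1)))" by simp
    then have 2: "derivs_bounded k (max B (B1 + real i * B2)) (\<lambda>u. - (f' (inverse u) * inverse u ^ (i + 2))
        + (- real i) * (f (inverse u) * inverse u ^ (i + 1)))"
      by (rule derivs_bounded_mono) simp
    have "derivs_bounded (Suc k) (max B (B1 + real i * B2)) (\<lambda>u. f (inverse u) * inverse u ^ i)"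
      by (rule derivs_bounded_SucI[OF order.trans[OF bd[OF Suc.prems]] deriv[OF f'(1) Suc.prems(2)] 2]) auto
    then show ?case by blast
  qed
qed

section \<open>Riemann sums of smooth functions\<close>

lemma antiderivative_exists:
  assumes "continuous_on UNIV f"
  shows "\<exists>G. \<forall>x. (G has_real_derivative f x) (at x)"
  using einterval_antiderivative[of "-\<infinity>" "\<infinity>" f] assms
  by (auto simp: has_real_derivative_iff_has_vector_derivative continuous_on_eq_continuous_at)

lemma integral_eq_antiderivative:
  assumes "\<And>x. (G has_real_derivative f x) (at x)" "a \<le> b"
  shows "(f has_integral (G b - G a)) {a..b}"
  using assms
  by (intro fundamental_theorem_of_calculus)
    (auto simp: has_real_derivative_iff_has_vector_derivative intro: has_vector_derivative_at_within)

text \<open>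
The error of a Riemann sum decreases faster than any power of the mesh. As a function of the
shift \<open>t\<close>, the Riemann sum \<open>S\<close> of \<open>f\<close> attains the value \<open>\<integral>f\<close> on \<open>[0, h]\<close>, and its derivative is the
Riemann sum of \<open>f'\<close>, a function of integral 0. Hence each derivative gains a factor \<open>h\<close>.
\<close>

lemma riemann_sum_shifted:
  assumes "derivs_bounded N B f" "\<And>x. x < - A \<or> A < x \<Longrightarrow> f x = 0"
    and h: "0 < h" and A: "a < - A" "A < a + real n * h" "0 \<le> A" and t: "0 \<le> t" "t \<le> h"
  shows "\<bar>h * (\<Sum>j<n. f (a + real j * h + t)) - integral {a..a + real n * h} f\<bar> \<le> 2 * (real n * h) * B * h ^ N"
  using assms(1,2) t
proof (induction N arbitrary: f t)
  case 0
  have B: "\<And>x. \<bar>f x\<bar> \<le> B" "continuous_on UNIV f" using 0 by auto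
  have "\<bar>h * (\<Sum>j<n. f (a + real j * h + t))\<bar> \<le> h * (\<Sum>j<n. B)"
    unfolding abs_mult using h by (intro mult_mono order.trans[OF sum_abs] sum_mono B) (auto simp: sum_nonneg)
  moreover have "\<bar>integral {a..a + real n * h} f\<bar> \<le> B * (a + real n * h - a)"
    using integral_bound[of a "a + real n * h" f B] B h continuous_on_subset[OF B(2)] by auto
  ultimately show ?case by (simp add: algebra_simps)
next
  case (Suc N)
  then obtain f' where f': "\<And>x. (f has_real_derivative f' x) (at x)" "derivs_bounded N B f'" by auto
  have supp': "x < - A \<or> A < x \<Longrightarrow> f' x = 0" for x
    using derivative_eq_0_outside[OF f'(1) Suc.prems(2), of "-A" A] by blast
  obtain G where G: "\<And>x. (G has_real_derivative f x) (at x)"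
    using antiderivative_exists derivs_bounded_continuous[OF Suc.prems(1)] by blast
  have "integral {a..a + real n * h} f' = f (a + real n * h) - f a"
    using integral_eq_antiderivative[OF f'(1)] A by (intro integral_unique) auto
  also have "\<dots> = 0" using Suc.prems(2) A by simp
  finally have int0: "integral {a..a + real n * h} f' = 0" .
  define S where "S s = h * (\<Sum>j<n. f (a + real j * h + s))" for s
  define S' where "S' s = h * (\<Sum>j<n. f' (a + real j * h + s))" for s
  define T where "T s = (\<Sum>j<n. G (a + real j * h + s))" for s
  have S'_le: "\<bar>S' s\<bar> \<le> 2 * (real n * h) * B * h ^ N" if "0 \<le> s" "s \<le> h" for s
    using Suc.IH[OF f'(2) supp' that] int0 by (simp add: S'_def)
  have shift: "((\<lambda>s. F (c + s)) has_real_derivative F' (c + s)) (at s)"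
    if "\<And>x. (F has_real_derivative F' x) (at x)" for F F' c s
    using DERIV_shift[of F "F' (c + s)" s c] that by (simp add: add.commute)
  have dS: "(S has_real_derivative S' s) (at s)" for s
    unfolding S_def S'_def by (intro DERIV_cmult DERIV_sum shift f')
  have dT: "(T has_real_derivative S s / h) (at s)" for s
    unfolding T_def S_def using h by (auto intro!: DERIV_sum shift G)
  \<comment> \<open>The primitive \<open>T\<close> of \<open>S / h\<close> telescopes between 0 and \<open>h\<close>, so that \<open>S\<close> takes its mean value at some \<open>z\<close>.\<close>
  obtain z where z: "0 < z" "z < h" "T h - T 0 = (h - 0) * (S z / h)"
    using MVT2[of 0 h T "\<lambda>s. S s / h"] dT h by blast
  have "T h - T 0 = (\<Sum>j<n. G (a + real (Suc j) * h) - G (a + real j * h))"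
    by (simp add: T_def sum_subtractf algebra_simps)
  also have "\<dots> = G (a + real n * h) - G a"
    using sum_lessThan_telescope[of "\<lambda>j. G (a + real j * h)" n] by simp
  also have "\<dots> = integral {a..a + real n * h} f"
    using integral_eq_antiderivative[OF G] A by (intro integral_unique[symmetric]) auto
  finally have int: "integral {a..a + real n * h} f = S z" using z h by simp
  have "norm (S t - S z) \<le> (2 * (real n * h) * B * h ^ N) * norm (t - z)"
    by (rule field_differentiable_bound[of "{0..h}" S S'])
      (use dS S'_le Suc.prems z in \<open>auto intro: has_field_derivative_at_within\<close>)
  also have "\<dots> \<le> (2 * (real n * h) * B * h ^ N) * h"
    using Suc.prems z derivs_bounded_nonneg[OF Suc.prems(1)] h by (intro mult_left_mono) auto
  finally show ?case unfolding int by (simp add: S_def mult_ac)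
qed

lemma riemann_sum:
  assumes f: "derivs_bounded N B f" "\<And>x. x < - A \<or> A < x \<Longrightarrow> f x = 0"
    and "0 \<le> A" "0 < h" "h \<le> 1" and S: "finite S" "\<And>j::int. f (h * of_int j) \<noteq> 0 \<Longrightarrow> j \<in> S"
  shows "\<bar>h * (\<Sum>j\<in>S. f (h * of_int j)) - integral {-A..A} f\<bar> \<le> 4 * (A + 2) * B * h ^ N"
proof -
  define K where "K = nat \<lceil>A / h\<rceil> + 1"
  have K: "A / h < real K" "real K \<le> A / h + 2"
    using assms by (auto simp: K_def) linarith+
  then have K': "A < real K * h" "A < h * real K" "real K * h \<le> A + 2 * h" using assms by (auto simp: field_simps)
  have "\<bar>h * (\<Sum>j<2 * K. f (- (real K * h) + real j * h + 0)) -
      integral {- (real K * h)..- (real K * h) + real (2 * K) * h} f\<bar> \<le> 2 * (real (2 * K) * h) * B * h ^ N"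
    by (rule riemann_sum_shifted[OF f]) (use assms K' in auto)
  also have "(\<Sum>j<2 * K. f (- (real K * h) + real j * h + 0)) = (\<Sum>j\<in>{- int K..<int K}. f (h * of_int j))"
    by (rule sum.reindex_bij_witness[of _ "\<lambda>j. nat (j + int K)" "\<lambda>j. int j - int K"])
      (auto simp: algebra_simps)
  also have "\<dots> = (\<Sum>j\<in>S \<inter> {- int K..<int K}. f (h * of_int j))"
    by (intro sum.mono_neutral_right) (use S in auto)
  also have "\<dots> = (\<Sum>j\<in>S. f (h * of_int j))"
  proof (intro sum.mono_neutral_left ballI)
    fix j assume j: "j \<in> S - S \<inter> {- int K..<int K}"
    then have "j < - int K \<or> int K \<le> j" by auto
    then have "h * of_int j < - A \<or> A < h * of_int j"
    proof
      assume "j < - int K"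
      then have "h * of_int j \<le> h * of_int (- int K)" using assms by (intro mult_left_mono) auto
      then show ?thesis using K' by (simp add: mult.commute)
    next
      assume "int K \<le> j"
      then have "h * of_int (int K) \<le> h * of_int j" using assms by (intro mult_left_mono) auto
      then show ?thesis using less_le_trans[OF K'(2)] by simp
    qed
    then show "f (h * of_int j) = 0" using f by blast
  qed (use S in auto)
  also have "integral {- (real K * h)..- (real K * h) + real (2 * K) * h} f = integral {-A..A} f"
  proof (rule integral_unique, rule has_integral_on_superset[of f _ "{-A..A}"])
    show "(f has_integral integral {-A..A} f) {-A..A}"
      by (rule integrable_integral[OF integrable_continuous_real])
        (rule derivs_bounded_continuous[OF f(1)])
  qed (use K' f in auto)
  also have "2 * (real (2 * K) * h) * B * h ^ N \<le> 4 * (A + 2) * B * h ^ N"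
    using K' assms derivs_bounded_nonneg[OF f(1)] by (intro mult_right_mono) auto
  finally show ?thesis .
qed

section \<open>Decay of smooth exponential sums\<close>

lemma e_add: "e (x + y) = e x * e y"
  by (simp add: e_def algebra_simps exp_add)

lemma norm_e [simp]: "norm (e x) = 1"
  by (simp add: e_def)

text \<open>
Multiplication of the sum by \<open>1 - e z\<close> amounts to replacing \<open>f t\<close> by \<open>f t - f (t - 1 / M)\<close>, which by the
mean value theorem is smaller by a factor \<open>1 / M\<close>. This replacement widens the support by at most 1,
which accounts for the term \<open>A + real N\<close>.
\<close>

lemma smooth_exp_sum_decay:
  assumes "derivs_bounded N B f" "\<And>x. x < - A \<or> A < x \<Longrightarrow> f x = 0" "0 \<le> A"
    and M: "1 \<le> M"
    and "finite S" "\<And>m::int. f (of_int m / M) \<noteq> 0 \<Longrightarrow> m \<in> S"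
  shows "norm (\<Sum>m\<in>S. of_real (f (of_int m / M)) * e (of_int m * z)) * norm (1 - e z) ^ N
    \<le> (2 * (A + real N) * M + 1) * B * (1 / M) ^ N"
  using assms(1-3,5,6)
proof (induction N arbitrary: f A S B)
  case 0
  have B: "\<And>x. \<bar>f x\<bar> \<le> B" "0 \<le> B" using 0 derivs_bounded_nonneg[OF 0(1)] by auto
  have *: "- A \<le> of_int m / M \<and> of_int m / M \<le> A" if "f (of_int m / M) \<noteq> 0" for m :: int
    using 0(2)[of "of_int m / M"] that by force
  have "norm (\<Sum>m\<in>S. of_real (f (of_int m / M)) * e (of_int m * z))
      = norm (\<Sum>m\<in>S \<inter> {-\<lfloor>A * M\<rfloor>..\<lfloor>A * M\<rfloor>}. of_real (f (of_int m / M)) * e (of_int m * z))"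
  proof (intro arg_cong[where f = norm] sum.mono_neutral_right ballI)
    fix m assume m: "m \<in> S - S \<inter> {-\<lfloor>A * M\<rfloor>..\<lfloor>A * M\<rfloor>}"
    have "f (of_int m / M) = 0"
    proof (rule ccontr)
      assume "f (of_int m / M) \<noteq> 0"
      then have "of_int m \<le> A * M" "of_int (- m) \<le> A * M" using *[of m] M by (auto simp: field_simps)
      then have "m \<le> \<lfloor>A * M\<rfloor>" "- m \<le> \<lfloor>A * M\<rfloor>" by (simp_all only: le_floor_iff)
      then show False using m by auto
    qed
    then show "of_real (f (of_int m / M)) * e (of_int m * z) = 0" by simp
  qed (use 0 in auto)
  also have "\<dots> \<le> (\<Sum>m\<in>S \<inter> {-\<lfloor>A * M\<rfloor>..\<lfloor>A * M\<rfloor>}. B)"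
    by (intro sum_norm_le) (simp add: norm_mult B)
  also have "\<dots> \<le> (\<Sum>m\<in>{-\<lfloor>A * M\<rfloor>..\<lfloor>A * M\<rfloor>}. B)"
    using B by (intro sum_mono2) auto
  also have "\<dots> = (2 * of_int \<lfloor>A * M\<rfloor> + 1) * B"
    using 0 M by simp
  also have "\<dots> \<le> (2 * (A * M) + 1) * B"
    using B by (intro mult_right_mono) auto
  finally show ?case by (simp add: mult.assoc)
next
  case (Suc N)
  define g where "g t = f t - f (t - 1 / M)" for t
  define S' where "S' = S \<union> (\<lambda>m. m + 1) ` S"
  have g: "derivs_bounded N (1 / M * B) g"
    unfolding g_def using M by (intro derivs_bounded_diff Suc.prems) auto
  have gs: "g x = 0" if "x < - (A + 1) \<or> A + 1 < x" for x
  proof -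
    have "1 / M \<le> 1" "0 < 1 / M" using M by auto
    then have "x < - A \<or> A < x" "x - 1 / M < - A \<or> A < x - 1 / M" using that by linarith+
    then show ?thesis using Suc.prems(2) by (simp add: g_def)
  qed
  have shift: "of_int (m + 1) / M - 1 / M = of_int m / M" for m :: int
    by (simp add: add_divide_distrib)
  have g_in: "m \<in> S'" if "g (of_int m / M) \<noteq> 0" for m
  proof (cases "f (of_int m / M) = 0")
    case True
    then have "f (of_int (m - 1) / M) \<noteq> 0" using that shift[of "m - 1"] by (simp add: g_def)
    then have "m - 1 \<in> S" using Suc.prems by blast
    then show ?thesis unfolding S'_def by force
  qed (use Suc.prems in \<open>auto simp: S'_def\<close>)
  have fin: "finite S'" using Suc.prems by (simp add: S'_def)
  have 1: "(\<Sum>m\<in>S. of_real (f (of_int m / M)) * e (of_int m * z)) =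
      (\<Sum>m\<in>S'. of_real (f (of_int m / M)) * e (of_int m * z))"
    by (intro sum.mono_neutral_left fin) (use Suc.prems in \<open>auto simp: S'_def\<close>)
  have "(\<Sum>m\<in>S. of_real (f (of_int (m + 1) / M - 1 / M)) * e (of_int (m + 1) * z)) =
      (\<Sum>m\<in>(\<lambda>m. m + 1) ` S. of_real (f (of_int m / M - 1 / M)) * e (of_int m * z))"
    by (subst sum.reindex) auto
  also have "\<dots> = (\<Sum>m\<in>S'. of_real (f (of_int m / M - 1 / M)) * e (of_int m * z))"
  proof (intro sum.mono_neutral_left fin ballI)
    fix m assume m: "m \<in> S' - (\<lambda>m. m + 1) ` S"
    then have "m - 1 \<notin> S" by force
    then have "f (of_int (m - 1) / M) = 0" using Suc.prems by blast
    then show "of_real (f (of_int m / M - 1 / M)) * e (of_int m * z) = 0"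
      using shift[of "m - 1"] by simp
  qed (auto simp: S'_def)
  finally have 2: "(\<Sum>m\<in>S. of_real (f (of_int m / M)) * e (of_int (m + 1) * z)) =
      (\<Sum>m\<in>S'. of_real (f (of_int m / M - 1 / M)) * e (of_int m * z))"
    unfolding shift .
  have "(\<Sum>m\<in>S. of_real (f (of_int m / M)) * e (of_int m * z)) * (1 - e z) =
      (\<Sum>m\<in>S. of_real (f (of_int m / M)) * e (of_int m * z)) -
      (\<Sum>m\<in>S. of_real (f (of_int m / M)) * e (of_int (m + 1) * z))"
    by (simp add: sum_distrib_right ring_distribs e_add mult.assoc)
  also have "\<dots> = (\<Sum>m\<in>S'. of_real (g (of_int m / M)) * e (of_int m * z))"
    unfolding 1 2 by (simp add: g_def sum_subtractf[symmetric] ring_distribs)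
  finally have eq: "(\<Sum>m\<in>S. of_real (f (of_int m / M)) * e (of_int m * z)) * (1 - e z) =
      (\<Sum>m\<in>S'. of_real (g (of_int m / M)) * e (of_int m * z))" .
  have "norm (\<Sum>m\<in>S. of_real (f (of_int m / M)) * e (of_int m * z)) * norm (1 - e z) ^ Suc N =
      norm (\<Sum>m\<in>S'. of_real (g (of_int m / M)) * e (of_int m * z)) * norm (1 - e z) ^ N"
    unfolding eq[symmetric] norm_mult by simp
  also have "\<dots> \<le> (2 * (A + 1 + real N) * M + 1) * (1 / M * B) * (1 / M) ^ N"
    by (rule Suc.IH[OF g gs]) (use Suc.prems g_in fin in auto)
  also have "\<dots> = (2 * (A + real (Suc N)) * M + 1) * B * (1 / M) ^ Suc N" by simp
  finally show ?case .
qed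

section \<open>The weights\<close>

text \<open>
The auxiliary functions: an even cutoff \<open>w\<close>; a function \<open>b\<close> such that \<open>\<omega> t = t b t\<close> has integral 1; and a
bump \<open>\<psi>\<close> whose translates by integers sum to 1. On \<open>[0, 1]\<close> only \<open>\<psi>\<close> and its translate by 1 can be
nonzero, which is the reason for the form of the last condition.
\<close>

locale delta_weights =
  fixes w b \<psi> :: "real \<Rightarrow> real"
  assumes w_smooth: "\<And>k. \<exists>B. derivs_bounded k B w"
    and w_0: "w 0 = 1"
    and w_even: "\<And>y. w (- y) = w y"
    and w_support: "\<And>y. y < - (1/2) \<or> 1/2 < y \<Longrightarrow> w y = 0"
    and b_smooth: "\<And>k. \<exists>B. derivs_bounded k B b"
    and b_support: "\<And>t. t < 1/2 \<or> 1 < t \<Longrightarrow> b t = 0"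
    and b_moment: "integral {1/2..1} (\<lambda>t. t * b t) = 1"
    and \<psi>_smooth: "\<And>k. \<exists>B. derivs_bounded k B \<psi>"
    and \<psi>_eq_1: "\<And>z. \<bar>z\<bar> \<le> 1/4 \<Longrightarrow> \<psi> z = 1"
    and \<psi>_eq_0: "\<And>z. 3/4 \<le> \<bar>z\<bar> \<Longrightarrow> \<psi> z = 0"
    and \<psi>_partition: "\<And>z. 0 \<le> z \<Longrightarrow> z \<le> 1 \<Longrightarrow> \<psi> z + \<psi> (z - 1) = 1"

lemma smooth_step_exists:
  obtains E :: "real \<Rightarrow> real" where "\<And>k. \<exists>B. derivs_bounded k B E"
    "\<And>x. x \<le> - (1/4) \<Longrightarrow> E x = 0" "\<And>x. 1/4 \<le> x \<Longrightarrow> E x = 1"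
proof -
  define \<eta> where "\<eta> x = bump (2 * x + 1/2)" for x
  have \<eta>: "\<exists>B. derivs_bounded k B \<eta>" for k
    using smooth_family_affine[OF bump_smooth[of "UNIV :: unit set"], of "\<lambda>_. 2" 2 "\<lambda>_. 1/2"]
    by (auto simp: smooth_family_def \<eta>_def [abs_def])
  obtain G where G: "\<And>x. (G has_real_derivative \<eta> x) (at x)"
    using \<eta>[of 0] antiderivative_exists[of \<eta>] by auto
  have const: "G x = G y" if "x \<le> y" "\<And>t. x \<le> t \<Longrightarrow> t \<le> y \<Longrightarrow> \<eta> t = 0" for x y
  proof -
    have "(\<eta> has_integral 0) {x..y}" using that by (intro has_integral_is_0) auto
    from has_integral_unique[OF integral_eq_antiderivative[OF G that(1)] this] show ?thesis by simp
  qed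
  have l: "G x = G (- (1/4))" if "x \<le> - (1/4)" for x
    using that by (intro const) (auto simp: \<eta>_def bump_eq_0)
  have r: "G x = G (1/4)" if "1/4 \<le> x" for x
    using that by (intro const[symmetric]) (auto simp: \<eta>_def bump_eq_0)
  have mono: "G x \<le> G y" if "x \<le> y" for x y
    using DERIV_nonneg_imp_nondecreasing[OF that, of G] G bump_nonneg by (auto simp: \<eta>_def)
  define c where "c = G (1/4) - G (- (1/4))"
  have "G (- (1/4)) < G (1/4)"
  proof (rule DERIV_pos_imp_increasing_open[of "- (1/4)" "1/4" G])
    fix t :: real assume "- (1/4) < t" "t < 1/4"
    then show "\<exists>y. (G has_real_derivative y) (at t) \<and> 0 < y"
      using G[of t] bump_pos[of "2 * t + 1/2"] by (intro exI[of _ "\<eta> t"]) (auto simp: \<eta>_def)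
  qed (auto intro!: continuous_at_imp_continuous_on DERIV_isCont[OF G])
  then have c: "c > 0" by (simp add: c_def)
  define E where "E x = (G x - G (- (1/4))) / c" for x
  have "0 \<le> E x \<and> E x \<le> 1" for x
  proof -
    have "G (- (1/4)) \<le> G x" using l[of x] mono[of "- (1/4)" x] by force
    moreover have "G x \<le> G (1/4)" using r[of x] mono[of x "1/4"] by force
    ultimately show ?thesis using c by (auto simp: E_def c_def field_simps)
  qed
  then have E1: "\<bar>E x\<bar> \<le> 1" for x by simp
  have "\<exists>B. derivs_bounded k B E" for k
  proof -
    obtain B where B: "derivs_bounded k B \<eta>" using \<eta> by blast
    have "derivs_bounded k (\<bar>1 / c\<bar> * B) (\<lambda>x. (1 / c) * \<eta> x)" by (intro derivs_bounded_cmult B)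
    then have 1: "derivs_bounded k (max 1 (\<bar>1 / c\<bar> * B)) (\<lambda>x. (1 / c) * \<eta> x)"
      by (rule derivs_bounded_mono) simp
    have 2: "(E has_real_derivative (1 / c) * \<eta> x) (at x)" for x
      unfolding E_def using c by (auto intro!: derivative_eq_intros G)
    have "derivs_bounded (Suc k) (max 1 (\<bar>1 / c\<bar> * B)) E"
      by (rule derivs_bounded_SucI[OF order.trans[OF E1] 2 1]) simp
    then show ?thesis using derivs_bounded_Suc_imp by blast
  qed
  then show ?thesis
  proof (rule that)
    show "E x = 0" if "x \<le> - (1/4)" for x using l[OF that] by (simp add: E_def)
    show "E x = 1" if "1/4 \<le> x" for x using r[OF that] c unfolding E_def c_def by simp
  qed
qed

lemma delta_weights_exist: "\<exists>w b \<psi>. delta_weights w b \<psi>"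
proof -
  have bump: "\<exists>B. derivs_bounded k B (\<lambda>x. c * bump (a * x + d))" for a c d k
  proof -
    obtain B where "derivs_bounded k B bump"
      using bump_smooth[of "UNIV :: unit set"] by (auto simp: smooth_family_def)
    then show ?thesis
      using derivs_bounded_cmult derivs_bounded_affine[of k B bump a "max 1 \<bar>a\<bar>"] by (metis max.cobounded1 max.cobounded2)
  qed
  have pos: "0 < bump (1/2)" by (rule bump_pos) auto
  define w where "w y = 1 / bump (1/2) * bump (1 * y + 1/2)" for y
  define I where "I = integral {1/2..1} (\<lambda>t. t * bump (2 * t - 1))"
  define b where "b t = 1 / I * bump (2 * t + - 1)" for t
  have "0 < I"
  proof -
    have cont: "continuous_on UNIV (\<lambda>t. t * bump (2 * t - 1))"
      using bump[of 0 1 2 "-1"] by (auto intro!: continuous_on_mult continuous_on_id)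
    obtain G where G: "\<And>t. (G has_real_derivative t * bump (2 * t - 1)) (at t)"
      using antiderivative_exists[OF cont] by blast
    have "G (1/2) < G 1"
    proof (rule DERIV_pos_imp_increasing_open[of "1/2" 1 G])
      fix t :: real assume "1/2 < t" "t < 1"
      then show "\<exists>y. (G has_real_derivative y) (at t) \<and> 0 < y"
        using G[of t] bump_pos[of "2 * t - 1"] by (intro exI[of _ "t * bump (2 * t - 1)"]) auto
    qed (auto intro!: continuous_at_imp_continuous_on DERIV_isCont[OF G])
    moreover have "I = G 1 - G (1/2)"
      unfolding I_def by (intro integral_unique integral_eq_antiderivative G) auto
    ultimately show ?thesis by simp
  qed
  obtain E where E: "\<And>k. \<exists>B. derivs_bounded k B E"
    "\<And>x. x \<le> - (1/4) \<Longrightarrow> E x = 0" "\<And>x. 1/4 \<le> x \<Longrightarrow> E x = 1"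
    using smooth_step_exists by blast
  define \<psi> where "\<psi> z = E (1 * z + 1/2) + (- 1) * E (1 * z + - (1/2))" for z
  have E': "smooth_family (UNIV :: unit set) (\<lambda>_. E)" using E(1) by (auto simp: smooth_family_def)
  note 1 = smooth_family_affine[OF E', of "\<lambda>_. 1" 1 "\<lambda>_. 1/2"]
  note 2 = smooth_family_affine[OF E', of "\<lambda>_. 1" 1 "\<lambda>_. - (1/2)"]
  have "smooth_family (UNIV :: unit set) (\<lambda>_. \<psi>)"
    unfolding \<psi>_def [abs_def]
    by (rule smooth_family_add[OF 1 smooth_family_mult[OF smooth_family_const 2]]) auto
  then have \<psi>: "\<exists>B. derivs_bounded k B \<psi>" for k by (auto simp: smooth_family_def)
  have "delta_weights w b \<psi>"
  proof
    show "\<exists>B. derivs_bounded k B w" "\<exists>B. derivs_bounded k B b" "\<exists>B. derivs_bounded k B \<psi>" for k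
      using bump \<psi> unfolding w_def b_def by blast+
    show "w 0 = 1" using pos by (simp add: w_def)
    show "w (- y) = w y" for y using bump_symmetric[of "y + 1/2"] by (simp add: w_def)
    show "w y = 0" if "y < - (1/2) \<or> 1/2 < y" for y using that by (auto simp: w_def bump_eq_0)
    show "b t = 0" if "t < 1/2 \<or> 1 < t" for t using that by (auto simp: b_def bump_eq_0)
    have "integral {1/2..1} (\<lambda>t. t * b t) = integral {1/2..1} (\<lambda>t. 1 / I * (t * bump (2 * t - 1)))"
      by (simp add: b_def mult_ac)
    also have "\<dots> = 1 / I * I" unfolding I_def by (rule integral_mult_right)
    finally show "integral {1/2..1} (\<lambda>t. t * b t) = 1" using \<open>0 < I\<close> by simp
    show "\<psi> z = 1" if "\<bar>z\<bar> \<le> 1/4" for z using that E(2,3) by (simp add: \<psi>_def abs_le_iff)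
    show "\<psi> z = 0" if "3/4 \<le> \<bar>z\<bar>" for z using that E(2,3) by (cases "z \<ge> 0") (simp_all add: \<psi>_def)
    show "\<psi> z + \<psi> (z - 1) = 1" if "0 \<le> z" "z \<le> 1" for z
      using that E(2,3) by (simp add: \<psi>_def)
  qed
  then show ?thesis by blast
qed

section \<open>Elementary estimates\<close>

lemma sum_inverse_squares_le: "(\<Sum>j=1..n. 1 / real j ^ 2) \<le> 2"
proof -
  have "(\<Sum>j=1..n. 1 / real j ^ 2) \<le> 2 - 1 / real n" if "1 \<le> n"
    using that
  proof (induction n rule: dec_induct)
    case (step n)
    have "1 / real (Suc n) ^ 2 \<le> 1 / real n - 1 / real (Suc n)"
      using step(1) by (simp add: divide_simps power2_eq_square)
    with step show ?case by simp
  qed auto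
  then show ?thesis by (cases "1 \<le> n") (auto intro: order_trans)
qed

lemma sum_symmetric_int:
  "(\<Sum>j\<in>{- int n..int n}. f j) = f 0 + (\<Sum>j=1..n. f (int j) + f (- int j))"
proof (induction n)
  case (Suc n)
  have "{- int (Suc n)..int (Suc n)} = insert (int (Suc n)) (insert (- int (Suc n)) {- int n..int n})"
    by auto
  then have "(\<Sum>j\<in>{- int (Suc n)..int (Suc n)}. f j) = f (int (Suc n)) + (f (- int (Suc n)) + (\<Sum>j\<in>{- int n..int n}. f j))"
    by simp
  with Suc show ?case by (simp add: ac_simps)
qed simp

lemma sum_cauchy_kernel_le:
  assumes M: "1 \<le> M" and K: "0 \<le> K"
  shows "(\<Sum>m\<in>{-K..K::int}. M / (M ^ 2 + of_int m ^ 2)) \<le> (5::real)"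
proof -
  define f where "f m = M / (M ^ 2 + (of_int m)\<^sup>2)" for m :: int
  have f: "f (- m) = f m" for m by (simp add: f_def)
  have one: "(\<Sum>j=1..n. f (int j)) \<le> 2" for n
  proof -
    have "(\<Sum>j=1..n. f (int j)) = (\<Sum>m<n. f (int (Suc m)))"
      by (simp add: sum.atLeast1_atMost_eq)
    also have "\<dots> \<le> (\<Sum>m<n. - (2 * M) / (M + real (Suc m)) - - (2 * M) / (M + real m))"
    proof (rule sum_mono)
      fix m
      have p: "0 < M + real m" using M by simp
      \<comment> \<open>The inequality \<open>(M + m)\<^sup>2 \<le> 2 (M\<^sup>2 + m\<^sup>2)\<close> provides a telescoping majorant.\<close>
      have "(M + real (Suc m)) * (M + real m) \<le> (M + real (Suc m)) ^ 2"
        using p by (simp add: power2_eq_square)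
      also have "\<dots> \<le> 2 * (M ^ 2 + real (Suc m) ^ 2)"
        using sum_squares_bound[of M "real (Suc m)"] by (simp add: power2_sum)
      finally have "(M + real (Suc m)) * (M + real m) \<le> 2 * (M ^ 2 + real (Suc m) ^ 2)" .
      then have "(2 * M) / (2 * (M\<^sup>2 + (real (Suc m))\<^sup>2)) \<le> (2 * M) / ((M + real (Suc m)) * (M + real m))"
        using M p by (intro divide_left_mono mult_pos_pos) (auto intro!: add_pos_nonneg)
      then have "M / (M\<^sup>2 + (real (Suc m))\<^sup>2) \<le> (2 * M) / ((M + real (Suc m)) * (M + real m))"
        by (simp only: mult_divide_mult_cancel_left_if) simp
      also have "\<dots> = - (2 * M) / (M + real (Suc m)) - - (2 * M) / (M + real m)"
        using p by (simp add: field_simps)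
      finally show "f (int (Suc m)) \<le> - (2 * M) / (M + real (Suc m)) - - (2 * M) / (M + real m)"
        by (simp add: f_def)
    qed
    also have "\<dots> = - (2 * M) / (M + real n) - - (2 * M) / (M + real 0)"
      by (rule sum_lessThan_telescope)
    also have "\<dots> \<le> 2" using M by simp
    finally show ?thesis .
  qed
  have "(\<Sum>m\<in>{- int (nat K)..int (nat K)}. f m) = f 0 + 2 * (\<Sum>j=1..nat K. f (int j))"
    unfolding sum_symmetric_int by (simp add: f sum_distrib_left)
  also have "f 0 \<le> 1" using M by (simp add: f_def power2_eq_square)
  finally show ?thesis using one[of "nat K"] K by (simp add: f_def)
qed

text \<open>
The restriction to \<open>\<bar>z\<bar> \<le> 3/4\<close> reflects the support of \<open>\<psi>\<close>; the distance of \<open>e z\<close> from 1 vanishes at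
\<open>\<bar>z\<bar> = 1\<close>.
\<close>

lemma norm_1_minus_e_ge:
  assumes "\<bar>z\<bar> \<le> 3/4"
  shows "\<bar>z\<bar> \<le> norm (1 - e z)"
proof -
  define t where "t = \<bar>z\<bar>"
  have t: "0 \<le> t" "t \<le> 3/4" using assms by (auto simp: t_def)
  have cos_t: "cos (2 * pi * z) = cos (2 * pi * t)" and sin_t: "\<bar>sin (2 * pi * z)\<bar> = \<bar>sin (2 * pi * t)\<bar>"
    by (auto simp: t_def abs_if)
  have "e z = exp (\<i> * of_real (2 * pi * z))" by (simp add: e_def mult_ac)
  then have "Re (1 - e z) = 1 - cos (2 * pi * z)" "Im (1 - e z) = - sin (2 * pi * z)"
    by (simp_all add: Re_exp Im_exp)
  then have n: "1 - cos (2 * pi * t) \<le> norm (1 - e z)" "\<bar>sin (2 * pi * t)\<bar> \<le> norm (1 - e z)"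
    using abs_Re_le_cmod[of "1 - e z"] abs_Im_le_cmod[of "1 - e z"] cos_t sin_t by auto
  \<comment> \<open>Near 0 the imaginary part is large enough, elsewhere the real part.\<close>
  consider "t \<le> 1/6" | "1/6 \<le> t" "t \<le> 1/2" | "1/2 \<le> t" by linarith
  then have "t \<le> norm (1 - e z)"
  proof cases
    case 1
    have "sin 0 - 0 / 2 \<le> sin (2 * pi * t) - (2 * pi * t) / 2"
    proof (rule DERIV_nonneg_imp_nondecreasing[of 0 "2 * pi * t" "\<lambda>x. sin x - x / 2"])
      fix x assume x: "0 \<le> x" "x \<le> 2 * pi * t"
      have "2 * pi * t \<le> pi / 3" using 1 mult_left_mono[OF 1, of "2 * pi"] by simp
      then have "x \<le> pi / 3" using x by linarith
      then have "cos (pi / 3) \<le> cos x" using x by (intro cos_monotone_0_pi_le) auto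
      then show "\<exists>y. ((\<lambda>x. sin x - x / 2) has_real_derivative y) (at x) \<and> 0 \<le> y"
        by (auto intro!: exI[of _ "cos x - 1 / 2"] derivative_eq_intros simp: cos_60)
    qed (use t in auto)
    moreover have "1 * t \<le> pi * t" using t pi_gt3 by (intro mult_right_mono) auto
    ultimately show ?thesis using n by simp
  next
    case 2
    have "pi / 3 \<le> 2 * pi * t" "2 * pi * t \<le> pi" using mult_left_mono[OF 2(1), of "2 * pi"] mult_left_mono[OF 2(2), of "2 * pi"] by auto
    then have "cos (2 * pi * t) \<le> cos (pi / 3)" by (intro cos_monotone_0_pi_le) auto
    then show ?thesis using n 2 by (simp add: cos_60)
  next
    case 3
    have "2 * pi * (1/4) \<le> 2 * pi * (1 - t)" "2 * pi * (1 - t) \<le> 2 * pi * (1/2)"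
      using 3 t by (auto intro!: mult_left_mono)
    then have "cos (2 * pi * (1 - t)) \<le> cos (pi / 2)" by (intro cos_monotone_0_pi_le) auto
    moreover have "cos (2 * pi * (1 - t)) = cos (2 * pi * t)"
      by (simp add: algebra_simps cos_diff)
    ultimately show ?thesis using n t by simp
  qed
  then show ?thesis by (simp add: t_def)
qed

section \<open>The coefficients\<close>

context delta_weights
begin

definition \<omega> :: "real \<Rightarrow> real" where "\<omega> t = t * b t"

text \<open>
The even extension of \<open>\<omega>\<close>.
\<close>

definition \<Omega> :: "real \<Rightarrow> real" where "\<Omega> t = \<omega> \<bar>t\<bar>"

lemma \<omega>_support: "t < 1/2 \<or> 1 < t \<Longrightarrow> \<omega> t = 0"
  using b_support by (simp add: \<omega>_def)

lemma \<omega>_smooth: "\<exists>B. derivs_bounded k B \<omega>"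
  using b_smooth[of k] derivs_bounded_times_id[where f=b, OF _ b_support] unfolding \<omega>_def [abs_def] by blast

lemma \<Omega>_smooth: "\<exists>B. derivs_bounded k B \<Omega>"
proof -
  obtain B where B: "derivs_bounded k B \<omega>" using \<omega>_smooth by blast
  have "\<Omega> t = \<omega> t + \<omega> (- 1 * t + 0)" for t
    using \<omega>_support[of t] \<omega>_support[of "-t"] by (cases "t \<ge> 0") (auto simp: \<Omega>_def)
  then have "\<Omega> = (\<lambda>t. \<omega> t + \<omega> (- 1 * t + 0))" by blast
  moreover have "derivs_bounded k (B + 1 ^ k * B) (\<lambda>t. \<omega> t + \<omega> (- 1 * t + 0))"
    by (intro derivs_bounded_add derivs_bounded_affine B) auto
  ultimately show ?thesis by metis
qed

lemma \<Omega>_support: "t < - 1 \<or> 1 < t \<Longrightarrow> \<Omega> t = 0"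
  by (auto simp: \<Omega>_def intro: \<omega>_support)

text \<open>
The range of summation over \<open>j\<close>. With \<open>x = q / Q\<close> it consists of the \<open>j \<ge> 1\<close> such that the multiple \<open>q j\<close> of
\<open>q\<close> is at most \<open>Q\<close>.
\<close>

definition J :: "real \<Rightarrow> nat set" where "J x = {1..nat \<lfloor>1 / x\<rfloor>}"

lemma J_iff: "0 < x \<Longrightarrow> j \<in> J x \<longleftrightarrow> 1 \<le> j \<and> x * real j \<le> 1"
proof -
  assume x: "0 < x"
  have "j \<le> nat \<lfloor>1 / x\<rfloor> \<longleftrightarrow> int j \<le> \<lfloor>1 / x\<rfloor>" using x by (simp add: le_nat_iff)
  also have "\<dots> \<longleftrightarrow> x * real j \<le> 1" using x by (simp add: le_floor_iff field_simps)
  finally show ?thesis by (auto simp: J_def)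
qed

lemma finite_J [simp]: "finite (J x)" by (simp add: J_def)

text \<open>
Heath-Brown's function \<open>h(x, y)\<close>. He sums over all \<open>j \<ge> 1\<close>; for \<open>\<bar>y\<bar> \<le> 1/2\<close>, the only range that matters here,
the terms with \<open>x j > 1\<close> vanish.
\<close>

definition h :: "real \<Rightarrow> real \<Rightarrow> real" where
  "h x y = (\<Sum>j\<in>J x. (\<omega> (x * real j) - \<omega> (\<bar>y\<bar> / (x * real j))) / (x * real j))"

text \<open>
This is the integral of \<open>\<omega> t / t\<close>. For \<open>\<bar>y\<bar> \<ge> x\<close> the two halves of \<open>h x y\<close> are each close to \<open>K / x\<close>, and
the estimates depend on the cancellation of these main terms.
\<close>

definition K where "K = integral {-1..1} b"

lemma riemann_b: "\<exists>C\<ge>0. \<forall>x. 0 < x \<and> x \<le> 1 \<longrightarrow> \<bar>x * (\<Sum>j\<in>J x. b (x * real j)) - K\<bar> \<le> C * x ^ N"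
proof -
  obtain B where B: "derivs_bounded N B b" using b_smooth by blast
  have supp: "x < - 1 \<or> 1 < x \<Longrightarrow> b x = 0" for x by (rule b_support) auto
  have "\<bar>x * (\<Sum>j\<in>J x. b (x * real j)) - K\<bar> \<le> 4 * (1 + 2) * B * x ^ N" if x: "0 < x" "x \<le> 1" for x
  proof -
    have "j \<in> int ` J x" if "b (x * of_int j) \<noteq> 0" for j
    proof -
      from that have 1: "1/2 \<le> x * of_int j" "x * of_int j \<le> 1" using b_support[of "x * of_int j"] by linarith+
      then have "0 < x * of_int j" by simp
      then have "0 < j" using x by (simp add: zero_less_mult_iff)
      then have "j = int (nat j)" "nat j \<in> J x" using 1 x by (auto simp: J_iff)
      then show ?thesis by blast
    qed
    from riemann_sum[where A=1, OF B supp _ x _ this]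
    show ?thesis by (simp add: sum.reindex K_def)
  qed
  then show ?thesis using derivs_bounded_nonneg[OF B] by (intro exI[of _ "4 * (1 + 2) * B"]) auto
qed

text \<open>
In terms of \<open>u = x j / \<bar>y\<bar>\<close>, the second half of \<open>h\<close> is \<open>1 / \<bar>y\<bar>\<close> times the sum of the values \<open>b_inv u\<close>.
\<close>

definition b_inv :: "real \<Rightarrow> real" where "b_inv u = b (inverse u) * inverse u ^ 2"

lemma b_inv_smooth: "\<exists>B. derivs_bounded k B b_inv"
  using b_smooth[of k] derivs_bounded_inversion[where f=b, OF _ b_support] unfolding b_inv_def [abs_def] by blast

lemma b_inv_support: "u < 1 \<or> 2 < u \<Longrightarrow> b_inv u = 0"
proof -
  assume "u < 1 \<or> 2 < u"
  then have "inverse u < 1/2 \<or> 1 < inverse u"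
    using inverse_outside[of u] less_imp_inverse_less[of 2 u] by auto
  then show ?thesis using b_support by (simp add: b_inv_def)
qed

lemma integral_b_inv: "integral {-2..2} b_inv = K"
proof -
  obtain G where G: "\<And>x. (G has_real_derivative b x) (at x)"
    using b_smooth[of 0] antiderivative_exists[of b] by auto
  have 1: "(b has_integral (G 1 - G (1/2))) {1/2..1}"
    by (rule integral_eq_antiderivative[OF G]) simp
  have "(b has_integral (G 1 - G (1/2))) {-1..1}"
    by (rule has_integral_on_superset[OF 1]) (use b_support in auto)
  then have K: "K = G 1 - G (1/2)" unfolding K_def by (rule integral_unique)
  have "(b_inv has_integral (- G (inverse 2) - - G (inverse 1))) {1..2}"
  proof (rule fundamental_theorem_of_calculus)
    fix u :: real assume u: "u \<in> {1..2}"
    have "((\<lambda>u. G (inverse u)) has_real_derivative b (inverse u) * - (inverse u ^ 2)) (at u)"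
      by (rule DERIV_chain2[OF G]) (use u in \<open>auto intro!: derivative_eq_intros simp: power2_eq_square\<close>)
    from DERIV_minus[OF this] have "((\<lambda>u. - G (inverse u)) has_real_derivative b_inv u) (at u)"
      by (simp add: b_inv_def)
    then show "((\<lambda>u. - G (inverse u)) has_vector_derivative b_inv u) (at u within {1..2})"
      by (simp add: has_real_derivative_iff_has_vector_derivative has_vector_derivative_at_within)
  qed simp
  then have 2: "(b_inv has_integral K) {1..2}" by (simp add: K inverse_eq_divide)
  have "(b_inv has_integral K) {-2..2}"
    by (rule has_integral_on_superset[OF 2]) (use b_inv_support in auto)
  then show ?thesis by (rule integral_unique)
qed

text \<open>
The first half of \<open>h x y\<close>, which does not depend on \<open>y\<close>.
\<close>

definition \<kappa> :: "real \<Rightarrow> real" where "\<kappa> x = (\<Sum>j\<in>J x. b (x * real j))"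

lemma h_eq:
  assumes "0 < x"
  shows "h x y = \<kappa> x - (\<Sum>j\<in>J x. \<omega> (\<bar>y\<bar> / (x * real j)) / (x * real j))"
proof -
  have "\<omega> (x * real j) / (x * real j) = b (x * real j)" if "j \<in> J x" for j
    using that assms by (auto simp: \<omega>_def J_iff)
  then show ?thesis
    by (simp add: h_def \<kappa>_def diff_divide_distrib sum_subtractf)
qed

lemma h_eq_b_inv:
  assumes "0 < x" "y \<noteq> 0"
  shows "h x y = \<kappa> x - (\<Sum>j\<in>J x. b_inv (x / \<bar>y\<bar> * real j)) / \<bar>y\<bar>"
proof -
  have "\<omega> (\<bar>y\<bar> / (x * real j)) / (x * real j) = b_inv (x / \<bar>y\<bar> * real j) / \<bar>y\<bar>" if "j \<in> J x" for j
    using that assms by (auto simp: \<omega>_def b_inv_def J_iff field_simps power2_eq_square)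
  then show ?thesis by (simp add: h_eq[OF assms(1)] sum_divide_distrib)
qed

text \<open>
For \<open>\<bar>y\<bar> < x\<close> at most one term of the second half of \<open>h\<close> is nonzero and the trivial bound \<open>O(1 / x)\<close> suffices.
For \<open>\<bar>y\<bar> \<ge> x\<close> both halves are Riemann sums, of mesh \<open>x\<close> and \<open>s = x / \<bar>y\<bar>\<close>, for the same integral \<open>K\<close>.
The error \<open>O(s\<^sup>2)\<close> for the second sum is what makes the resulting bound summable over \<open>m\<close>,
without a logarithm.
\<close>

lemma h_bound:
  "\<exists>C\<ge>0. \<forall>x y. 0 < x \<and> x \<le> 1 \<and> \<bar>y\<bar> \<le> 1/2 \<longrightarrow> \<bar>h x y\<bar> \<le> C * (1 + x / (x ^ 2 + y ^ 2))"
proof -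
  obtain C1 where C1: "0 \<le> C1" "\<And>x. 0 < x \<Longrightarrow> x \<le> 1 \<Longrightarrow> \<bar>x * \<kappa> x - K\<bar> \<le> C1 * x"
    using riemann_b[of 1] by (auto simp: \<kappa>_def)
  obtain B where B: "derivs_bounded 2 B b_inv" using b_inv_smooth by blast
  have B0: "0 \<le> B" "\<And>u. \<bar>b_inv u\<bar> \<le> B" using derivs_bounded_nonneg[OF B] derivs_bounded_abs_le[OF B] by auto
  define C2 where "C2 = 4 * (2 + 2) * B"
  define C where "C = 2 * (\<bar>K\<bar> + C1 + 2 * B + C2)"
  have C2: "0 \<le> C2" using B0 by (simp add: C2_def)
  have C: "0 \<le> C" using C1 B0 C2 by (simp add: C_def)
  have twice: "u * (2 * t) \<le> 2 * v * t" if "0 \<le> t" "u \<le> v" for u v t :: real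
    using mult_right_mono[OF that(2,1)] by simp
  have "\<bar>h x y\<bar> \<le> C * (1 + x / (x ^ 2 + y ^ 2))" if x: "0 < x" "x \<le> 1" and y: "\<bar>y\<bar> \<le> 1/2" for x y
  proof (cases "\<bar>y\<bar> < x")
    case True
    have "x * \<bar>\<kappa> x\<bar> = \<bar>x * \<kappa> x\<bar>" using x by (simp add: abs_mult)
    also have "\<dots> \<le> \<bar>K\<bar> + C1 * x" using C1(2)[OF x] by linarith
    also have "\<dots> \<le> \<bar>K\<bar> + C1" using C1 x by (simp add: mult_left_le)
    finally have 1: "\<bar>\<kappa> x\<bar> \<le> (\<bar>K\<bar> + C1) / x" using x by (simp add: field_simps)
    have 2: "\<bar>h x y - \<kappa> x\<bar> \<le> 2 * B / x"
    proof (cases "y = 0")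
      case True
      then show ?thesis using h_eq[OF x(1), of y] \<omega>_support[of 0] B0 x by simp
    next
      case False
      define s where "s = x / \<bar>y\<bar>"
      have s: "1 < s" using \<open>\<bar>y\<bar> < x\<close> False by (simp add: s_def)
      \<comment> \<open>As \<open>s > 1\<close>, only \<open>j = 1\<close> can meet the support of \<open>b_inv\<close>.\<close>
      have "(\<Sum>j\<in>J x. b_inv (s * real j)) = (\<Sum>j\<in>J x \<inter> {1}. b_inv (s * real j))"
      proof (intro sum.mono_neutral_right ballI)
        fix j assume "j \<in> J x - J x \<inter> {1}"
        then have "2 \<le> j" using x by (auto simp: J_iff)
        then have "s * 2 \<le> s * real j" using s by (intro mult_left_mono) auto
        then show "b_inv (s * real j) = 0" using s by (intro b_inv_support) linarith
      qed auto
      also have "\<dots> = b_inv s" using x by (simp add: J_iff)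
      finally have "\<bar>h x y - \<kappa> x\<bar> = \<bar>b_inv s\<bar> / \<bar>y\<bar>"
        using h_eq_b_inv[OF x(1) False] by (simp add: s_def)
      also have "\<dots> \<le> 2 * B / x"
      proof (cases "s \<le> 2")
        case True
        then have "1 / \<bar>y\<bar> \<le> 2 / x" using x False by (simp add: s_def field_simps)
        then have "\<bar>b_inv s\<bar> * (1 / \<bar>y\<bar>) \<le> B * (2 / x)" using B0 by (intro mult_mono) auto
        then show ?thesis by (simp add: mult.commute)
      next
        case False
        then show ?thesis using b_inv_support[of s] B0 x by simp
      qed
      finally show ?thesis .
    qed
    have "x ^ 2 + y ^ 2 \<le> 2 * x ^ 2" using True power_mono[of "\<bar>y\<bar>" x 2] by simp
    then have "1 / x \<le> 2 * (x / (x ^ 2 + y ^ 2))"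
      using x by (simp add: field_simps power2_eq_square add_pos_nonneg)
    have "\<bar>h x y\<bar> \<le> (\<bar>K\<bar> + C1) / x + 2 * B / x" using 1 2 by linarith
    also have "\<dots> = (\<bar>K\<bar> + C1 + 2 * B) * (1 / x)" by (simp add: add_divide_distrib)
    also have "\<dots> \<le> (\<bar>K\<bar> + C1 + 2 * B) * (2 * (x / (x ^ 2 + y ^ 2)))"
      using \<open>1 / x \<le> _\<close> C1 B0 by (intro mult_left_mono) auto
    also have "\<dots> \<le> C * (x / (x ^ 2 + y ^ 2))"
      unfolding C_def using x by (intro twice) (use C2 in auto)
    also have "\<dots> \<le> C * (1 + x / (x ^ 2 + y ^ 2))" using C by (intro mult_left_mono) auto
    finally show ?thesis .
  next
    case False
    then have y0: "y \<noteq> 0" "x \<le> \<bar>y\<bar>" using x by auto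
    define s where "s = x / \<bar>y\<bar>"
    have s: "0 < s" "s \<le> 1" using x y0 by (auto simp: s_def)
    have "j \<in> int ` J x" if "b_inv (s * of_int j) \<noteq> 0" for j
    proof -
      from that have 1: "1 \<le> s * of_int j" "s * of_int j \<le> 2" using b_inv_support[of "s * of_int j"] by linarith+
      then have "0 < s * of_int j" by linarith
      then have "0 < j" using s by (simp add: zero_less_mult_iff)
      moreover have "x * of_int j \<le> 1" using 1 y y0 by (simp add: s_def field_simps)
      ultimately have "j = int (nat j)" "nat j \<in> J x" using x by (auto simp: J_iff)
      then show ?thesis by blast
    qed
    have supp: "u < - 2 \<or> 2 < u \<Longrightarrow> b_inv u = 0" for u by (rule b_inv_support) auto
    from riemann_sum[where A=2, OF B supp _ s _ \<open>\<And>j. b_inv (s * of_int j) \<noteq> 0 \<Longrightarrow> j \<in> int ` J x\<close>]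
    have 1: "\<bar>s * (\<Sum>j\<in>J x. b_inv (s * real j)) - K\<bar> \<le> C2 * s ^ 2"
      by (simp add: sum.reindex integral_b_inv C2_def)
    have "x * h x y = (x * \<kappa> x - K) - (s * (\<Sum>j\<in>J x. b_inv (s * real j)) - K)"
      unfolding h_eq_b_inv[OF x(1) y0(1)] by (simp add: s_def right_diff_distrib)
    then have "x * \<bar>h x y\<bar> \<le> C1 * x + C2 * s ^ 2"
      using 1 C1(2)[OF x] x by (simp add: abs_mult[symmetric, of x, unfolded abs_of_pos[OF x(1)]])
    also have "\<dots> = x * (C1 + C2 * (x / y ^ 2))"
      using y0 by (simp add: s_def field_simps power2_eq_square)
    finally have 2: "\<bar>h x y\<bar> \<le> C1 + C2 * (x / y ^ 2)" using x by simp
    have "x ^ 2 + y ^ 2 \<le> 2 * y ^ 2" using y0 power_mono[of x "\<bar>y\<bar>" 2] x by simp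
    then have "x / y ^ 2 \<le> 2 * (x / (x ^ 2 + y ^ 2))"
      using x y0 by (simp add: field_simps add_pos_nonneg)
    then have "C2 * (x / y ^ 2) \<le> C2 * (2 * (x / (x ^ 2 + y ^ 2)))" using C2 by (intro mult_left_mono)
    also have "\<dots> \<le> C * (x / (x ^ 2 + y ^ 2))" 
      unfolding C_def using x by (intro twice) (use C1 B0 in auto)
    finally have "C2 * (x / y ^ 2) \<le> C * (x / (x ^ 2 + y ^ 2))" .
    moreover have "C1 \<le> C" using C1 B0 C2 by (simp add: C_def)
    ultimately show ?thesis using 2 by (simp add: algebra_simps)
  qed
  with C show ?thesis by blast
qed

text \<open>
The coefficient of \<open>ramanujan_sum q m\<close> in the approximate formula for \<open>\<delta>(m)\<close>.
\<close>

definition coef :: "real \<Rightarrow> nat \<Rightarrow> int \<Rightarrow> real" where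
  "coef Q q m = w (of_int m / Q ^ 2) * h (real q / Q) (of_int m / Q ^ 2) / Q ^ 2"

text \<open>
A finite set that contains all \<open>m\<close> with nonzero \<open>coef Q q m\<close>.
\<close>

definition freqs :: "real \<Rightarrow> int set" where "freqs Q = {- \<lceil>Q ^ 2\<rceil>..\<lceil>Q ^ 2\<rceil>}"

text \<open>
The trigonometric polynomial with the coefficients \<open>coef Q q m\<close>. It is real as these are even in \<open>m\<close>.
\<close>

definition kernel :: "real \<Rightarrow> nat \<Rightarrow> real \<Rightarrow> real" where
  "kernel Q q z = (\<Sum>m\<in>freqs Q. coef Q q m * cos (2 * pi * of_int m * z))"

text \<open>
The weight functions of the theorem.
\<close>

definition p :: "real \<Rightarrow> nat \<Rightarrow> real \<Rightarrow> real" where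
  "p Q q z = \<psi> z * kernel Q q z"

lemma finite_freqs [simp]: "finite (freqs Q)" by (simp add: freqs_def)

lemma in_freqs: "1 \<le> Q \<Longrightarrow> w (of_int m / Q ^ 2) \<noteq> 0 \<Longrightarrow> m \<in> freqs Q"
proof -
  assume Q: "1 \<le> Q" and "w (of_int m / Q ^ 2) \<noteq> 0"
  then have "- (1/2) \<le> of_int m / Q ^ 2" "of_int m / Q ^ 2 \<le> 1/2" using w_support by force+
  then have "of_int (- m) \<le> Q ^ 2" "of_int m \<le> Q ^ 2" using Q by (auto simp: field_simps) 
  then have "- m \<le> \<lceil>Q ^ 2\<rceil>" "m \<le> \<lceil>Q ^ 2\<rceil>" by (metis ceiling_mono ceiling_of_int)+
  then show ?thesis by (auto simp: freqs_def)
qed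

text \<open>
With \<open>M = q Q\<close> the bound for \<open>h\<close> becomes \<open>1 / Q\<^sup>2 + M / (M\<^sup>2 + m\<^sup>2)\<close>, whose sum over \<open>m\<close> is bounded.
\<close>

lemma coef_sum_bound:
  "\<exists>C\<ge>0. \<forall>Q\<ge>1. \<forall>q. 1 \<le> q \<and> real q \<le> Q \<longrightarrow> (\<Sum>m\<in>freqs Q. \<bar>coef Q q m\<bar>) \<le> C"
proof -
  obtain C where C: "0 \<le> C" "\<And>x y. 0 < x \<Longrightarrow> x \<le> 1 \<Longrightarrow> \<bar>y\<bar> \<le> 1/2 \<Longrightarrow> \<bar>h x y\<bar> \<le> C * (1 + x / (x ^ 2 + y ^ 2))"
    using h_bound by blast
  obtain B where B: "derivs_bounded 0 B w" using w_smooth by blast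
  have B0: "0 \<le> B" "\<And>y. \<bar>w y\<bar> \<le> B" using derivs_bounded_nonneg[OF B] B by auto
  have "(\<Sum>m\<in>freqs Q. \<bar>coef Q q m\<bar>) \<le> B * C * 10" if Q: "1 \<le> Q" and q: "1 \<le> q" "real q \<le> Q" for Q q
  proof -
    define M where "M = real q * Q"
    have "1 * 1 \<le> real q * Q" using Q q by (intro mult_mono) auto
    then have M: "1 \<le> M" by (simp add: M_def)
    have "\<bar>coef Q q m\<bar> \<le> B * C * (1 / Q ^ 2 + M / (M ^ 2 + of_int m ^ 2))" for m
    proof (cases "\<bar>of_int m / Q ^ 2\<bar> \<le> 1/2")
      case True
      let ?x = "real q / Q" and ?y = "of_int m / Q ^ 2"
      have "\<bar>coef Q q m\<bar> = \<bar>w ?y\<bar> * \<bar>h ?x ?y\<bar> / Q ^ 2" by (simp add: coef_def abs_mult)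
      also have "\<dots> \<le> B * (C * (1 + ?x / (?x ^ 2 + ?y ^ 2))) / Q ^ 2"
        using B0 Q q True by (intro divide_right_mono mult_mono C) auto
      also have "\<dots> = B * C * (1 / Q ^ 2 + ?x / (?x ^ 2 + ?y ^ 2) / Q ^ 2)"
        by (simp add: algebra_simps add_divide_distrib)
      also have "?x / (?x ^ 2 + ?y ^ 2) / Q ^ 2 = M / (M ^ 2 + of_int m ^ 2)"
      proof -
        have Q4: "Q ^ 4 = Q ^ 2 * Q ^ 2" by (simp flip: power_add)
        have "?x ^ 2 = M ^ 2 / Q ^ 4"
          unfolding M_def using Q by (simp add: power_divide power_mult_distrib field_simps)
        moreover have "?y ^ 2 = of_int m ^ 2 / Q ^ 4"
          unfolding Q4 by (simp add: power_divide power2_eq_square)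
        moreover have "?x / Q ^ 2 = M / Q ^ 4"
          unfolding Q4 M_def using Q by (simp add: power2_eq_square)
        moreover have "?x / (?x ^ 2 + ?y ^ 2) / Q ^ 2 = (?x / Q ^ 2) / (?x ^ 2 + ?y ^ 2)"
          by (simp add: field_simps)
        ultimately have "?x / (?x ^ 2 + ?y ^ 2) / Q ^ 2 = (M / Q ^ 4) / ((M ^ 2 + of_int m ^ 2) / Q ^ 4)"
          by (simp only: add_divide_distrib)
        then show ?thesis using Q by simp
      qed
      finally show ?thesis .
    next
      case False
      then have "w (of_int m / Q ^ 2) = 0" using w_support by (force simp: abs_le_iff)
      then show ?thesis using B0 C M by (simp add: coef_def)
    qed
    then have "(\<Sum>m\<in>freqs Q. \<bar>coef Q q m\<bar>) \<le> (\<Sum>m\<in>freqs Q. B * C * (1 / Q ^ 2 + M / (M ^ 2 + of_int m ^ 2)))"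
      by (intro sum_mono)
    also have "\<dots> = B * C * (real (card (freqs Q)) / Q ^ 2 + (\<Sum>m\<in>freqs Q. M / (M ^ 2 + of_int m ^ 2)))"
      by (simp add: sum_distrib_left[symmetric] sum.distrib)
    also have "\<dots> \<le> B * C * (5 + 5)"
    proof (intro mult_left_mono add_mono)
      have Q2: "1 \<le> Q ^ 2" using Q by simp
      have "real (card (freqs Q)) = 2 * of_int \<lceil>Q ^ 2\<rceil> + 1" using Q2 by (simp add: freqs_def)
      also have "\<dots> \<le> 2 * (Q ^ 2 + 1) + 1" by (intro add_mono mult_left_mono) (auto simp: of_int_ceiling_le_add_one)
      also have "\<dots> \<le> 5 * Q ^ 2" using Q2 by simp
      finally show "real (card (freqs Q)) / Q ^ 2 \<le> 5" using Q by (simp add: field_simps)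
      show "(\<Sum>m\<in>freqs Q. M / (M ^ 2 + of_int m ^ 2)) \<le> 5"
        unfolding freqs_def by (rule sum_cauchy_kernel_le[OF M]) (use Q2 in simp)
    qed (use B0 C in auto)
    finally show ?thesis by simp
  qed
  then show ?thesis using B0 C by (intro exI[of _ "B * C * 10"]) auto
qed

lemma kernel_le_coef_sum: "\<bar>kernel Q q z\<bar> \<le> (\<Sum>m\<in>freqs Q. \<bar>coef Q q m\<bar>)"
  unfolding kernel_def
  by (intro order.trans[OF sum_abs] sum_mono) (simp add: abs_mult mult_left_le)

lemma p_bound: "\<exists>C\<ge>0. \<forall>Q\<ge>1. \<forall>q. 1 \<le> q \<and> real q \<le> Q \<longrightarrow> (\<forall>z. \<bar>p Q q z\<bar> \<le> C)"
proof -
  obtain C where C: "0 \<le> C" "\<And>Q q. 1 \<le> Q \<Longrightarrow> 1 \<le> q \<Longrightarrow> real q \<le> Q \<Longrightarrow> (\<Sum>m\<in>freqs Q. \<bar>coef Q q m\<bar>) \<le> C"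
    using coef_sum_bound by blast
  obtain B where B: "derivs_bounded 0 B \<psi>" using \<psi>_smooth by blast
  have "\<bar>p Q q z\<bar> \<le> B * C" if "1 \<le> Q" "1 \<le> q" "real q \<le> Q" for Q q z
    unfolding p_def abs_mult
    using B C(2)[OF that] derivs_bounded_nonneg[OF B] kernel_le_coef_sum[of Q q z] by (intro mult_mono) auto
  then show ?thesis using C derivs_bounded_nonneg[OF B] by (intro exI[of _ "B * C"]) auto
qed

lemma p_smooth: "smooth (p Q q)"
proof -
  have \<psi>: "smooth_family (UNIV :: unit set) (\<lambda>_. \<psi>)" using \<psi>_smooth by (auto simp: smooth_family_def)
  have "smooth_family (UNIV :: unit set) (\<lambda>_ z. \<psi> z * (\<Sum>m\<in>freqs Q. coef Q q m * cos (2 * pi * of_int m * z)))"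
  proof (intro smooth_family_mult[OF \<psi>] smooth_family_sum)
    fix m
    show "smooth_family (UNIV :: unit set) (\<lambda>_ z. coef Q q m * cos (2 * pi * of_int m * z))"
      by (intro smooth_family_mult[OF smooth_family_const] smooth_family_cos[of _ _ "\<bar>2 * pi * of_int m\<bar>"]) auto
  qed simp
  then have "\<exists>B. derivs_bounded k B (p Q q)" for k
    by (auto simp: smooth_family_def p_def [abs_def] kernel_def)
  then show ?thesis by (rule smoothI)
qed

text \<open>
The two halves of \<open>h\<close>, with the sum over \<open>m\<close> inside. In both parts it is a sum of a
smooth function, at scale \<open>Q\<^sup>2\<close> in the first and \<open>q j Q\<close> in the second.
\<close>

lemma coef_sum_split:
  fixes g :: "int \<Rightarrow> 'a :: real_vector"
  assumes "1 \<le> Q" "1 \<le> q" "real q \<le> Q"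
  shows "(\<Sum>m\<in>freqs Q. coef Q q m *\<^sub>R g m) =
    \<kappa> (real q / Q) *\<^sub>R ((1 / Q ^ 2) *\<^sub>R (\<Sum>m\<in>freqs Q. w (of_int m / Q ^ 2) *\<^sub>R g m)) -
    (\<Sum>j\<in>J (real q / Q). (1 / (real q * real j * Q)) *\<^sub>R
      (\<Sum>m\<in>freqs Q. (w (of_int m / Q ^ 2) * \<Omega> (of_int m / (real q * real j * Q))) *\<^sub>R g m))"
proof -
  define x where "x = real q / Q"
  have x: "0 < x" using assms by (simp add: x_def)
  have coef: "coef Q q m = \<kappa> x * (1 / Q ^ 2) * w (of_int m / Q ^ 2) -
      (\<Sum>j\<in>J x. 1 / (real q * real j * Q) * (w (of_int m / Q ^ 2) * \<Omega> (of_int m / (real q * real j * Q))))" for m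
  proof -
    have *: "w (of_int m / Q ^ 2) * (\<omega> (\<bar>of_int m / Q ^ 2\<bar> / (x * real j)) / (x * real j)) / Q ^ 2 =
        1 / (real q * real j * Q) * (w (of_int m / Q ^ 2) * \<Omega> (of_int m / (real q * real j * Q)))" for j
    proof -
      have "\<bar>of_int m / Q ^ 2\<bar> / (x * real j) = \<bar>of_int m / (real q * real j * Q)\<bar>"
        using assms by (simp add: x_def abs_mult power2_eq_square)
      moreover have "x * real j * Q ^ 2 = real q * real j * Q"
        using assms by (simp add: x_def power2_eq_square)
      moreover have "w (of_int m / Q ^ 2) * (\<omega> (\<bar>of_int m / Q ^ 2\<bar> / (x * real j)) / (x * real j)) / Q ^ 2 =
          w (of_int m / Q ^ 2) * \<omega> (\<bar>of_int m / Q ^ 2\<bar> / (x * real j)) / (x * real j * Q ^ 2)"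
        by simp
      ultimately show ?thesis unfolding \<Omega>_def by (simp only: times_divide_eq_left mult_1)
    qed
    show ?thesis
      unfolding coef_def h_eq[OF x, folded x_def] x_def[symmetric]
      unfolding *[symmetric] right_diff_distrib diff_divide_distrib sum_distrib_left sum_divide_distrib
      by simp
  qed
  show ?thesis
    unfolding coef x_def[symmetric] scaleR_left_diff_distrib sum_subtractf scaleR_sum_left
    by (subst sum.swap[of _ "J x" "freqs Q"]) (simp add: scaleR_sum_right mult.assoc)
qed

section \<open>Decay of the weight functions\<close>

lemma kernel_le_exp_sum:
  "\<bar>kernel Q q z\<bar> \<le> norm (\<Sum>m\<in>freqs Q. coef Q q m *\<^sub>R e (of_int m * z))"
proof -
  have "Re (e (of_int m * z)) = cos (2 * pi * of_int m * z)" for m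
  proof -
    have "e (of_int m * z) = exp (\<i> * of_real (2 * pi * of_int m * z))" by (simp add: e_def mult_ac)
    then show ?thesis by (simp add: Re_exp)
  qed
  then have "kernel Q q z = Re (\<Sum>m\<in>freqs Q. coef Q q m *\<^sub>R e (of_int m * z))"
    by (simp add: kernel_def)
  then show ?thesis using abs_Re_le_cmod by metis
qed

lemma \<kappa>_bound: "\<exists>C\<ge>0. \<forall>x. 0 < x \<and> x \<le> 1 \<longrightarrow> \<bar>\<kappa> x\<bar> \<le> C / x"
proof -
  obtain C where C: "0 \<le> C" "\<And>x. 0 < x \<Longrightarrow> x \<le> 1 \<Longrightarrow> \<bar>x * \<kappa> x - K\<bar> \<le> C"
    using riemann_b[of 0] by (auto simp: \<kappa>_def)
  have "\<bar>\<kappa> x\<bar> \<le> (\<bar>K\<bar> + C) / x" if x: "0 < x" "x \<le> 1" for x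
  proof -
    have "\<bar>x * \<kappa> x\<bar> \<le> \<bar>K\<bar> + C" using C(2)[OF x] by linarith
    then show ?thesis using x by (simp add: abs_mult field_simps)
  qed
  then show ?thesis using C by (intro exI[of _ "\<bar>K\<bar> + C"]) auto
qed

text \<open>
The functions of \<open>t = m / (q j Q)\<close> that occur in the second part of \<open>coef_sum_split\<close>; there the
parameter \<open>a\<close> is \<open>q j / Q\<close>.
\<close>

lemma w_\<Omega>_smooth_family: "smooth_family {0..1} (\<lambda>a t. w (a * t) * \<Omega> t)"
proof -
  have "smooth_family {0..1::real} (\<lambda>_. w)" "smooth_family {0..1::real} (\<lambda>_. \<Omega>)"
    using w_smooth \<Omega>_smooth by (auto simp: smooth_family_def)
  from smooth_family_mult[OF smooth_family_affine[OF this(1), of "\<lambda>a. a" 1 "\<lambda>_. 0"] this(2)]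
  show ?thesis by simp
qed

text \<open>
Every exponential sum in \<open>coef_sum_split\<close> decays in \<open>q j Q \<bar>z\<bar>\<close>, and an exponent of at least 2 makes
the sum over \<open>j\<close> converge.
\<close>

lemma p_decay:
  "\<exists>C\<ge>0. \<forall>Q\<ge>1. \<forall>q. 1 \<le> q \<and> real q \<le> Q \<longrightarrow>
     (\<forall>z. \<bar>p Q q z\<bar> * (real q * Q * \<bar>z\<bar>) ^ (N + 2) \<le> C)"
proof -
  define n where "n = N + 2"
  obtain B\<psi> where B\<psi>: "derivs_bounded 0 B\<psi> \<psi>" using \<psi>_smooth by blast
  obtain Bw where Bw: "derivs_bounded n Bw w" using w_smooth by blast
  obtain B where "\<forall>a\<in>{0..1}. derivs_bounded n B (\<lambda>t. w (a * t) * \<Omega> t)"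
    using smooth_familyD[OF w_\<Omega>_smooth_family] by blast
  then have B: "\<And>a. 0 \<le> a \<Longrightarrow> a \<le> 1 \<Longrightarrow> derivs_bounded n B (\<lambda>t. w (a * t) * \<Omega> t)" by simp
  obtain C\<kappa> where C\<kappa>: "0 \<le> C\<kappa>" "\<And>x. 0 < x \<Longrightarrow> x \<le> 1 \<Longrightarrow> \<bar>\<kappa> x\<bar> \<le> C\<kappa> / x"
    using \<kappa>_bound by blast
  have nn: "0 \<le> B\<psi>" "0 \<le> Bw" "0 \<le> B"
    using derivs_bounded_nonneg[OF B\<psi>] derivs_bounded_nonneg[OF Bw] derivs_bounded_nonneg[OF B[of 0]] by auto
  define c where "c = 2 * (1 + real n) + 1"
  have c: "0 \<le> c" by (simp add: c_def)
  define D where "D = C\<kappa> * (c * Bw) + 2 * (c * B)"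
  have D: "0 \<le> D" using nn C\<kappa> c by (simp add: D_def)
  have main: "\<bar>p Q q z\<bar> * (real q * Q * \<bar>z\<bar>) ^ n \<le> B\<psi> * D"
    if Q: "1 \<le> Q" and q: "1 \<le> q" "real q \<le> Q" for Q q z
  proof (cases "\<bar>z\<bar> \<le> 3/4")
    case False
    then show ?thesis using \<psi>_eq_0 D nn by (simp add: p_def)
  next
    case True
    define x where "x = real q / Q"
    have x: "0 < x" "x \<le> 1" using Q q by (auto simp: x_def)
    define T where "T = norm (1 - e z) ^ n"
    have T: "0 \<le> T" by (simp add: T_def)
    have norm_le: "norm (\<Sum>m\<in>S. f (of_int m / M) *\<^sub>R e (of_int m * z)) * T \<le> c * M * B' * (1 / M) ^ n"
      if "derivs_bounded n B' f" "\<And>x. x < - 1 \<or> 1 < x \<Longrightarrow> f x = 0" "1 \<le> M" "finite S"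
        "\<And>m::int. f (of_int m / M) \<noteq> 0 \<Longrightarrow> m \<in> S" for f M S B'
    proof -
      have "norm (\<Sum>m\<in>S. of_real (f (of_int m / M)) * e (of_int m * z)) * norm (1 - e z) ^ n
          \<le> (2 * (1 + real n) * M + 1) * B' * (1 / M) ^ n"
        by (rule smooth_exp_sum_decay) (use that in auto)
      also have "\<dots> \<le> (c * M) * B' * (1 / M) ^ n"
        using that derivs_bounded_nonneg[OF that(1)] by (intro mult_right_mono) (auto simp: c_def ring_distribs)
      finally show ?thesis by (simp add: T_def scaleR_conv_of_real)
    qed
    have Q2: "1 \<le> Q ^ 2" using Q by simp
    have 1: "norm (\<Sum>m\<in>freqs Q. w (of_int m / Q ^ 2) *\<^sub>R e (of_int m * z)) * T \<le> c * Q ^ 2 * Bw * (1 / Q ^ 2) ^ n"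
      by (rule norm_le[OF Bw _ Q2]) (use w_support in_freqs[OF Q] in auto)
    have 2: "norm (\<Sum>m\<in>freqs Q. (w (of_int m / Q ^ 2) * \<Omega> (of_int m / (real q * real j * Q))) *\<^sub>R e (of_int m * z)) * T
        \<le> c * (real q * real j * Q) * B * (1 / (real q * real j * Q)) ^ n" if j: "j \<in> J x" for j
    proof -
      have j1: "1 \<le> j" "x * real j \<le> 1" using j x by (auto simp: J_iff)
      have "1 * 1 * 1 \<le> real q * real j * Q" using Q q j1 by (intro mult_mono) auto
      then have M: "1 \<le> real q * real j * Q" by simp
      have arg: "x * real j * (of_int m / (real q * real j * Q)) = of_int m / Q ^ 2" for m :: int
        using Q q j1 by (simp add: x_def power2_eq_square)
      have "norm (\<Sum>m\<in>freqs Q. (w (x * real j * (of_int m / (real q * real j * Q))) *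
          \<Omega> (of_int m / (real q * real j * Q))) *\<^sub>R e (of_int m * z)) * T
        \<le> c * (real q * real j * Q) * B * (1 / (real q * real j * Q)) ^ n"
      proof (rule norm_le[OF B _ M])
        fix m assume "w (x * real j * (of_int m / (real q * real j * Q))) * \<Omega> (of_int m / (real q * real j * Q)) \<noteq> 0"
        then show "m \<in> freqs Q" unfolding arg using in_freqs[OF Q] by auto
      qed (use x j1 \<Omega>_support in auto)
      then show ?thesis unfolding arg .
    qed
    define M where "M = real q * Q"
    have "1 * 1 \<le> real q * Q" using Q q by (intro mult_mono) auto
    then have M: "1 \<le> M" by (simp add: M_def)
    define S0 where "S0 = (\<Sum>m\<in>freqs Q. w (of_int m / Q ^ 2) *\<^sub>R e (of_int m * z))"
    define S where "S j = (\<Sum>m\<in>freqs Q. (w (of_int m / Q ^ 2) * \<Omega> (of_int m / (real q * real j * Q))) *\<^sub>R e (of_int m * z))" for j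
    have first: "\<bar>\<kappa> x\<bar> * (1 / Q ^ 2) * norm S0 * T * M ^ n \<le> C\<kappa> * (c * Bw)"
    proof -
      have "\<bar>\<kappa> x\<bar> * (1 / Q ^ 2) * norm S0 * T * M ^ n = \<bar>\<kappa> x\<bar> * (1 / Q ^ 2) * M ^ n * (norm S0 * T)" by simp
      also have "\<dots> \<le> (C\<kappa> / x) * (1 / Q ^ 2) * M ^ n * (c * Q ^ 2 * Bw * (1 / Q ^ 2) ^ n)"
      proof (rule mult_mono[OF _ 1[folded S0_def]])
        show "\<bar>\<kappa> x\<bar> * (1 / Q ^ 2) * M ^ n \<le> (C\<kappa> / x) * (1 / Q ^ 2) * M ^ n"
          using C\<kappa>(2)[OF x] M by (intro mult_right_mono) auto
      qed (use C\<kappa>(1) x M T in auto)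
      also have "\<dots> = C\<kappa> * (c * Bw) * ((M / Q ^ 2) ^ n / x)"
        using Q by (simp add: power_divide power_one_over field_simps)
      also have "M / Q ^ 2 = x" using Q by (simp add: M_def x_def power2_eq_square)
      also have "x ^ n / x = x ^ (N + 1)" using x by (simp add: n_def)
      also have "C\<kappa> * (c * Bw) * x ^ (N + 1) \<le> C\<kappa> * (c * Bw) * 1"
        using C\<kappa> c nn x by (intro mult_left_mono power_le_one) auto
      finally show ?thesis by simp
    qed
    have second: "(1 / (real q * real j * Q)) * norm (S j) * T * M ^ n \<le> c * B * (1 / real j ^ 2)"
      if j: "j \<in> J x" for j
    proof -
      have j1: "1 \<le> j" using j x by (auto simp: J_iff)
      have "(1 / (real q * real j * Q)) * norm (S j) * T * M ^ n =
          (1 / (real q * real j * Q)) * M ^ n * (norm (S j) * T)" by simp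
      also have "\<dots> \<le> (1 / (real q * real j * Q)) * M ^ n *
          (c * (real q * real j * Q) * B * (1 / (real q * real j * Q)) ^ n)"
        using 2[OF j] M Q unfolding S_def by (intro mult_left_mono) auto
      also have "\<dots> = c * B * (M / (real q * real j * Q)) ^ n"
        using Q q j1 by (simp add: power_divide power_one_over)
      also have "M / (real q * real j * Q) = 1 / real j" using Q q by (simp add: M_def)
      also have "c * B * (1 / real j) ^ n \<le> c * B * (1 / real j) ^ 2"
        using c nn j1 by (intro mult_left_mono power_decreasing) (auto simp: n_def)
      finally show ?thesis by (simp add: power_one_over)
    qed
    have "norm (\<Sum>m\<in>freqs Q. coef Q q m *\<^sub>R e (of_int m * z)) \<le>
        \<bar>\<kappa> x\<bar> * (1 / Q ^ 2) * norm S0 + (\<Sum>j\<in>J x. (1 / (real q * real j * Q)) * norm (S j))"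
      unfolding coef_sum_split[OF Q q] x_def[symmetric] S0_def[symmetric] S_def[symmetric]
      by (rule order.trans[OF norm_triangle_ineq4 add_mono[OF _ order.trans[OF norm_sum]]])
        (use Q in \<open>auto intro!: sum_mono simp: abs_mult\<close>)
    then have "norm (\<Sum>m\<in>freqs Q. coef Q q m *\<^sub>R e (of_int m * z)) * (T * M ^ n) \<le>
        (\<bar>\<kappa> x\<bar> * (1 / Q ^ 2) * norm S0 + (\<Sum>j\<in>J x. (1 / (real q * real j * Q)) * norm (S j))) * (T * M ^ n)"
      using T M by (intro mult_right_mono) auto
    also have "\<dots> = \<bar>\<kappa> x\<bar> * (1 / Q ^ 2) * norm S0 * T * M ^ n +
        (\<Sum>j\<in>J x. (1 / (real q * real j * Q)) * norm (S j) * T * M ^ n)"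
      by (simp add: ring_distribs sum_distrib_right mult.assoc)
    also have "\<dots> \<le> C\<kappa> * (c * Bw) + (\<Sum>j\<in>J x. c * B * (1 / real j ^ 2))"
      by (intro add_mono sum_mono first second)
    also have "(\<Sum>j\<in>J x. c * B * (1 / real j ^ 2)) = c * B * (\<Sum>j\<in>J x. 1 / real j ^ 2)"
      by (simp add: sum_distrib_left)
    also have "\<dots> \<le> c * B * 2"
      using c nn sum_inverse_squares_le unfolding J_def by (intro mult_left_mono) auto
    finally have le_D: "norm (\<Sum>m\<in>freqs Q. coef Q q m *\<^sub>R e (of_int m * z)) * (T * M ^ n) \<le> D"
      by (simp add: D_def)
    have "\<bar>kernel Q q z\<bar> * (\<bar>z\<bar> ^ n * M ^ n) \<le>
        norm (\<Sum>m\<in>freqs Q. coef Q q m *\<^sub>R e (of_int m * z)) * (T * M ^ n)"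
      unfolding T_def using M norm_1_minus_e_ge[OF True] kernel_le_exp_sum[of Q q z]
      by (intro mult_mono power_mono) auto
    then have "\<bar>kernel Q q z\<bar> * (\<bar>z\<bar> ^ n * M ^ n) \<le> D" using le_D by (rule order.trans)
    moreover have "\<bar>\<psi> z\<bar> \<le> B\<psi>" using B\<psi> by simp
    ultimately have "\<bar>\<psi> z\<bar> * (\<bar>kernel Q q z\<bar> * (\<bar>z\<bar> ^ n * M ^ n)) \<le> B\<psi> * D"
      using nn M by (intro mult_mono) auto
    then show ?thesis by (simp add: p_def abs_mult M_def power_mult_distrib mult_ac)
  qed
  have "0 \<le> B\<psi> * D" using nn D by simp
  with main show ?thesis unfolding n_def by blast
qed

section \<open>The weight functions near 0\<close>

lemma integral_\<omega>: "(\<omega> has_integral 1) {-1..1}"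
proof -
  have "\<omega> integrable_on {1/2..1}"
    using \<omega>_smooth[of 0] by (auto intro: integrable_continuous_real continuous_on_subset)
  from integrable_integral[OF this] have "(\<omega> has_integral 1) {1/2..1}"
    using b_moment by (simp only: \<omega>_def [abs_def])
  then show ?thesis
    by (rule has_integral_on_superset) (use \<omega>_support in auto)
qed

lemma integral_b_abs: "((\<lambda>t. b \<bar>t\<bar>) has_integral 2 * K) {-1..1}"
  and integral_\<Omega>: "(\<Omega> has_integral 2) {-1..1}"
proof -
  have symm: "((\<lambda>t. f t + f (- t)) has_integral 2 * integral {-1..1} f) {-1..1}"
    if "f integrable_on {-1..1}" for f :: "real \<Rightarrow> real"
  proof -
    have 1: "(f has_integral integral {-1..1} f) {-1..1}" using that by (rule integrable_integral)
    then have "((\<lambda>t. f (- t)) has_integral integral {-1..1} f) {-1..1}"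
      using has_integral_reflect_real[of f "integral {-1..1} f" 1 "-1"] by simp
    from has_integral_add[OF 1 this] show ?thesis by simp
  qed
  have b: "b integrable_on {-1..1}"
    using b_smooth[of 0] by (auto intro: integrable_continuous_real continuous_on_subset)
  have "b \<bar>t\<bar> = b t + b (- t)" for t using b_support[of t] b_support[of "-t"] by (cases "t \<ge> 0") auto
  then show "((\<lambda>t. b \<bar>t\<bar>) has_integral 2 * K) {-1..1}" using symm[OF b] by (simp add: K_def)
  have \<omega>: "\<omega> integrable_on {-1..1}" "integral {-1..1} \<omega> = 1" using integral_\<omega> by auto
  have "\<Omega> t = \<omega> t + \<omega> (- t)" for t
    using \<omega>_support[of t] \<omega>_support[of "-t"] by (cases "t \<ge> 0") (auto simp: \<Omega>_def)
  then have "\<Omega> = (\<lambda>t. \<omega> t + \<omega> (- t))" by blast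
  then show "(\<Omega> has_integral 2) {-1..1}" using symm[OF \<omega>(1)] \<omega>(2) by simp
qed

text \<open>
For fixed \<open>t\<close> the sum over \<open>j\<close> of the even function \<open>g\<close> is half of a Riemann sum of mesh \<open>x \<bar>t\<bar>\<close> from
which the term \<open>g 0 = 1\<close> is removed. The removed terms produce the \<open>-1\<close>, the source of the main
term 1 of \<open>p\<close> near 0.
\<close>

lemma integral_twisted_\<Omega>:
  assumes g: "derivs_bounded (Suc N) B g" "\<And>y. y < - (1/2) \<or> 1/2 < y \<Longrightarrow> g y = 0"
    and even: "\<And>y. g (- y) = g y" and "g 0 = 1"
    and \<Omega>: "\<And>t. \<bar>\<Omega> t\<bar> \<le> B\<Omega>" and x: "0 < x" "x \<le> 1"
  shows "\<bar>(\<Sum>j\<in>J x. integral {-1..1} (\<lambda>t. g (x * real j * t) * \<Omega> t)) - (integral {-1..1} g * K / x - 1)\<bar>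
    \<le> 12 * B * B\<Omega> * x ^ N"
proof -
  define I where "I = integral {-1..1} g"
  have B0: "0 \<le> B" "0 \<le> B\<Omega>" using derivs_bounded_nonneg[OF g(1)] \<Omega>[of 0] by linarith+
  have pointwise: "\<bar>(\<Sum>j\<in>J x. g (x * real j * t) * \<Omega> t) - (I / (2 * x) * b \<bar>t\<bar> - 1/2 * \<Omega> t)\<bar> \<le> 6 * B * B\<Omega> * x ^ N"
    if t: "t \<in> {-1..1}" for t
  proof (cases "\<bar>t\<bar> < 1/2")
    case True
    then have "\<Omega> t = 0" "b \<bar>t\<bar> = 0" using b_support \<omega>_support by (auto simp: \<Omega>_def)
    then show ?thesis using B0 x by simp
  next
    case False
    define s where "s = x * \<bar>t\<bar>"
    have "x * \<bar>t\<bar> \<le> x * 1" using x t by (intro mult_left_mono) auto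
    then have s: "0 < s" "s \<le> x" using x False by (auto simp: s_def)
    then have s1: "s \<le> 1" using x by linarith
    define n where "n = nat \<lfloor>1 / x\<rfloor>"
    have "j \<in> {- int n..int n}" if "g (s * of_int j) \<noteq> 0" for j
    proof -
      have "- (1/2) \<le> s * of_int j" "s * of_int j \<le> 1/2" using that g(2)[of "s * of_int j"] by linarith+
      then have "s * of_int \<bar>j\<bar> \<le> 1/2" using s by (cases "j \<ge> 0") auto
      moreover have "x * of_int \<bar>j\<bar> * (1/2) \<le> x * of_int \<bar>j\<bar> * \<bar>t\<bar>" using False x by (intro mult_left_mono) auto
      ultimately have "x * of_int \<bar>j\<bar> \<le> 1" by (simp add: s_def mult_ac)
      then have "\<bar>j\<bar> \<le> int n" using x by (simp add: n_def le_floor_iff field_simps)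
      then show ?thesis by auto
    qed
    moreover have "g y = 0" if "y < - 1 \<or> 1 < y" for y using that by (intro g(2)) auto
    ultimately have "\<bar>s * (\<Sum>j\<in>{- int n..int n}. g (s * of_int j)) - I\<bar> \<le> 4 * (1 + 2) * B * s ^ Suc N"
      unfolding I_def using s s1 by (intro riemann_sum[OF g(1)]) auto
    also have "(\<Sum>j\<in>{- int n..int n}. g (s * of_int j)) = 1 + 2 * (\<Sum>j\<in>J x. g (s * real j))"
      unfolding sum_symmetric_int by (simp add: even \<open>g 0 = 1\<close> J_def n_def sum_distrib_left)
    also have "(\<Sum>j\<in>J x. g (s * real j)) = (\<Sum>j\<in>J x. g (x * real j * t))"
    proof (intro sum.cong refl)
      fix j
      show "g (s * real j) = g (x * real j * t)"
        using even[of "x * real j * t"] by (cases "t \<ge> 0") (auto simp: s_def mult_ac)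
    qed
    finally have 1: "\<bar>s * (1 + 2 * (\<Sum>j\<in>J x. g (x * real j * t))) - I\<bar> \<le> 12 * B * s ^ Suc N" by simp
    define E where "E = s * (1 + 2 * (\<Sum>j\<in>J x. g (x * real j * t))) - I"
    have "(\<Sum>j\<in>J x. g (x * real j * t)) = ((I + E) / s - 1) / 2" using s by (simp add: E_def)
    then have "(\<Sum>j\<in>J x. g (x * real j * t) * \<Omega> t) = ((I + E) / s - 1) / 2 * \<Omega> t"
      by (simp add: sum_distrib_right[symmetric])
    moreover have "\<Omega> t / s = b \<bar>t\<bar> / x" using False x by (simp add: \<Omega>_def \<omega>_def s_def)
    then have "((I + E) / s - 1) / 2 * \<Omega> t = (I / (2 * x) * b \<bar>t\<bar> - 1/2 * \<Omega> t) + E / s / 2 * \<Omega> t"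
      by (simp add: add_divide_distrib diff_divide_distrib ring_distribs) (metis (no_types, lifting) mult.commute times_divide_eq_right divide_divide_eq_left)
    ultimately have "(\<Sum>j\<in>J x. g (x * real j * t) * \<Omega> t) - (I / (2 * x) * b \<bar>t\<bar> - 1/2 * \<Omega> t) = E / s / 2 * \<Omega> t"
      by linarith
    then have "\<bar>(\<Sum>j\<in>J x. g (x * real j * t) * \<Omega> t) - (I / (2 * x) * b \<bar>t\<bar> - 1/2 * \<Omega> t)\<bar> = \<bar>E / s\<bar> / 2 * \<bar>\<Omega> t\<bar>"
      by (simp add: abs_mult)
    also have "\<dots> \<le> 12 * B * x ^ N / 2 * B\<Omega>"
    proof (intro mult_mono divide_right_mono \<Omega>)
      have "\<bar>E\<bar> \<le> 12 * B * s ^ N * s" using 1 unfolding E_def[symmetric] by (simp add: mult_ac)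
      then have "\<bar>E / s\<bar> \<le> 12 * B * s ^ N" using s by (simp add: divide_le_eq)
      also have "\<dots> \<le> 12 * B * x ^ N" using B0 s by (intro mult_left_mono power_mono) auto
      finally show "\<bar>E / s\<bar> \<le> 12 * B * x ^ N" .
    qed (use B0 x in auto)
    also have "12 * B * x ^ N / 2 * B\<Omega> = 6 * B * B\<Omega> * x ^ N" by simp
    finally show ?thesis .
  qed
  have int: "((\<lambda>t. g (x * real j * t) * \<Omega> t) has_integral integral {-1..1} (\<lambda>t. g (x * real j * t) * \<Omega> t)) {-1..1}" for j
  proof (intro integrable_integral integrable_continuous_real continuous_on_mult)
    show "continuous_on {-1..1} (\<lambda>t. g (x * real j * t))"
      by (rule continuous_on_compose2[OF derivs_bounded_continuous[OF g(1), of UNIV]]) (auto intro!: continuous_intros)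
    show "continuous_on {-1..1} \<Omega>" using \<Omega>_smooth[of 0] by (auto intro: continuous_on_subset)
  qed
  have "((\<lambda>t. (\<Sum>j\<in>J x. g (x * real j * t) * \<Omega> t) - (I / (2 * x) * b \<bar>t\<bar> - 1/2 * \<Omega> t)) has_integral
      (\<Sum>j\<in>J x. integral {-1..1} (\<lambda>t. g (x * real j * t) * \<Omega> t)) - (I / (2 * x) * (2 * K) - 1/2 * 2)) {-1..1}"
    by (intro has_integral_diff has_integral_sum has_integral_mult_right integral_b_abs integral_\<Omega> int) auto
  from has_integral_bound_real[where B = "6 * B * B\<Omega> * x ^ N" and S = "{}", OF _ _ this] pointwise B0 x
  show ?thesis by (simp add: I_def)
qed

text \<open>
For \<open>\<bar>z\<bar> \<le> Q\<^sup>-\<^sup>2\<close> the function \<open>w y cos (a y)\<close> with \<open>a = 2 \<pi> Q\<^sup>2 z\<close> ranges over a family with uniformly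
bounded derivatives. Replacing the sums over \<open>m\<close> in \<open>coef_sum_split\<close> by integrals, the main terms
\<open>I K / x\<close> cancel and 1 remains.
\<close>

lemma kernel_near_0:
  "\<exists>C\<ge>0. \<forall>Q\<ge>1. \<forall>q. 1 \<le> q \<and> real q \<le> Q \<longrightarrow>
     (\<forall>z. \<bar>z\<bar> \<le> 1 / Q ^ 2 \<longrightarrow> \<bar>kernel Q q z - 1\<bar> \<le> C * (real q / Q) ^ N)"
proof -
  define A where "A = {- (2 * pi)..2 * pi}"
  define g where "g a y = w y * cos (a * y)" for a y :: real
  have cosfam: "smooth_family A (\<lambda>a y. cos (a * y))"
    by (rule smooth_family_cos[of _ _ "2 * pi"]) (auto simp: A_def abs_le_iff)
  have g: "smooth_family A g"
    unfolding g_def [abs_def] using w_smooth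
    by (intro smooth_family_mult cosfam) (auto simp: smooth_family_def)
  have "smooth_family ({0..1} \<times> A) (\<lambda>i. g (snd i))"
    using g by (auto simp: smooth_family_def)
  from smooth_family_affine[OF this, of fst 1 "\<lambda>_. 0"]
  have "smooth_family ({0..1} \<times> A) (\<lambda>i t. g (snd i) (fst i * t))" by auto
  moreover have "smooth_family ({0..1} \<times> A) (\<lambda>_. \<Omega>)" using \<Omega>_smooth by (auto simp: smooth_family_def)
  ultimately have g\<Omega>: "smooth_family ({0..1} \<times> A) (\<lambda>i t. g (snd i) (fst i * t) * \<Omega> t)"
    by (rule smooth_family_mult)
  obtain B1 where B1: "\<forall>a\<in>A. derivs_bounded (Suc N) B1 (g a)" using smooth_familyD[OF g] by blast
  obtain B2 where B2: "\<forall>i\<in>{0..1} \<times> A. derivs_bounded (Suc N) B2 (\<lambda>t. g (snd i) (fst i * t) * \<Omega> t)"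
    using smooth_familyD[OF g\<Omega>] by blast
  have "0 \<in> A" "(0::real, 0) \<in> {0..1} \<times> A" by (auto simp: A_def)
  then have B0: "0 \<le> B1" "0 \<le> B2" using B1 B2 by (meson derivs_bounded_nonneg)+
  obtain B\<Omega> where "derivs_bounded 0 B\<Omega> \<Omega>" using \<Omega>_smooth by blast
  then have B\<Omega>: "\<And>t. \<bar>\<Omega> t\<bar> \<le> B\<Omega>" "0 \<le> B\<Omega>" by (auto dest: derivs_bounded_nonneg)
  obtain Cb where Cb: "0 \<le> Cb" "\<And>x. 0 < x \<Longrightarrow> x \<le> 1 \<Longrightarrow> \<bar>x * \<kappa> x - K\<bar> \<le> Cb * x ^ Suc N"
    using riemann_b[of "Suc N"] by (auto simp: \<kappa>_def)
  obtain C\<kappa> where C\<kappa>: "0 \<le> C\<kappa>" "\<And>x. 0 < x \<Longrightarrow> x \<le> 1 \<Longrightarrow> \<bar>\<kappa> x\<bar> \<le> C\<kappa> / x"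
    using \<kappa>_bound by blast
  define C where "C = C\<kappa> * (12 * B1) + Cb * (2 * B1) + 12 * B2 + 12 * B1 * B\<Omega>"
  have "\<bar>kernel Q q z - 1\<bar> \<le> C * (real q / Q) ^ N"
    if Q: "1 \<le> Q" and q: "1 \<le> q" "real q \<le> Q" and z: "\<bar>z\<bar> \<le> 1 / Q ^ 2" for Q q z
  proof -
    define x where "x = real q / Q"
    have x: "0 < x" "x \<le> 1" using Q q by (auto simp: x_def)
    define a where "a = 2 * pi * Q ^ 2 * z"
    have "Q ^ 2 * \<bar>z\<bar> \<le> 1" using z Q by (simp add: field_simps)
    then have "2 * pi * (Q ^ 2 * \<bar>z\<bar>) \<le> 2 * pi * 1" by (intro mult_left_mono) auto
    then have "\<bar>a\<bar> \<le> 2 * pi" by (simp add: a_def abs_mult)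
    then have a: "a \<in> A" by (auto simp: A_def)
    define f where "f = g a"
    have f: "derivs_bounded (Suc N) B1 f" using B1 a by (simp add: f_def)
    have f_supp: "f y = 0" if "y < - (1/2) \<or> 1/2 < y" for y
      using w_support[OF that] by (simp add: f_def g_def)
    then have f_supp1: "f y = 0" if "y < - 1 \<or> 1 < y" for y using that by auto
    have f_even: "f (- y) = f y" for y by (simp add: f_def g_def w_even)
    have f_0: "f 0 = 1" by (simp add: f_def g_def w_0)
    define I where "I = integral {-1..1} f"
    have I: "\<bar>I\<bar> \<le> 2 * B1"
      using integral_bound[of "-1" 1 f B1] derivs_bounded_continuous[OF f] derivs_bounded_abs_le[OF f]
      by (simp add: I_def)
    have f_freqs: "m \<in> freqs Q" if "f (of_int m / Q ^ 2) \<noteq> 0" for m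
      using that in_freqs[OF Q] by (auto simp: f_def g_def)
    have cos_f: "w (of_int m / Q ^ 2) * cos (2 * pi * of_int m * z) = f (of_int m / Q ^ 2)" for m :: int
      using Q by (simp add: f_def g_def a_def mult_ac)
    have Qx: "1 / Q \<le> x" using Q q by (simp add: x_def divide_right_mono)
    define T1 where "T1 = 1 / Q ^ 2 * (\<Sum>m\<in>freqs Q. f (of_int m / Q ^ 2))"
    have T1: "\<bar>T1 - I\<bar> \<le> 12 * B1 * x ^ Suc N"
    proof -
      have "1 / Q ^ 2 \<le> 1 / Q" using Q by (simp add: field_simps power2_eq_square)
      then have "(1 / Q ^ 2) ^ Suc N \<le> x ^ Suc N" using Qx Q by (intro power_mono) auto
      then have "12 * B1 * (1 / Q ^ 2) ^ Suc N \<le> 12 * B1 * x ^ Suc N"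
        using B0 by (intro mult_left_mono) auto
      moreover have "\<bar>1 / Q ^ 2 * (\<Sum>m\<in>freqs Q. f (1 / Q ^ 2 * of_int m)) - I\<bar> \<le> 4 * (1 + 2) * B1 * (1 / Q ^ 2) ^ Suc N"
        unfolding I_def using Q f_freqs by (intro riemann_sum[OF f f_supp1]) auto
      ultimately show ?thesis by (simp add: T1_def)
    qed
    define T2 where "T2 j = 1 / (real q * real j * Q) *
      (\<Sum>m\<in>freqs Q. f (of_int m / Q ^ 2) * \<Omega> (of_int m / (real q * real j * Q)))" for j
    define I2 where "I2 j = integral {-1..1} (\<lambda>t. f (x * real j * t) * \<Omega> t)" for j
    have T2: "\<bar>T2 j - I2 j\<bar> \<le> 12 * B2 * x ^ Suc N" if j: "j \<in> J x" for j
    proof -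
      have j1: "1 \<le> j" "x * real j \<le> 1" using j x by (auto simp: J_iff)
      define M where "M = real q * real j * Q"
      have "1 * 1 * Q \<le> real q * real j * Q" using Q q j1 by (intro mult_mono) auto
      then have M: "Q \<le> M" by (simp add: M_def)
      have arg: "x * real j * (1 / M * of_int m) = of_int m / Q ^ 2" for m :: int
        using Q q j1 by (simp add: x_def M_def power2_eq_square)
      have "(x * real j, a) \<in> {0..1} \<times> A" using x j1 a by simp
      with B2 have f2: "derivs_bounded (Suc N) B2 (\<lambda>t. f (x * real j * t) * \<Omega> t)" unfolding f_def by fastforce
      have "\<bar>1 / M * (\<Sum>m\<in>freqs Q. f (x * real j * (1 / M * of_int m)) * \<Omega> (1 / M * of_int m)) - I2 j\<bar>
          \<le> 4 * (1 + 2) * B2 * (1 / M) ^ Suc N"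
        unfolding I2_def
      proof (intro riemann_sum[OF f2])
        fix m assume "f (x * real j * (1 / M * of_int m)) * \<Omega> (1 / M * of_int m) \<noteq> 0"
        then show "m \<in> freqs Q" unfolding arg using f_freqs by auto
      qed (use \<Omega>_support M Q in auto)
      also have "\<dots> \<le> 12 * B2 * x ^ Suc N"
      proof -
        have "1 / M \<le> 1 / Q" using M Q by (intro divide_left_mono) auto
        then have "(1 / M) ^ Suc N \<le> x ^ Suc N" using Qx M Q by (intro power_mono) auto
        then have "12 * B2 * (1 / M) ^ Suc N \<le> 12 * B2 * x ^ Suc N" using B0 by (intro mult_left_mono) auto
        then show ?thesis by simp
      qed
      finally show ?thesis unfolding arg by (simp add: T2_def M_def)
    qed
    have T3: "\<bar>(\<Sum>j\<in>J x. I2 j) - (I * K / x - 1)\<bar> \<le> 12 * B1 * B\<Omega> * x ^ N"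
      unfolding I2_def I_def by (rule integral_twisted_\<Omega>[OF f f_supp f_even f_0 B\<Omega>(1) x])
    have "kernel Q q z = (\<Sum>m\<in>freqs Q. coef Q q m *\<^sub>R cos (2 * pi * of_int m * z))"
      by (simp add: kernel_def)
    also have "\<dots> = \<kappa> x * T1 - (\<Sum>j\<in>J x. T2 j)"
      unfolding coef_sum_split[OF Q q] x_def[symmetric] T1_def T2_def
      by (simp add: cos_f[symmetric] mult_ac)
    finally have eq: "kernel Q q z - 1 = \<kappa> x * (T1 - I) + (\<kappa> x - K / x) * I -
        (\<Sum>j\<in>J x. T2 j - I2 j) - ((\<Sum>j\<in>J x. I2 j) - (I * K / x - 1))"
      by (simp add: algebra_simps sum_subtractf)
    \<comment> \<open>The main terms are \<open>\<kappa> x \<approx> K / x\<close>, \<open>T1 \<approx> I\<close> and \<open>\<Sum>\<^sub>j I2 j \<approx> I K / x - 1\<close>.\<close>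
    have tri: "\<bar>s + t - u - v\<bar> \<le> \<bar>s\<bar> + \<bar>t\<bar> + \<bar>u\<bar> + \<bar>v\<bar>" for s t u v :: real by linarith
    have "\<bar>kernel Q q z - 1\<bar> \<le> \<bar>\<kappa> x * (T1 - I)\<bar> + \<bar>(\<kappa> x - K / x) * I\<bar> +
        \<bar>\<Sum>j\<in>J x. T2 j - I2 j\<bar> + \<bar>(\<Sum>j\<in>J x. I2 j) - (I * K / x - 1)\<bar>" unfolding eq by (rule tri)
    also have "\<dots> \<le> C\<kappa> * (12 * B1) * x ^ N + Cb * (2 * B1) * x ^ N + 12 * B2 * x ^ N + 12 * B1 * B\<Omega> * x ^ N"
    proof (intro add_mono T3)
      have "\<bar>\<kappa> x * (T1 - I)\<bar> \<le> (C\<kappa> / x) * (12 * B1 * x ^ Suc N)"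
        unfolding abs_mult using C\<kappa> x T1 by (intro mult_mono) auto
      then show "\<bar>\<kappa> x * (T1 - I)\<bar> \<le> C\<kappa> * (12 * B1) * x ^ N" using x by simp
      have "\<bar>\<kappa> x - K / x\<bar> = \<bar>x * \<kappa> x - K\<bar> / x" using x by (simp add: field_simps abs_divide[symmetric] flip: abs_of_pos)
      also have "\<dots> \<le> Cb * x ^ Suc N / x" using Cb(2)[OF x] x by (intro divide_right_mono) auto
      finally have "\<bar>\<kappa> x - K / x\<bar> \<le> Cb * x ^ N" using x by simp
      then have "\<bar>(\<kappa> x - K / x) * I\<bar> \<le> (Cb * x ^ N) * (2 * B1)"
        unfolding abs_mult using I Cb x by (intro mult_mono) auto
      then show "\<bar>(\<kappa> x - K / x) * I\<bar> \<le> Cb * (2 * B1) * x ^ N" by (simp add: mult_ac)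
      have "\<bar>\<Sum>j\<in>J x. T2 j - I2 j\<bar> \<le> (\<Sum>j\<in>J x. 12 * B2 * x ^ Suc N)"
        by (intro order.trans[OF sum_abs] sum_mono T2)
      also have "\<dots> = real (card (J x)) * (12 * B2 * x ^ Suc N)" by simp
      also have "\<dots> \<le> (1 / x) * (12 * B2 * x ^ Suc N)"
        using x B0 by (intro mult_right_mono) (auto simp: J_def)
      finally show "\<bar>\<Sum>j\<in>J x. T2 j - I2 j\<bar> \<le> 12 * B2 * x ^ N" using x by simp
    qed
    finally show ?thesis by (simp add: C_def x_def ring_distribs)
  qed
  moreover have "0 \<le> C" using B0 B\<Omega> Cb C\<kappa> by (simp add: C_def)
  ultimately show ?thesis by blast
qed

text \<open>
For \<open>Q \<ge> 2\<close> the interval \<open>\<bar>z\<bar> \<le> Q\<^sup>-\<^sup>2\<close> lies in the range where \<open>\<psi> = 1\<close>; for \<open>Q < 2\<close> the ratio \<open>q / Q\<close> is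
bounded below and the claim follows from boundedness.
\<close>

lemma p_near_0:
  "\<exists>C\<ge>0. \<forall>Q\<ge>1. \<forall>q. 1 \<le> q \<and> real q \<le> Q \<longrightarrow>
     (\<forall>z. \<bar>z\<bar> \<le> 1 / Q ^ 2 \<longrightarrow> \<bar>p Q q z - 1\<bar> \<le> C * (real q / Q) ^ N)"
proof -
  obtain C where C: "0 \<le> C" "\<And>Q q z. 1 \<le> Q \<Longrightarrow> 1 \<le> q \<Longrightarrow> real q \<le> Q \<Longrightarrow> \<bar>z\<bar> \<le> 1 / Q ^ 2 \<Longrightarrow>
      \<bar>kernel Q q z - 1\<bar> \<le> C * (real q / Q) ^ N"
    using kernel_near_0[of N] by blast
  obtain D where D: "0 \<le> D" "\<And>Q q z. 1 \<le> Q \<Longrightarrow> 1 \<le> q \<Longrightarrow> real q \<le> Q \<Longrightarrow> \<bar>p Q q z\<bar> \<le> D"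
    using p_bound by blast
  have "\<bar>p Q q z - 1\<bar> \<le> (C + (D + 1) * 2 ^ N) * (real q / Q) ^ N"
    if Q: "1 \<le> Q" and q: "1 \<le> q" "real q \<le> Q" and z: "\<bar>z\<bar> \<le> 1 / Q ^ 2" for Q q z
  proof (cases "Q < 2")
    case True
    have "1 \<le> 2 * (real q / Q)" using True Q q by (simp add: field_simps)
    then have "1 \<le> (2 * (real q / Q)) ^ N" by (rule one_le_power)
    then have "(D + 1) * 1 \<le> (D + 1) * (2 ^ N * (real q / Q) ^ N)"
      unfolding power_mult_distrib using D by (intro mult_left_mono) auto
    moreover have "\<bar>p Q q z - 1\<bar> \<le> D + 1" using D(2)[OF Q q, of z] by linarith
    moreover have "0 \<le> C * (real q / Q) ^ N" using C Q by simp
    ultimately show ?thesis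
      unfolding distrib_right[of C] by (simp only: mult.assoc mult_1_right)
  next
    case False
    then have "2 ^ 2 \<le> Q ^ 2" by (intro power_mono) auto
    then have "1 / Q ^ 2 \<le> 1 / 2 ^ 2" by (intro divide_left_mono) auto
    then have "\<psi> z = 1" using z by (intro \<psi>_eq_1) simp
    then have "\<bar>p Q q z - 1\<bar> \<le> C * (real q / Q) ^ N" using C(2)[OF Q q z] by (simp add: p_def)
    moreover have "0 \<le> (D + 1) * 2 ^ N * (real q / Q) ^ N" using D Q by simp
    ultimately show ?thesis by (simp add: ring_distribs)
  qed
  moreover have "0 \<le> C + (D + 1) * 2 ^ N" using C D by simp
  ultimately show ?thesis by blast
qed

end

section \<open>Ramanujan sums\<close>

lemma finite_nat_le_real: "finite {q::nat. 1 \<le> q \<and> real q \<le> Q}"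
  by (rule finite_subset[of _ "{..nat \<lfloor>Q\<rfloor>}"]) (auto simp: le_nat_floor)

lemma sum_nat_le_square:
  assumes "1 \<le> Q"
  shows "(\<Sum>q | 1 \<le> q \<and> real q \<le> Q. real q) \<le> Q ^ 2"
proof -
  have "{q::nat. 1 \<le> q \<and> real q \<le> Q} \<subseteq> {1..nat \<lfloor>Q\<rfloor>}" by (auto simp: le_nat_floor)
  then have "card {q::nat. 1 \<le> q \<and> real q \<le> Q} \<le> nat \<lfloor>Q\<rfloor>"
    using card_mono[of "{1..nat \<lfloor>Q\<rfloor>}"] by fastforce
  then have c: "real (card {q::nat. 1 \<le> q \<and> real q \<le> Q}) \<le> Q" using assms by (meson le_nat_floor of_nat_floor of_nat_mono order.trans zero_le_one)
  have "(\<Sum>q | 1 \<le> q \<and> real q \<le> Q. real q) \<le> real (card {q::nat. 1 \<le> q \<and> real q \<le> Q}) * Q"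
    by (rule sum_bounded_above) auto
  also have "\<dots> \<le> Q * Q" using c assms by (intro mult_right_mono) auto
  finally show ?thesis by (simp add: power2_eq_square)
qed

text \<open>
The Ramanujan sum \<open>c\<^sub>q(m)\<close>.
\<close>

definition ramanujan_sum :: "nat \<Rightarrow> int \<Rightarrow> complex" where
  "ramanujan_sum q m = (\<Sum>a | 1 \<le> a \<and> a \<le> q \<and> gcd a q = 1. e (real a / real q * of_int m))"

lemma norm_ramanujan_sum_le: "norm (ramanujan_sum q m) \<le> real q"
proof -
  have "norm (ramanujan_sum q m) \<le> (\<Sum>a | 1 \<le> a \<and> a \<le> q \<and> gcd a q = 1. 1)"
    unfolding ramanujan_sum_def by (intro sum_norm_le) simp
  also have "\<dots> \<le> (\<Sum>a\<in>{1..q}. 1)" by (intro sum_mono2) auto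
  finally show ?thesis by simp
qed

lemma e_nat_mult: "e (real n * x) = e x ^ n"
  by (simp add: e_def mult_ac flip: exp_of_nat_mult)

lemma e_eq_1_iff: "e x = 1 \<longleftrightarrow> x \<in> \<int>"
proof -
  have "e x = 1 \<longleftrightarrow> (\<exists>n::int. 2 * pi * x = of_int (2 * n) * pi)"
    by (simp add: e_def exp_eq_1)
  also have "\<dots> \<longleftrightarrow> x \<in> \<int>" by (auto simp: Ints_def)
  finally show ?thesis .
qed

lemma sum_additive_character:
  assumes "1 \<le> k"
  shows "(\<Sum>b=1..k. e (real b / real k * of_int m)) = (if int k dvd m then of_nat k else 0)"
proof -
  define r where "r = e (of_int m / real k)"
  have r: "e (real b / real k * of_int m) = r ^ b" for b
    using e_nat_mult[of b "of_int m / real k"] by (simp add: r_def)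
  have "r ^ k = e (of_int m)" using e_nat_mult[of k "of_int m / real k"] assms by (simp add: r_def)
  then have rk: "r ^ k = 1" using e_eq_1_iff by simp
  have r1: "r = 1 \<longleftrightarrow> int k dvd m"
  proof -
    have "r = 1 \<longleftrightarrow> (\<exists>n::int. of_int m / real k = of_int n)"
      by (auto simp: r_def e_eq_1_iff Ints_def)
    also have "\<dots> \<longleftrightarrow> (\<exists>n::int. m = int k * n)"
    proof -
      have "of_int m / real k = of_int n \<longleftrightarrow> m = int k * n" for n
      proof -
        have "of_int m / real k = of_int n \<longleftrightarrow> real_of_int m = of_int (int k * n)"
          using assms by (simp add: field_simps)
        then show ?thesis by (simp only: of_int_eq_iff)
      qed
      then show ?thesis by simp
    qed
    finally show ?thesis by (simp add: dvd_def)
  qed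
  have "(\<Sum>b=1..k. r ^ b) = (\<Sum>b<k. r ^ Suc b)" by (simp add: sum.atLeast1_atMost_eq)
  also have "\<dots> = r * (\<Sum>b<k. r ^ b)" by (simp add: sum_distrib_left)
  also have "\<dots> = (if int k dvd m then of_nat k else 0)"
    using r1 rk by (auto simp: geometric_sum)
  finally show ?thesis unfolding r .
qed

text \<open>
Each fraction \<open>b / k\<close> has a unique reduced form \<open>a / q\<close>, and \<open>q\<close> divides \<open>k\<close>; so this is the full character sum
modulo \<open>k\<close>.
\<close>

lemma sum_ramanujan_sum_divisors:
  assumes k: "1 \<le> k"
  shows "(\<Sum>q | q dvd k. ramanujan_sum q m) = (if int k dvd m then of_nat k else 0)"
proof -
  have fin: "finite {q. q dvd k}" using k by simp
  have "(\<Sum>q | q dvd k. ramanujan_sum q m) =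
      (\<Sum>(q, a)\<in>(SIGMA q:{q. q dvd k}. {a. 1 \<le> a \<and> a \<le> q \<and> gcd a q = 1}). e (real a / real q * of_int m))"
    unfolding ramanujan_sum_def
    by (rule sum.Sigma[OF fin]) (auto intro: finite_subset[of _ "{1.._}"])
  also have "\<dots> = (\<Sum>b=1..k. e (real b / real k * of_int m))"
  proof (rule sum.reindex_bij_witness[of _ "\<lambda>b. (k div gcd b k, b div gcd b k)" "\<lambda>(q, a). a * (k div q)"])
    fix qa assume "qa \<in> (SIGMA q:{q. q dvd k}. {a. 1 \<le> a \<and> a \<le> q \<and> gcd a q = 1})"
    then obtain q a where qa: "qa = (q, a)" "q dvd k" "1 \<le> a" "a \<le> q" "gcd a q = 1" by auto
    then obtain d where d: "k = q * d" by (auto simp: dvd_def)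
    have "0 < q" "0 < d" using k d by auto
    have "gcd (d * a) (d * q) = d" using gcd_mult_distrib_nat[of d a q] qa(5) by simp
    then have g: "gcd (a * (k div q)) k = d" using \<open>0 < q\<close> by (simp add: d mult.commute)
    show "(\<lambda>b. (k div gcd b k, b div gcd b k)) ((\<lambda>(q, a). a * (k div q)) qa) = qa"
      using g \<open>0 < q\<close> \<open>0 < d\<close> by (simp add: qa(1)) (simp add: d)
    show "(\<lambda>(q, a). a * (k div q)) qa \<in> {1..k}"
      using qa \<open>0 < q\<close> \<open>0 < d\<close> by (simp add: d)
    show "e (real ((\<lambda>(q, a). a * (k div q)) qa) / real k * of_int m) =
        (\<lambda>(q, a). e (real a / real q * of_int m)) qa"
      using \<open>0 < q\<close> \<open>0 < d\<close> by (simp add: qa(1) d)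
  next
    fix b assume b: "b \<in> {1..k}"
    have g: "0 < gcd b k" "gcd b k dvd b" "gcd b k dvd k" using b by auto
    obtain b' k' where bk: "b = gcd b k * b'" "k = gcd b k * k'" using g by (metis dvd_def)
    have div: "b div gcd b k = b'" "k div gcd b k = k'"
      using bk g by (metis nonzero_mult_div_cancel_left less_not_refl)+
    have "0 < b'" "0 < k'" using bk b k by (metis mult_0_right neq0_conv atLeastAtMost_iff not_one_le_zero)+
    moreover have "b' \<le> k'" using b div by (metis atLeastAtMost_iff div_le_mono)
    moreover have "gcd b' k' = 1" using div_gcd_coprime[of b k] k div by (auto simp: coprime_iff_gcd_eq_1)
    ultimately show "(\<lambda>b. (k div gcd b k, b div gcd b k)) b \<in> (SIGMA q:{q. q dvd k}. {a. 1 \<le> a \<and> a \<le> q \<and> gcd a q = 1})"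
      using div bk(2) by (auto intro: dvdI[of _ _ "gcd b k"] simp: mult.commute)
    have "k div k' = gcd b k" using bk(2) \<open>0 < k'\<close> by (metis nonzero_mult_div_cancel_right less_not_refl)
    then show "(\<lambda>(q, a). a * (k div q)) ((\<lambda>b. (k div gcd b k, b div gcd b k)) b) = b"
      using div bk(1) by (simp add: mult.commute)
  qed
  finally show ?thesis using sum_additive_character[OF k] by simp
qed

section \<open>Fourier coefficients of the weight functions\<close>

lemma has_integral_e_unit_interval:
  "((\<lambda>z. e (of_int k * z)) has_integral (if k = 0 then 1 else 0)) {0..1}"
proof (cases "k = 0")
  case True
  then show ?thesis using has_integral_const_real[of "1::complex" 0 1] by (simp add: e_def)
next
  case False
  define c where "c = 2 * of_real pi * \<i> * of_int k"
  have c: "c \<noteq> 0" using False by (simp add: c_def)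
  have e: "e (of_int k * z) = exp (c * of_real z)" for z by (simp add: e_def c_def mult_ac)
  have "((\<lambda>z. exp (c * of_real z)) has_integral (exp (c * of_real 1) / c - exp (c * of_real 0) / c)) {0..1}"
  proof (rule fundamental_theorem_of_calculus)
    fix z :: real
    have "((\<lambda>z. exp (c * z) / c) has_field_derivative exp (c * of_real z)) (at (of_real z))"
      using c by (auto intro!: derivative_eq_intros)
    from has_vector_derivative_real_field[OF this]
    show "((\<lambda>z. exp (c * of_real z) / c) has_vector_derivative exp (c * of_real z)) (at z within {0..1})"
      by (rule has_vector_derivative_at_within)
  qed simp
  moreover have "exp (c * of_real 1) = 1"
    using e[of 1] e_eq_1_iff[of "of_int k"] by simp
  ultimately show ?thesis using False by (simp add: e)
qed

lemma continuous_on_e [continuous_intros]: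
  "continuous_on S f \<Longrightarrow> continuous_on S (\<lambda>z. e (f z))"
  unfolding e_def by (intro continuous_intros)

context delta_weights
begin

lemma \<psi>_continuous: "continuous_on S \<psi>"
  using \<psi>_smooth[of 0] by (auto intro: continuous_on_subset)

text \<open>
For integral frequency \<open>k\<close> the integral over the line folds to the integral of \<open>e (k z)\<close> over the unit interval.
\<close>

lemma \<psi>_fourier:
  "integrable lborel (\<lambda>z. of_real (\<psi> z) * e (of_int k * z))" (is "integrable _ ?f")
  "(LINT z|lborel. of_real (\<psi> z) * e (of_int k * z)) = (if k = 0 then 1 else 0)"
proof -
  have f: "continuous_on S ?f" for S by (intro continuous_intros \<psi>_continuous)
  have f': "continuous_on S (\<lambda>z. ?f (z - 1))" for S
    by (rule continuous_on_compose2[OF f[of UNIV]]) (auto intro!: continuous_intros)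
  have ind: "indicator {-1..1} z *\<^sub>R ?f z = ?f z" for z
    using \<psi>_eq_0[of z] by (auto simp: indicator_def)
  have int: "set_integrable lborel {-1..1} ?f" by (rule borel_integrable_atLeastAtMost'[OF f])
  then show "integrable lborel ?f" by (simp add: set_integrable_def ind)
  have shift: "e (of_int k * (z - 1)) = e (of_int k * z)" for z
  proof -
    have "of_int k * z = of_int k * (z - 1) + of_int k" by (simp add: algebra_simps)
    then have "e (of_int k * z) = e (of_int k * (z - 1)) * e (of_int k)" by (simp only: e_add)
    moreover have "e (of_int k) = 1" using e_eq_1_iff by simp
    ultimately show ?thesis by simp
  qed
  have "(LINT z|lborel. ?f z) = (LINT z:{-1..1}|lborel. ?f z)"
    by (simp add: set_lebesgue_integral_def ind)
  also have "\<dots> = integral {-1..1} ?f" by (rule set_borel_integral_eq_integral(2)[OF int])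
  also have "\<dots> = integral {-1..0} ?f + integral {0..1} ?f"
    by (rule Henstock_Kurzweil_Integration.integral_combine[symmetric]) (auto intro!: integrable_continuous_real f)
  also have "integral {-1..0} ?f = integral {0..1} (\<lambda>z. ?f (z - 1))"
    using integral_shift_real_ivl[of "-1" "-1" 0 ?f] by simp
  also have "\<dots> + integral {0..1} ?f = integral {0..1} (\<lambda>z. ?f (z - 1) + ?f z)"
    by (rule Henstock_Kurzweil_Integration.integral_add[symmetric])
      (rule integrable_continuous_real[OF f'] integrable_continuous_real[OF f])+
  also have "\<dots> = integral {0..1} (\<lambda>z. e (of_int k * z))"
  proof (rule Henstock_Kurzweil_Integration.integral_cong)
    fix z :: real assume "z \<in> {0..1}"
    then have "\<psi> (z - 1) + \<psi> z = 1" using \<psi>_partition[of z] by simp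
    then have "of_real (\<psi> (z - 1)) + of_real (\<psi> z) = (1::complex)" by (metis of_real_1 of_real_add)
    then show "?f (z - 1) + ?f z = e (of_int k * z)"
      unfolding shift by (simp add: distrib_right[symmetric])
  qed
  also have "\<dots> = (if k = 0 then 1 else 0)" by (rule integral_unique[OF has_integral_e_unit_interval])
  finally show "(LINT z|lborel. ?f z) = (if k = 0 then 1 else 0)" .
qed

lemma coef_minus: "coef Q q (- m) = coef Q q m"
  by (simp add: coef_def h_def w_even)

lemma p_fourier:
  assumes Q: "1 \<le> Q"
  shows "integrable lborel (\<lambda>z. of_real (p Q q z) * e (of_int m * z))"
    and "(LINT z|lborel. of_real (p Q q z) * e (of_int m * z)) = of_real (coef Q q m)"
proof -
  have cos_e: "of_real (cos (2 * pi * of_int k * z)) * e (of_int m * z) =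
      (e (of_int (m + k) * z) + e (of_int (m - k) * z)) / 2" for k z
  proof -
    have "e (of_int k * z) + e (of_int (- k) * z) = 2 * of_real (cos (2 * pi * of_int k * z))"
      by (simp add: e_def cos_exp_eq cos_of_real [symmetric] mult_ac)
    then have 1: "of_real (cos (2 * pi * of_int k * z)) = (e (of_int k * z) + e (of_int (- k) * z)) / 2" by simp
    have 2: "e (of_int (m + k) * z) = e (of_int k * z) * e (of_int m * z)"
      "e (of_int (m - k) * z) = e (of_int (- k) * z) * e (of_int m * z)"
      by (simp_all add: e_add[symmetric] algebra_simps)
    show ?thesis unfolding 1 2 by (simp add: distrib_right)
  qed
  have eq: "of_real (p Q q z) * e (of_int m * z) = (\<Sum>k\<in>freqs Q. of_real (coef Q q k / 2) *
      (of_real (\<psi> z) * e (of_int (m + k) * z) + of_real (\<psi> z) * e (of_int (m - k) * z)))" for z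
  proof -
    have "of_real (p Q q z) * e (of_int m * z) =
        (\<Sum>k\<in>freqs Q. of_real (\<psi> z) * of_real (coef Q q k) * (of_real (cos (2 * pi * of_int k * z)) * e (of_int m * z)))"
      by (simp add: p_def kernel_def sum_distrib_left sum_distrib_right mult_ac)
    then show ?thesis unfolding cos_e by (simp add: ring_distribs add_divide_distrib mult_ac)
  qed
  have int: "integrable lborel (\<lambda>z. of_real (coef Q q k / 2) *
      (of_real (\<psi> z) * e (of_int (m + k) * z) + of_real (\<psi> z) * e (of_int (m - k) * z)))" for k
    by (intro integrable_mult_right Bochner_Integration.integrable_add \<psi>_fourier)
  then show "integrable lborel (\<lambda>z. of_real (p Q q z) * e (of_int m * z))"
    unfolding eq by (intro Bochner_Integration.integrable_sum)
  have "(LINT z|lborel. of_real (p Q q z) * e (of_int m * z)) =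
      (\<Sum>k\<in>freqs Q. of_real (coef Q q k / 2) * ((if m + k = 0 then 1 else 0) + (if m - k = 0 then 1 else 0)))"
    unfolding eq Bochner_Integration.integral_sum[OF int] integral_mult_right_zero
      Bochner_Integration.integral_add[OF \<psi>_fourier(1) \<psi>_fourier(1)] \<psi>_fourier(2) ..
  also have "\<dots> = (\<Sum>k\<in>freqs Q. if k = - m then of_real (coef Q q m / 2) else 0) +
      (\<Sum>k\<in>freqs Q. if k = m then of_real (coef Q q m / 2) else 0)"
    unfolding sum.distrib[symmetric]
    by (intro sum.cong refl) (auto simp: coef_minus ring_distribs add_eq_0_iff)
  also have "\<dots> = of_real (coef Q q m)"
  proof (cases "m \<in> freqs Q")
    case True
    then have "- m \<in> freqs Q" by (auto simp: freqs_def)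
    with True show ?thesis by simp
  next
    case False
    then have "w (of_int m / Q ^ 2) = 0" using in_freqs[OF Q] by blast
    then have "coef Q q m = 0" by (simp add: coef_def)
    then show ?thesis by simp
  qed
  finally show "(LINT z|lborel. of_real (p Q q z) * e (of_int m * z)) = of_real (coef Q q m)" .
qed

text \<open>
The truncated Fourier integral of \<open>p Q q\<close> at the frequency \<open>m\<close>, with the truncation of the theorem.
\<close>

definition truncated :: "real \<Rightarrow> real \<Rightarrow> nat \<Rightarrow> int \<Rightarrow> complex" where
  "truncated \<theta> Q q m = (LINT z:{z. \<bar>z\<bar> < (real q * Q) powr (-1 + \<theta>)}|lborel. of_real (p Q q z) * e (of_int m * z))"

text \<open>
Outside the range of integration \<open>q Q \<bar>z\<bar> \<ge> (q Q)\<^sup>\<theta> \<ge> Q\<^sup>\<theta>\<close>, so that the decay of \<open>p\<close> applies; moreover \<open>p\<close>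
vanishes for \<open>\<bar>z\<bar> > 1\<close>.
\<close>

lemma truncated_approx:
  assumes "0 < \<theta>"
  shows "\<exists>C\<ge>0. \<forall>Q\<ge>1. \<forall>q. 1 \<le> q \<and> real q \<le> Q \<longrightarrow> (\<forall>m.
    norm (truncated \<theta> Q q m - of_real (coef Q q m)) \<le> C * Q powr (- \<theta> * (real N + 2)))"
proof -
  obtain C where C: "0 \<le> C" "\<And>Q q z. 1 \<le> Q \<Longrightarrow> 1 \<le> q \<Longrightarrow> real q \<le> Q \<Longrightarrow>
      \<bar>p Q q z\<bar> * (real q * Q * \<bar>z\<bar>) ^ (N + 2) \<le> C"
    using p_decay[of N] by blast
  have "norm (truncated \<theta> Q q m - of_real (coef Q q m)) \<le> 2 * C * Q powr (- \<theta> * (real N + 2))"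
    if Q: "1 \<le> Q" and q: "1 \<le> q" "real q \<le> Q" for Q q m
  proof -
    define M where "M = real q * Q"
    have "1 * Q \<le> real q * Q" using Q q by (intro mult_right_mono) auto
    then have M: "Q \<le> M" by (simp add: M_def)
    then have M: "Q \<le> M" "1 \<le> M" using Q by linarith+
    define R where "R = M powr (-1 + \<theta>)"
    define f where "f z = of_real (p Q q z) * e (of_int m * z)" for z
    define D where "D = C * Q powr (- \<theta> * (real N + 2))"
    have D: "0 \<le> D" using C by (simp add: D_def)
    have f: "integrable lborel f" "(LINT z|lborel. f z) = of_real (coef Q q m)"
      unfolding f_def by (rule p_fourier[OF Q])+
    define in' where "in' = {z::real. \<bar>z\<bar> < R}"
    have "in' = {-R<..<R}" by (auto simp: in'_def abs_less_iff)
    then have meas: "in' \<in> sets lborel" by simp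
    have int_in: "integrable lborel (\<lambda>z. indicator in' z *\<^sub>R f z)"
      by (rule integrable_mult_indicator[OF meas f(1)])
    have tail: "norm (f z - indicator in' z *\<^sub>R f z) \<le> D * indicator {-1..1} z" for z
    proof (cases "z \<in> in' \<or> 1 < \<bar>z\<bar>")
      case True
      then show ?thesis using D \<psi>_eq_0[of z] by (auto simp: indicator_def f_def p_def)
    next
      case False
      then have z: "R \<le> \<bar>z\<bar>" "\<bar>z\<bar> \<le> 1" by (auto simp: in'_def)
      have "M powr \<theta> = M * R"
        using M by (simp add: R_def powr_diff)
      also have "\<dots> \<le> M * \<bar>z\<bar>" using z M by (intro mult_left_mono) auto
      finally have Mz: "M powr \<theta> \<le> M * \<bar>z\<bar>" .
      have "Q powr (\<theta> * (real N + 2)) \<le> M powr (\<theta> * (real N + 2))"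
        using M Q assms by (intro powr_mono2) auto
      also have "\<dots> = (M powr \<theta>) powr real (N + 2)" by (simp add: powr_powr add.commute)
      also have "\<dots> = (M powr \<theta>) ^ (N + 2)" using M by (intro powr_realpow) auto
      also have "\<dots> \<le> (M * \<bar>z\<bar>) ^ (N + 2)" using Mz by (intro power_mono) auto
      finally have "\<bar>p Q q z\<bar> * Q powr (\<theta> * (real N + 2)) \<le> \<bar>p Q q z\<bar> * (M * \<bar>z\<bar>) ^ (N + 2)"
        by (intro mult_left_mono) auto
      also have "\<dots> \<le> C" using C(2)[OF Q q, of z] by (simp add: M_def)
      finally have "\<bar>p Q q z\<bar> \<le> D" using Q by (simp add: D_def powr_minus divide_simps)
      then show ?thesis using False z by (auto simp: f_def norm_mult indicator_def abs_le_iff)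
    qed
    have "truncated \<theta> Q q m - of_real (coef Q q m) = - (LINT z|lborel. f z - indicator in' z *\<^sub>R f z)"
      unfolding Bochner_Integration.integral_diff[OF f(1) int_in] f(2)
      by (simp add: truncated_def set_lebesgue_integral_def f_def in'_def R_def M_def)
    also have "norm \<dots> \<le> (LINT z|lborel. norm (f z - indicator in' z *\<^sub>R f z))"
      unfolding norm_minus_cancel by (rule integral_norm_bound)
    also have "\<dots> \<le> (LINT z|lborel. D * indicator {-1..1} (z::real))"
    proof (rule Bochner_Integration.integral_mono[OF _ _ tail])
      show "integrable lborel (\<lambda>z. norm (f z - indicator in' z *\<^sub>R f z))"
        by (intro integrable_norm Bochner_Integration.integrable_diff f int_in)
    qed auto
    also have "\<dots> = 2 * D" by simp
    finally show ?thesis by (simp add: D_def)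
  qed
  then show ?thesis using C by (intro exI[of _ "2 * C"]) auto
qed

section \<open>The delta symbol\<close>

lemma sum_\<omega>_near_1: "\<exists>C\<ge>0. \<forall>Q\<ge>1. \<bar>(\<Sum>k | 1 \<le> k \<and> real k \<le> Q. \<omega> (real k / Q)) / Q - 1\<bar> \<le> C * (1 / Q) ^ N"
proof -
  obtain B where B: "derivs_bounded N B \<omega>" using \<omega>_smooth by blast
  have supp: "t < - 1 \<or> 1 < t \<Longrightarrow> \<omega> t = 0" for t by (rule \<omega>_support) auto
  have "\<bar>(\<Sum>k | 1 \<le> k \<and> real k \<le> Q. \<omega> (real k / Q)) / Q - 1\<bar> \<le> 12 * B * (1 / Q) ^ N" if Q: "1 \<le> Q" for Q
  proof -
    let ?A = "{k::nat. 1 \<le> k \<and> real k \<le> Q}"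
    have fin: "finite ?A" by (rule finite_nat_le_real)
    have "k \<in> int ` ?A" if "\<omega> (1 / Q * of_int k) \<noteq> 0" for k
    proof -
      have "1/2 \<le> 1 / Q * of_int k" "1 / Q * of_int k \<le> 1" using that \<omega>_support[of "1 / Q * of_int k"] by linarith+
      then have 1: "0 < real_of_int k" "of_int k \<le> Q" using Q by (auto simp: field_simps)
      then have "k = int (nat k)" "nat k \<in> ?A" by auto
      then show ?thesis by blast
    qed
    then have "\<bar>1 / Q * (\<Sum>k\<in>int ` ?A. \<omega> (1 / Q * of_int k)) - integral {-1..1} \<omega>\<bar> \<le> 4 * (1 + 2) * B * (1 / Q) ^ N"
      using Q fin by (intro riemann_sum[OF B supp]) auto
    then show ?thesis
      using integral_unique[OF integral_\<omega>] by (simp add: sum.reindex)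
  qed
  then show ?thesis using derivs_bounded_nonneg[OF B] by (intro exI[of _ "12 * B"]) auto
qed

text \<open>
The bound on \<open>m\<close> ensures that neither sum is affected by the condition \<open>k \<le> Q\<close>, so that both run over all
divisors of \<open>m\<close> and the involution \<open>k \<mapsto> \<bar>m\<bar> / k\<close> applies.
\<close>

lemma sum_divisors_switch:
  assumes Q: "1 \<le> Q" and m: "m \<noteq> 0" "\<bar>of_int m / Q ^ 2\<bar> \<le> 1/2"
  shows "(\<Sum>k | 1 \<le> k \<and> real k \<le> Q \<and> int k dvd m. \<omega> (real k / Q) - \<omega> (\<bar>of_int m\<bar> / (real k * Q))) = 0"
proof -
  let ?A = "{k::nat. 1 \<le> k \<and> real k \<le> Q \<and> int k dvd m}"
  define n where "n = nat \<bar>m\<bar>"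
  have n: "0 < n" "real n = \<bar>of_int m\<bar>" using m by (auto simp: n_def)
  let ?D = "{k. k dvd n}"
  have dvd: "int k dvd m \<longleftrightarrow> k dvd n" for k by (simp add: n_def nat_abs_dvd_iff)
  have D: "finite ?D" using n by simp
  have A: "?A \<subseteq> ?D" by (auto simp: dvd)
  have pos: "1 \<le> k" if "k dvd n" for k using that n by (auto intro: Suc_leI dvd_pos_nat)
  have big: "Q < real k" if "k \<in> ?D - ?A" for k using that pos[of k] by (auto simp: dvd)
  have nQ: "real n \<le> Q ^ 2 / 2" using m(2) Q n by (simp add: abs_divide field_simps)
  have 1: "(\<Sum>k\<in>?A. \<omega> (real k / Q)) = (\<Sum>k\<in>?D. \<omega> (real k / Q))"
  proof (rule sum.mono_neutral_left[OF D A], intro ballI \<omega>_support disjI2)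
    fix k assume "k \<in> ?D - ?A"
    then show "1 < real k / Q" using big[of k] Q by simp
  qed
  have 2: "(\<Sum>k\<in>?A. \<omega> (real n / (real k * Q))) = (\<Sum>k\<in>?D. \<omega> (real n / (real k * Q)))"
  proof (rule sum.mono_neutral_left[OF D A], intro ballI \<omega>_support disjI1)
    fix k assume "k \<in> ?D - ?A"
    then have k: "Q < real k" by (rule big)
    then have "Q * Q < real k * Q" using Q by simp
    then have "real n < 1/2 * (real k * Q)" using nQ by (simp add: power2_eq_square)
    then show "real n / (real k * Q) < 1/2" using k Q by (simp add: divide_less_eq)
  qed
  have inv: "n div (n div k) = k" "n div k \<in> ?D" if "k dvd n" for k
    using that n by (auto simp: dvd_def)
  have 3: "(\<Sum>k\<in>?D. \<omega> (real n / (real k * Q))) = (\<Sum>k\<in>?D. \<omega> (real k / Q))"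
  proof (rule sum.reindex_bij_witness[of _ "\<lambda>k. n div k" "\<lambda>k. n div k"])
    fix k assume k: "k \<in> ?D"
    then obtain l where l: "n = k * l" by (auto simp: dvd_def)
    have kl: "0 < k" "0 < l" using n l by auto
    show "\<omega> (real (n div k) / Q) = \<omega> (real n / (real k * Q))"
      using kl by (auto simp: l)
  qed (use inv in auto)
  show ?thesis using 1 2 3 by (simp add: sum_subtractf n(2))
qed

text \<open>
Grouping the pairs \<open>(q, j)\<close> by the product \<open>k = q j\<close> turns the sum of Ramanujan sums into the condition \<open>k dvd m\<close>.
\<close>

lemma sum_ramanujan_coef:
  assumes Q: "1 \<le> Q"
  shows "(\<Sum>q | 1 \<le> q \<and> real q \<le> Q. ramanujan_sum q m * of_real (coef Q q m)) =
    (if m = 0 then of_real ((\<Sum>k | 1 \<le> k \<and> real k \<le> Q. \<omega> (real k / Q)) / Q) else 0)"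
proof -
  let ?A = "{k::nat. 1 \<le> k \<and> real k \<le> Q}"
  have fin: "finite ?A" by (rule finite_nat_le_real)
  define g where "g k = (\<omega> (real k / Q) - \<omega> (\<bar>of_int m\<bar> / (real k * Q)))" for k :: nat
  define W where "W = w (of_int m / Q ^ 2) / Q"
  have coef: "coef Q q m = W * (\<Sum>j\<in>J (real q / Q). g (q * j) / real (q * j))" if q: "q \<in> ?A" for q
  proof -
    have "(\<omega> (real q / Q * real j) - \<omega> (\<bar>of_int m / Q ^ 2\<bar> / (real q / Q * real j))) / (real q / Q * real j) / Q ^ 2 =
        g (q * j) / real (q * j) / Q" for j
    proof -
      have "\<bar>of_int m / Q ^ 2\<bar> / (real q / Q * real j) = \<bar>of_int m\<bar> / (real (q * j) * Q)"
        "real q / Q * real j = real (q * j) / Q"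
        using Q q by (auto simp: abs_divide power2_eq_square field_simps)
      then show ?thesis unfolding g_def using Q by (simp add: power2_eq_square mult_ac)
    qed
    then have "h (real q / Q) (of_int m / Q ^ 2) / Q ^ 2 = (\<Sum>j\<in>J (real q / Q). g (q * j) / real (q * j)) / Q"
      by (simp add: h_def sum_divide_distrib)
    moreover have "coef Q q m = w (of_int m / Q ^ 2) * (h (real q / Q) (of_int m / Q ^ 2) / Q ^ 2)"
      by (simp add: coef_def)
    ultimately show ?thesis unfolding W_def by simp
  qed
  have J: "j \<in> J (real q / Q) \<longleftrightarrow> 1 \<le> j \<and> q * j \<in> ?A" if "q \<in> ?A" for q j
    using that Q by (subst J_iff) (auto simp: field_simps)
  have "(\<Sum>q\<in>?A. ramanujan_sum q m * of_real (coef Q q m)) =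
      of_real W * (\<Sum>q\<in>?A. \<Sum>j\<in>J (real q / Q). ramanujan_sum q m * of_real (g (q * j) / real (q * j)))"
    by (simp add: coef sum_distrib_left mult_ac)
  also have "(\<Sum>q\<in>?A. \<Sum>j\<in>J (real q / Q). ramanujan_sum q m * of_real (g (q * j) / real (q * j))) =
      (\<Sum>(q, j)\<in>(SIGMA q:?A. J (real q / Q)). ramanujan_sum q m * of_real (g (q * j) / real (q * j)))"
    by (rule sum.Sigma[OF fin]) simp
  also have "\<dots> = (\<Sum>(k, q)\<in>(SIGMA k:?A. {q. q dvd k}). ramanujan_sum q m * of_real (g k / real k))"
  proof (rule sum.reindex_bij_witness[of _ "\<lambda>(k, q). (q, k div q)" "\<lambda>(q, j). (q * j, q)"])
    fix y assume "y \<in> (SIGMA k:?A. {q. q dvd k})"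
    then obtain k q l where y: "y = (k, q)" "k \<in> ?A" "k = q * l" by (auto simp: dvd_def)
    have ql: "0 < q" "0 < l" using y by (auto intro!: Nat.gr0I)
    have "q \<le> k" using y ql by simp
    then have "q \<in> ?A" using y(2) ql by (auto intro: order.trans)
    then show "(\<lambda>(k, q). (q, k div q)) y \<in> (SIGMA q:?A. J (real q / Q))"
      using y ql J[of q l] by auto
    show "(\<lambda>(q, j). (q * j, q)) ((\<lambda>(k, q). (q, k div q)) y) = y" using y by simp
  qed (use J in auto)
  also have "\<dots> = (\<Sum>k\<in>?A. \<Sum>q | q dvd k. ramanujan_sum q m * of_real (g k / real k))"
    by (rule sum.Sigma[symmetric, OF fin]) auto
  also have "\<dots> = (\<Sum>k\<in>?A. (if int k dvd m then of_nat k else 0) * of_real (g k / real k))"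
    unfolding sum_distrib_right[symmetric] by (intro sum.cong refl) (simp add: sum_ramanujan_sum_divisors)
  also have "\<dots> = (\<Sum>k\<in>?A. if int k dvd m then of_real (g k) else 0)"
    by (intro sum.cong) auto
  also have "\<dots> = of_real (\<Sum>k\<in>?A \<inter> {k. int k dvd m}. g k)"
    unfolding of_real_sum sum.inter_restrict[OF fin] by (intro sum.cong) auto
  finally have eq: "(\<Sum>q\<in>?A. ramanujan_sum q m * of_real (coef Q q m)) =
      of_real (W * (\<Sum>k\<in>?A \<inter> {k. int k dvd m}. g k))" by simp
  show ?thesis
  proof (cases "m = 0")
    case True
    then show ?thesis unfolding eq using \<omega>_support[of 0] by (simp add: g_def W_def w_0)
  next
    case False
    have "W * (\<Sum>k\<in>?A \<inter> {k. int k dvd m}. g k) = 0"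
    proof (cases "\<bar>of_int m / Q ^ 2\<bar> \<le> 1/2")
      case True
      have "?A \<inter> {k. int k dvd m} = {k. 1 \<le> k \<and> real k \<le> Q \<and> int k dvd m}" by auto
      then show ?thesis using sum_divisors_switch[OF Q \<open>m \<noteq> 0\<close> True] by (simp add: g_def)
    next
      case False
      then have "w (of_int m / Q ^ 2) = 0" using w_support by (force simp: abs_le_iff)
      then show ?thesis by (simp add: W_def)
    qed
    then show ?thesis unfolding eq by (simp only: False if_False of_real_0)
  qed
qed

text \<open>
The approximation of \<open>\<delta>(m)\<close>, uniformly in \<open>m\<close>. The trivial bound \<open>\<bar>c\<^sub>q(m)\<bar> \<le> q\<close> loses a
factor \<open>Q\<^sup>2\<close>, which the choice of \<open>n\<close> absorbs.
\<close>

lemma delta_approx: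
  assumes \<theta>: "0 < \<theta>"
  shows "\<exists>C\<ge>0. \<forall>Q\<ge>1. \<forall>m.
    norm ((if m = 0 then 1 else 0) - (\<Sum>q | 1 \<le> q \<and> real q \<le> Q. ramanujan_sum q m * truncated \<theta> Q q m))
      \<le> C * Q powr (- N * \<theta>)"
proof -
  \<comment> \<open>The summand \<open>2 / \<theta>\<close> pays for the factor \<open>Q\<^sup>2\<close>.\<close>
  define n where "n = nat \<lceil>N + 2 / \<theta>\<rceil>"
  define k where "k = nat \<lceil>N * \<theta>\<rceil>"
  obtain C where C: "0 \<le> C" "\<And>Q q m. 1 \<le> Q \<Longrightarrow> 1 \<le> q \<Longrightarrow> real q \<le> Q \<Longrightarrow>
      norm (truncated \<theta> Q q m - of_real (coef Q q m)) \<le> C * Q powr (- \<theta> * (real n + 2))"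
    using truncated_approx[OF \<theta>, of n] by blast
  obtain D where D: "0 \<le> D" "\<And>Q. 1 \<le> Q \<Longrightarrow>
      \<bar>(\<Sum>k | 1 \<le> k \<and> real k \<le> Q. \<omega> (real k / Q)) / Q - 1\<bar> \<le> D * (1 / Q) ^ k"
    using sum_\<omega>_near_1[of k] by blast
  have "norm ((if m = 0 then 1 else 0) - (\<Sum>q | 1 \<le> q \<and> real q \<le> Q. ramanujan_sum q m * truncated \<theta> Q q m))
      \<le> (C + D) * Q powr (- N * \<theta>)" if Q: "1 \<le> Q" for Q m
  proof -
    let ?A = "{q::nat. 1 \<le> q \<and> real q \<le> Q}"
    define \<delta> where "\<delta> = (if m = 0 then 1 else 0 :: complex)"
    define S where "S = (\<Sum>k\<in>?A. \<omega> (real k / Q)) / Q"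
    have main: "(\<Sum>q\<in>?A. ramanujan_sum q m * of_real (coef Q q m)) = \<delta> * of_real S"
      using sum_ramanujan_coef[OF Q, of m] by (simp add: \<delta>_def S_def)
    have 1: "norm (\<delta> - \<delta> * of_real S) \<le> D * Q powr (- N * \<theta>)"
    proof -
      have "\<delta> - \<delta> * of_real S = \<delta> * of_real (1 - S)" by (simp add: algebra_simps)
      then have "norm (\<delta> - \<delta> * of_real S) = norm \<delta> * \<bar>1 - S\<bar>" by (simp only: norm_mult norm_of_real)
      also have "\<dots> \<le> 1 * \<bar>1 - S\<bar>" by (intro mult_right_mono) (auto simp: \<delta>_def)
      also have "\<dots> \<le> D * (1 / Q) ^ k" using D(2)[OF Q] by (simp add: S_def abs_minus_commute)
      also have "(1 / Q) ^ k = Q powr (- real k)" using Q by (simp add: powr_minus powr_realpow power_inverse divide_inverse)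
      also have "D * Q powr (- real k) \<le> D * Q powr (- N * \<theta>)"
      proof (intro mult_left_mono powr_mono)
        show "- real k \<le> - N * \<theta>" unfolding k_def by linarith
      qed (use D Q in auto)
      finally show ?thesis .
    qed
    have 2: "norm (\<Sum>q\<in>?A. ramanujan_sum q m * (of_real (coef Q q m) - truncated \<theta> Q q m)) \<le> C * Q powr (- N * \<theta>)"
    proof -
      have "norm (\<Sum>q\<in>?A. ramanujan_sum q m * (of_real (coef Q q m) - truncated \<theta> Q q m))
          \<le> (\<Sum>q\<in>?A. real q * (C * Q powr (- \<theta> * (real n + 2))))"
      proof (rule sum_norm_le)
        fix q assume "q \<in> ?A"
        then show "norm (ramanujan_sum q m * (of_real (coef Q q m) - truncated \<theta> Q q m))
            \<le> real q * (C * Q powr (- \<theta> * (real n + 2)))"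
          using C(2)[OF Q, of q m] unfolding norm_mult
          by (intro mult_mono norm_ramanujan_sum_le) (auto simp: norm_minus_commute)
      qed
      also have "\<dots> = (\<Sum>q\<in>?A. real q) * (C * Q powr (- \<theta> * (real n + 2)))"
        by (rule sum_distrib_right[symmetric])
      also have "\<dots> \<le> Q ^ 2 * (C * Q powr (- \<theta> * (real n + 2)))"
        using C by (intro mult_right_mono sum_nat_le_square[OF Q]) auto
      also have "\<dots> = C * Q powr (2 - \<theta> * (real n + 2))"
        using Q by (simp add: powr_diff powr_minus divide_inverse)
      also have "\<dots> \<le> C * Q powr (- N * \<theta>)"
      proof (intro mult_left_mono powr_mono)
        have "N + 2 / \<theta> \<le> real n" unfolding n_def by linarith
        then have "\<theta> * (N + 2 / \<theta>) \<le> \<theta> * (real n + 2)" using \<theta> by (intro mult_left_mono) auto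
        then show "2 - \<theta> * (real n + 2) \<le> - N * \<theta>" using \<theta> by (simp add: algebra_simps)
      qed (use C Q in auto)
      finally show ?thesis .
    qed
    have split: "\<delta> - (\<Sum>q\<in>?A. ramanujan_sum q m * truncated \<theta> Q q m) =
        (\<delta> - \<delta> * of_real S) + (\<Sum>q\<in>?A. ramanujan_sum q m * (of_real (coef Q q m) - truncated \<theta> Q q m))"
      by (simp add: main[symmetric] right_diff_distrib sum_subtractf)
    have "norm (\<delta> - (\<Sum>q\<in>?A. ramanujan_sum q m * truncated \<theta> Q q m)) \<le>
        D * Q powr (- N * \<theta>) + C * Q powr (- N * \<theta>)"
      unfolding split by (rule norm_triangle_le[OF add_mono[OF 1 2]])
    then show ?thesis by (simp add: \<delta>_def algebra_simps)
  qed
  then show ?thesis using C D by (intro exI[of _ "C + D"]) auto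
qed

end

section \<open>Summation over integer vectors\<close>

lemma weight_bounds:
  assumes W: "weight n W"
  obtains R B where "0 \<le> R" "0 \<le> B"
    "\<And>x. x \<in> topspace (Euclidean_space n) \<Longrightarrow> \<bar>W x\<bar> \<le> B"
    "\<And>x i. x \<in> topspace (Euclidean_space n) \<Longrightarrow> W x \<noteq> 0 \<Longrightarrow> \<bar>x i\<bar> \<le> R"
proof -
  let ?E = "Euclidean_space n"
  let ?U = "{x \<in> topspace ?E. W x \<noteq> 0}"
  let ?S = "?E closure_of ?U"
  have cpt: "compactin ?E ?S" using W by (simp add: weight_def compact_support_def)
  have sub: "?U \<subseteq> ?S" by (rule closure_of_subset) auto
  have bdd: "\<exists>B\<ge>0. \<forall>x\<in>?U. \<bar>f x\<bar> \<le> B" if "continuous_map ?E euclideanreal f" for f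
  proof -
    have "compact (f ` ?S)" using image_compactin[OF cpt that] by simp
    then obtain B where "\<forall>y\<in>f ` ?S. norm y \<le> B" using compact_imp_bounded bounded_iff by blast
    then have "\<forall>x\<in>?U. \<bar>f x\<bar> \<le> max 0 B" using sub by (force simp: max_def)
    then show ?thesis by (intro exI[of _ "max 0 B"]) auto
  qed
  have "continuous_map ?E euclideanreal (foldr partial [] W)"
    using W unfolding weight_def smooth_on_space_def by (metis empty_set empty_subsetI)
  then obtain B where B: "0 \<le> B" "\<forall>x\<in>?U. \<bar>W x\<bar> \<le> B" using bdd[of W] by auto
  have "continuous_map ?E euclideanreal (\<lambda>x. x i)" for i
    unfolding Euclidean_space_def
    by (rule continuous_map_from_subtopology) (rule continuous_map_product_projection, simp)
  then have "\<forall>i. \<exists>R\<ge>0. \<forall>x\<in>?U. \<bar>x i\<bar> \<le> R" using bdd by blast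
  then obtain R where R: "\<And>i. 0 \<le> R i" "\<And>i x. x \<in> ?U \<Longrightarrow> \<bar>x i\<bar> \<le> R i" by metis
  show ?thesis
  proof
    show "0 \<le> (\<Sum>i<n. R i)" using R by (intro sum_nonneg)
    show "0 \<le> B" by fact
    show "\<bar>W x\<bar> \<le> B" if "x \<in> topspace ?E" for x
      using B that by (cases "W x = 0") auto
    show "\<bar>x i\<bar> \<le> (\<Sum>i<n. R i)" if "x \<in> topspace ?E" "W x \<noteq> 0" for x i
    proof (cases "i < n")
      case True
      then have "R i \<le> (\<Sum>i<n. R i)" using R by (intro member_le_sum) auto
      then show ?thesis using R(2)[of x i] that by simp
    next
      case False
      then have "x i = 0" using that by (simp add: topspace_Euclidean_space)
      then show ?thesis using R by (simp add: sum_nonneg)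
    qed
  qed
qed

lemma card_int_box_le:
  fixes k :: real
  assumes "0 \<le> k"
  shows "finite {x \<in> int_vecs n. \<forall>i. \<bar>real_of_int (x i)\<bar> \<le> k}"
    and "real (card {x \<in> int_vecs n. \<forall>i. \<bar>real_of_int (x i)\<bar> \<le> k}) \<le> (2 * k + 1) ^ n"
proof -
  let ?X = "{x \<in> int_vecs n. \<forall>i. \<bar>real_of_int (x i)\<bar> \<le> k}"
  let ?Y = "{..<n} \<rightarrow>\<^sub>E {-\<lfloor>k\<rfloor>..\<lfloor>k\<rfloor>}"
  have inj: "inj_on (\<lambda>x. restrict x {..<n}) ?X"
  proof (rule inj_onI)
    fix x y assume xy: "x \<in> ?X" "y \<in> ?X" and eq: "restrict x {..<n} = restrict y {..<n}"
    show "x = y"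
    proof
      fix i
      have "restrict x {..<n} i = restrict y {..<n} i" by (rule fun_cong[OF eq])
      then show "x i = y i" using xy by (cases "i < n") (auto simp: int_vecs_def)
    qed
  qed
  have "(\<lambda>x. restrict x {..<n}) ` ?X \<subseteq> ?Y"
  proof (intro image_subsetI PiE_I)
    fix x i assume "x \<in> ?X"
    then have "of_int (x i) \<le> k" "of_int (- x i) \<le> k" using abs_le_iff by force+
    then have "x i \<le> \<lfloor>k\<rfloor>" "- x i \<le> \<lfloor>k\<rfloor>" by (simp_all only: le_floor_iff)
    moreover assume "i \<in> {..<n}"
    ultimately show "restrict x {..<n} i \<in> {-\<lfloor>k\<rfloor>..\<lfloor>k\<rfloor>}" by auto
  qed auto
  moreover have fin: "finite ?Y" by (intro finite_PiE) auto
  ultimately have *: "finite ?X" "card ?X \<le> card ?Y"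
    using inj by (meson finite_imageD finite_subset, meson card_inj_on_le)
  show "finite ?X" by fact
  have "0 \<le> \<lfloor>k\<rfloor>" using assms by simp
  then have "real (card ?Y) = (2 * of_int \<lfloor>k\<rfloor> + 1) ^ n" by (simp add: card_PiE)
  also have "\<dots> \<le> (2 * k + 1) ^ n" using assms by (intro power_mono) auto
  finally show "real (card ?X) \<le> (2 * k + 1) ^ n" using * by linarith
qed

lemma weight_sum_bound:
  assumes W: "weight n W"
  obtains C where "0 \<le> C"
    "\<And>P. 1 \<le> P \<Longrightarrow> finite {x \<in> int_vecs n. W (\<lambda>i. of_int (x i) / P) \<noteq> 0}"
    "\<And>P. 1 \<le> P \<Longrightarrow> (\<Sum>x | x \<in> int_vecs n \<and> W (\<lambda>i. of_int (x i) / P) \<noteq> 0. \<bar>W (\<lambda>i. of_int (x i) / P)\<bar>) \<le> C * P ^ n"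
proof -
  obtain R B where RB: "0 \<le> R" "0 \<le> B"
    "\<And>x. x \<in> topspace (Euclidean_space n) \<Longrightarrow> \<bar>W x\<bar> \<le> B"
    "\<And>x i. x \<in> topspace (Euclidean_space n) \<Longrightarrow> W x \<noteq> 0 \<Longrightarrow> \<bar>x i\<bar> \<le> R"
    using weight_bounds[OF W] by metis
  have top: "(\<lambda>i. of_int (x i) / P) \<in> topspace (Euclidean_space n)" if "x \<in> int_vecs n" for x P
    using that by (simp add: int_vecs_def topspace_Euclidean_space)
  let ?X = "\<lambda>P. {x \<in> int_vecs n. W (\<lambda>i. of_int (x i) / P) \<noteq> 0}"
  have sub: "?X P \<subseteq> {x \<in> int_vecs n. \<forall>i. \<bar>real_of_int (x i)\<bar> \<le> R * P}" if "1 \<le> P" for P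
  proof safe
    fix x i assume "x \<in> int_vecs n" "W (\<lambda>i. of_int (x i) / P) \<noteq> 0"
    then have "\<bar>of_int (x i) / P\<bar> \<le> R" using RB(4)[OF top] by blast
    then show "\<bar>real_of_int (x i)\<bar> \<le> R * P" using that by (simp add: field_simps)
  qed
  show ?thesis
  proof
    show "0 \<le> B * (2 * R + 1) ^ n" using RB by simp
    fix P :: real assume P: "1 \<le> P"
    have RP: "0 \<le> R * P" using RB P by simp
    show fin: "finite (?X P)" by (rule finite_subset[OF sub[OF P] card_int_box_le(1)[OF RP]])
    have "(\<Sum>x\<in>?X P. \<bar>W (\<lambda>i. of_int (x i) / P)\<bar>) \<le> real (card (?X P)) * B"
      by (rule sum_bounded_above) (use RB(3)[OF top] in auto)
    also have "\<dots> \<le> (2 * (R * P) + 1) ^ n * B"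
      using card_mono[OF card_int_box_le(1)[OF RP] sub[OF P]] card_int_box_le(2)[OF RP] RB
      by (intro mult_right_mono) (auto intro: order.trans[OF of_nat_mono])
    also have "\<dots> \<le> ((2 * R + 1) * P) ^ n * B"
      using P RB RP by (intro mult_right_mono power_mono) (auto simp: algebra_simps)
    finally show "(\<Sum>x | x \<in> int_vecs n \<and> W (\<lambda>i. of_int (x i) / P) \<noteq> 0. \<bar>W (\<lambda>i. of_int (x i) / P)\<bar>)
        \<le> B * (2 * R + 1) ^ n * P ^ n" by (simp add: power_mult_distrib mult_ac)
  qed
qed

context delta_weights
begin

text \<open>
Both terms on the left are sums over the finitely many integer vectors \<open>x\<close> in the support of the
weight; the contribution of \<open>x\<close> depends only on the weight at \<open>x\<close> and on the integer \<open>F(x)\<close>.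
\<close>

lemma circle_method_identity:
  assumes fin: "finite {x \<in> int_vecs n. W (\<lambda>i. of_int (x i) / P) \<noteq> 0}" (is "finite ?X")
    and Q: "1 \<le> Q"
  shows "complex_of_real (N_count n W F P) - (\<Sum>q | 1 \<le> q \<and> real q \<le> Q.
      LINT z:{z. \<bar>z\<bar> < (real q * Q) powr (-1 + \<theta>)}|lborel. complex_of_real (p Q q z) * exp_sum_q n W F P q z) =
    (\<Sum>x\<in>?X. of_real (W (\<lambda>i. of_int (x i) / P)) * ((if poly_eval F x = 0 then 1 else 0) -
      (\<Sum>q | 1 \<le> q \<and> real q \<le> Q. ramanujan_sum q (poly_eval F x) * truncated \<theta> Q q (poly_eval F x))))"
proof -
  define c where "c x = W (\<lambda>i. of_int (x i) / P)" for x
  let ?A = "{q::nat. 1 \<le> q \<and> real q \<le> Q}"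
  define X where "X = {x \<in> int_vecs n. W (\<lambda>i. of_int (x i) / P) \<noteq> 0}"
  have X: "finite X" "X = {x \<in> int_vecs n. c x \<noteq> 0}" using fin by (auto simp: X_def c_def)
  have "N_count n W F P = (\<Sum>\<^sub>\<infinity>x\<in>X. if poly_eval F x = 0 then c x else 0)"
    unfolding N_count_def c_def[symmetric] by (rule infsum_cong_neutral) (auto simp: X(2))
  also have "\<dots> = (\<Sum>x\<in>X. if poly_eval F x = 0 then c x else 0)" using X(1) by simp
  finally have 1: "complex_of_real (N_count n W F P) =
      (\<Sum>x\<in>X. of_real (c x) * (if poly_eval F x = 0 then 1 else 0))"
    by (simp add: if_distrib cong: if_cong)
  have S: "exp_sum n W F P \<alpha> = (\<Sum>x\<in>X. of_real (c x) * e (\<alpha> * of_int (poly_eval F x)))" for \<alpha>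
  proof -
    have "exp_sum n W F P \<alpha> = (\<Sum>\<^sub>\<infinity>x\<in>X. of_real (c x) * e (\<alpha> * of_int (poly_eval F x)))"
      unfolding exp_sum_def c_def[symmetric] by (rule infsum_cong_neutral) (auto simp: X(2))
    then show ?thesis using X(1) by simp
  qed
  have e_split: "e ((real a / real q + z) * of_int m) = e (real a / real q * of_int m) * e (of_int m * z)" for a q z m
    by (simp add: distrib_right e_add mult.commute[of z])
  have Sq: "exp_sum_q n W F P q z =
      (\<Sum>x\<in>X. of_real (c x) * ramanujan_sum q (poly_eval F x) * e (of_int (poly_eval F x) * z))" for q z
    unfolding exp_sum_q_def S ramanujan_sum_def e_split
    by (subst sum.swap) (simp add: sum_distrib_left sum_distrib_right mult.assoc)
  have 2: "(LINT z:{z. \<bar>z\<bar> < (real q * Q) powr (-1 + \<theta>)}|lborel. complex_of_real (p Q q z) * exp_sum_q n W F P q z) =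
      (\<Sum>x\<in>X. of_real (c x) * ramanujan_sum q (poly_eval F x) * truncated \<theta> Q q (poly_eval F x))" for q
  proof -
    define T where "T = {z. \<bar>z\<bar> < (real q * Q) powr (-1 + \<theta>)}"
    have "T = {- ((real q * Q) powr (-1 + \<theta>))<..<(real q * Q) powr (-1 + \<theta>)}"
      by (auto simp: T_def abs_less_iff)
    then have T: "T \<in> sets lborel" by simp
    have int: "integrable lborel (\<lambda>z. indicator T z *\<^sub>R (of_real (p Q q z) * e (of_int m * z)))" for m
      by (rule integrable_mult_indicator[OF T p_fourier(1)[OF Q]])
    have "indicator T z *\<^sub>R (complex_of_real (p Q q z) * exp_sum_q n W F P q z) =
        (\<Sum>x\<in>X. of_real (c x) * ramanujan_sum q (poly_eval F x) *
          (indicator T z *\<^sub>R (of_real (p Q q z) * e (of_int (poly_eval F x) * z))))" for z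
      by (simp add: Sq sum_distrib_left scaleR_sum_right mult_ac scaleR_conv_of_real)
    then have "(LINT z:T|lborel. complex_of_real (p Q q z) * exp_sum_q n W F P q z) =
        (LINT z|lborel. (\<Sum>x\<in>X. of_real (c x) * ramanujan_sum q (poly_eval F x) *
          (indicator T z *\<^sub>R (of_real (p Q q z) * e (of_int (poly_eval F x) * z)))))"
      by (simp add: set_lebesgue_integral_def)
    also have "\<dots> = (\<Sum>x\<in>X. of_real (c x) * ramanujan_sum q (poly_eval F x) *
        (LINT z|lborel. indicator T z *\<^sub>R (of_real (p Q q z) * e (of_int (poly_eval F x) * z))))"
      by (subst Bochner_Integration.integral_sum) (intro integrable_mult_right int, simp only: integral_mult_right_zero)
    finally show ?thesis by (simp only: T_def truncated_def set_lebesgue_integral_def)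
  qed
  have 3: "(\<Sum>q\<in>?A. \<Sum>x\<in>X. of_real (c x) * ramanujan_sum q (poly_eval F x) * truncated \<theta> Q q (poly_eval F x)) =
      (\<Sum>x\<in>X. of_real (c x) * (\<Sum>q\<in>?A. ramanujan_sum q (poly_eval F x) * truncated \<theta> Q q (poly_eval F x)))"
    by (subst sum.swap) (simp add: sum_distrib_left mult.assoc)
  show ?thesis
    unfolding c_def[symmetric] X(2)[symmetric] 1 2 3 right_diff_distrib sum_subtractf ..
qed

lemma delta_method:
  assumes W: "weight n W" and \<theta>: "0 < \<theta>"
  shows "\<exists>C. \<forall>F. \<forall>Q\<ge>1. \<forall>P\<ge>1.
    norm (complex_of_real (N_count n W F P) - (\<Sum>q | 1 \<le> q \<and> real q \<le> Q.
      LINT z:{z. \<bar>z\<bar> < (real q * Q) powr (-1 + \<theta>)}|lborel. complex_of_real (p Q q z) * exp_sum_q n W F P q z))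
    \<le> C * Q powr (- N * \<theta>) * P ^ n"
proof -
  obtain C where C: "0 \<le> C" "\<And>P. 1 \<le> P \<Longrightarrow> finite {x \<in> int_vecs n. W (\<lambda>i. of_int (x i) / P) \<noteq> 0}"
    "\<And>P. 1 \<le> P \<Longrightarrow> (\<Sum>x | x \<in> int_vecs n \<and> W (\<lambda>i. of_int (x i) / P) \<noteq> 0. \<bar>W (\<lambda>i. of_int (x i) / P)\<bar>) \<le> C * P ^ n"
    using weight_sum_bound[OF W] by blast
  obtain D where D: "0 \<le> D" "\<And>Q m. 1 \<le> Q \<Longrightarrow>
    norm ((if m = 0 then 1 else 0) - (\<Sum>q | 1 \<le> q \<and> real q \<le> Q. ramanujan_sum q m * truncated \<theta> Q q m))
      \<le> D * Q powr (- N * \<theta>)"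
    using delta_approx[OF \<theta>, of N] by blast
  show ?thesis
  proof (intro exI allI impI)
    fix F Q P assume Q: "1 \<le> (Q::real)" and P: "1 \<le> (P::real)"
    let ?X = "{x \<in> int_vecs n. W (\<lambda>i. of_int (x i) / P) \<noteq> 0}"
    show "norm (complex_of_real (N_count n W F P) - (\<Sum>q | 1 \<le> q \<and> real q \<le> Q.
        LINT z:{z. \<bar>z\<bar> < (real q * Q) powr (-1 + \<theta>)}|lborel. complex_of_real (p Q q z) * exp_sum_q n W F P q z))
      \<le> C * D * Q powr (- N * \<theta>) * P ^ n" (is "norm ?L \<le> _")
    proof -
      have "norm ?L \<le> (\<Sum>x\<in>?X. \<bar>W (\<lambda>i. of_int (x i) / P)\<bar> * (D * Q powr (- N * \<theta>)))"
        unfolding circle_method_identity[OF C(2)[OF P] Q]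
      proof (rule sum_norm_le)
        fix x
        show "norm (complex_of_real (W (\<lambda>i. of_int (x i) / P)) * ((if poly_eval F x = 0 then 1 else 0) -
            (\<Sum>q | 1 \<le> q \<and> real q \<le> Q. ramanujan_sum q (poly_eval F x) * truncated \<theta> Q q (poly_eval F x))))
          \<le> \<bar>W (\<lambda>i. of_int (x i) / P)\<bar> * (D * Q powr (- N * \<theta>))"
          unfolding norm_mult norm_of_real by (rule mult_left_mono[OF D(2)[OF Q] abs_ge_zero])
      qed
      also have "\<dots> = (\<Sum>x\<in>?X. \<bar>W (\<lambda>i. of_int (x i) / P)\<bar>) * (D * Q powr (- N * \<theta>))"
        by (rule sum_distrib_right[symmetric])
      also have "\<dots> \<le> (C * P ^ n) * (D * Q powr (- N * \<theta>))"
        using C(3)[OF P] D(1) by (intro mult_right_mono) auto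
      finally show ?thesis by (simp add: mult_ac)
    qed
  qed
qed

end

theorem proposition1p3:
  shows "\<exists>p :: real \<Rightarrow> nat \<Rightarrow> real \<Rightarrow> real.
    (\<forall>Q\<ge>1. \<forall>q::nat. 1 \<le> q \<and> real q \<le> Q \<longrightarrow> smooth (p Q q)) \<and>
    (\<forall>N::real. N \<ge> 0 \<longrightarrow> (\<exists>C::real. \<forall>Q\<ge>1. \<forall>q::nat. 1 \<le> q \<and> real q \<le> Q \<longrightarrow>
       (\<forall>z. \<bar>p Q q z\<bar> \<le> C))) \<and>
    (\<forall>N::real. N \<ge> 0 \<longrightarrow> (\<exists>C::real. \<forall>Q\<ge>1. \<forall>q::nat. 1 \<le> q \<and> real q \<le> Q \<longrightarrow>
       (\<forall>z. \<bar>z\<bar> \<le> 1 / Q ^ 2 \<longrightarrow> \<bar>p Q q z - 1\<bar> \<le> C * (real q / Q) powr N))) \<and>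
    (\<forall>(n::nat) W. weight n W \<longrightarrow>
      (\<forall>(\<theta>::real) (N::real). \<theta> > 0 \<and> N \<ge> 0 \<longrightarrow>
        (\<exists>C::real. \<forall>F. poly_in_vars n F \<and> homogeneous 4 F \<longrightarrow>
          (\<forall>Q\<ge>1. \<forall>P::real. P \<ge> 1 \<longrightarrow>
            norm (complex_of_real (N_count n W F P) -
                  (\<Sum>q::nat | 1 \<le> q \<and> real q \<le> Q.
                     LINT z:{z::real. \<bar>z\<bar> < (real q * Q) powr (-1 + \<theta>)}|lborel.
                       complex_of_real (p Q q z) * exp_sum_q n W F P q z))
            \<le> C * Q powr (- N * \<theta>) * P ^ n))))"
proof -
  obtain w b \<psi> where weights: "delta_weights w b \<psi>" using delta_weights_exist by blast
  define p where "p = delta_weights.p w b \<psi>"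
  note p_smooth = delta_weights.p_smooth[OF weights, folded p_def]
  note p_bound = delta_weights.p_bound[OF weights, folded p_def]
  note p_near_0 = delta_weights.p_near_0[OF weights, folded p_def]
  note delta_method = delta_weights.delta_method[OF weights, folded p_def]
  have near: "\<exists>C::real. \<forall>Q\<ge>1. \<forall>q::nat. 1 \<le> q \<and> real q \<le> Q \<longrightarrow>
      (\<forall>z. \<bar>z\<bar> \<le> 1 / Q ^ 2 \<longrightarrow> \<bar>p Q q z - 1\<bar> \<le> C * (real q / Q) powr N)" for N :: real
  proof -
    obtain C where C: "0 \<le> C" "\<And>Q q z. 1 \<le> Q \<Longrightarrow> 1 \<le> q \<Longrightarrow> real q \<le> Q \<Longrightarrow> \<bar>z\<bar> \<le> 1 / Q ^ 2 \<Longrightarrow>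
        \<bar>p Q q z - 1\<bar> \<le> C * (real q / Q) ^ nat \<lceil>N\<rceil>"
      using p_near_0[of "nat \<lceil>N\<rceil>"] by blast
    have "\<bar>p Q q z - 1\<bar> \<le> C * (real q / Q) powr N"
      if Q: "1 \<le> Q" and q: "1 \<le> q" "real q \<le> Q" and z: "\<bar>z\<bar> \<le> 1 / Q ^ 2" for Q q z
    proof -
      have "(real q / Q) ^ nat \<lceil>N\<rceil> = (real q / Q) powr real (nat \<lceil>N\<rceil>)"
        using Q q by (intro powr_realpow[symmetric]) auto
      also have "\<dots> \<le> (real q / Q) powr N"
        using Q q by (intro powr_mono') (auto simp: real_nat_ceiling_ge)
      finally have "C * (real q / Q) ^ nat \<lceil>N\<rceil> \<le> C * (real q / Q) powr N"
        using C by (intro mult_left_mono)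
      then show ?thesis using C(2)[OF Q q z] by linarith
    qed
    then show ?thesis by blast
  qed
  show ?thesis
  proof (intro exI[of _ p] conjI allI impI)
    show "smooth (p Q q)" for Q q by (rule p_smooth)
    show "\<exists>C::real. \<forall>Q\<ge>1. \<forall>q::nat. 1 \<le> q \<and> real q \<le> Q \<longrightarrow> (\<forall>z. \<bar>p Q q z\<bar> \<le> C)"
      using p_bound by blast
  next
    fix N :: real
    show "\<exists>C::real. \<forall>Q\<ge>1. \<forall>q::nat. 1 \<le> q \<and> real q \<le> Q \<longrightarrow>
       (\<forall>z. \<bar>z\<bar> \<le> 1 / Q ^ 2 \<longrightarrow> \<bar>p Q q z - 1\<bar> \<le> C * (real q / Q) powr N)" by (rule near)
  next
    fix n :: nat and W and \<theta> N :: real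
    assume "weight n W" "\<theta> > 0 \<and> N \<ge> 0"
    then show "\<exists>C::real. \<forall>F. poly_in_vars n F \<and> homogeneous 4 F \<longrightarrow>
          (\<forall>Q\<ge>1. \<forall>P::real. P \<ge> 1 \<longrightarrow>
            norm (complex_of_real (N_count n W F P) -
                  (\<Sum>q::nat | 1 \<le> q \<and> real q \<le> Q.
                     LINT z:{z::real. \<bar>z\<bar> < (real q * Q) powr (-1 + \<theta>)}|lborel.
                       complex_of_real (p Q q z) * exp_sum_q n W F P q z))
            \<le> C * Q powr (- N * \<theta>) * P ^ n)"
      using delta_method[of n W \<theta> N] by blast
  qed
qed

end
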